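(* Let $R$ and $S$ be rings. (1) If $L$ is a right $R$-module, $M$ an $R$-$S$-bimodule and $N$ an injective right $S$-module, then $$\operatorname{Ext}^{\mathcal{WF}}_n(L,\operatorname{Hom}_S(M,N))\cong \operatorname{Hom}_S(\operatorname{Tor}^n_{\mathcal{W}}(L,M),N)$$ for any non-negative integer $n$. (2) If $L$ is an $S$-$R$-bimodule, $M$ a left $R$-module and $N$ an injective left $S$-module, then $$\operatorname{Ext}^{\mathcal{WI}}_n(M,\operatorname{Hom}_S(L,N))\cong \operatorname{Hom}_S(\operatorname{Tor}^n_{\mathcal{W}}(L,M),N)$$ for any non-negative integer $n$.
   Context: Rings are associative with identity and modules are unitary. An $A$-$B$-bimodule is a left $A$-, right $B$-bimodule. A left $R$-module $F$ is super finitely presented if there is an exact sequence $\cdots\to F_1\to F_0\to F\to 0$ with each $F_i$ finitely generated projective. A left $R$-module $M$ is weak injective if $\operatorname{Ext}^1_R(F,M)=0$ for every super finitely presented left $R$-module $F$; a right $R$-module $M$ is weak flat if $\operatorname{Tor}_1^R(M,F)=0$ for every super finitely presented left $R$-module $F$. $\mathcal{WI}$ is the class of weak injective left $R$-modules and $\mathcal{WF}$ the class of weak flat right $R$-modules. For a class $\mathcal C$ (either $\mathcal{WI}$ or $\mathcal{WF}$), a right $\mathcal C$-resolution of $M$ is a complex $0\to M\to W^0\to W^1\to\cdots$ with all $W^i\in\mathcal C$ which becomes exact after applying $\operatorname{Hom}_R(-,W)$ for every $W\in\mathcal C$; a left $\mathcal C$-resolution of $M$ is a complex $\cdots\to W_1\to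 W_0\to M\to 0$ with all $W_i\in\mathcal C$ which becomes exact after applying $\operatorname{Hom}_R(W,-)$ for every $W\in\mathcal C$. It is known that every left $R$-module has left and right $\mathcal{WI}$-resolutions and every right $R$-module has left and right $\mathcal{WF}$-resolutions. A deleted resolution is one with the term $M$ removed. For left $R$-modules $M,N$, $\operatorname{Ext}^{\mathcal{WI}}_n(M,N)$ is $H_n(\operatorname{Hom}_R(W^\bullet,N))$ with $W^\bullet$ a deleted right $\mathcal{WI}$-resolution of $M$, or equivalently $H_n(\operatorname{Hom}_R(M,W_\bullet))$ with $W_\bullet$ a deleted left $\mathcal{WI}$-resolution of $N$ (the two are known to agree). For right $R$-modules $M,N$, $\operatorname{Ext}^{\mathcal{WF}}_n(M,N)$ is defined in the same way with $\mathcal{WF}$ in place of $\mathcal{WI}$. For a right $R$-module $M$ and a left $R$-module $N$, $\operatorname{Tor}^n_{\mathcal W}(M,N)$ is $H^n(W^\bullet\otimes_R N)$ with $W^\bullet$ a deleted right $\mathcal{WF}$-resolution of $M$, or equivalently $H^n(M\otimes_R V^\bullet)$ with $V^\bullet$ a deleted right $\mathcal{WI}$-resolution of $N$ (known to agree). In the statement all these functors are taken over $R$; $\operatorname{Tor}^n_{\mathcal W}(L,M)$ carries the $S$-module structure induced from that of the bimodule argument. Isomorphisms are of abelian groups. *)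

theory Defs
  imports "HOL-Algebra.Module" "HOL-Algebra.AbelCoset" "HOL-Algebra.Generated_Groups"
    "HOL-Algebra.Free_Abelian_Groups"
begin

text \<open>
  The library's locale \<open>module\<close> requires a commutative ring, so modules over an arbitrary ring are
  introduced here; the record type \<open>('r, 'm) module\<close> is reused.  A right module is stored in the same
  record type, with \<open>r \<odot>\<^bsub>M\<^esub> x\<close> standing for the right action \<open>x r\<close>; only the associativity law
  differs from that of a left module.
\<close>

locale left_module = R?: ring R + M?: abelian_group M 
    for R :: "('a, 'x) ring_scheme" (structure) and M :: "('a, 'm, 'y) module_scheme" (structure) +
  assumes smult_closed:
      "\<lbrakk>a \<in> carrier R; x \<in> carrier M\<rbrakk> \<Longrightarrow> a \<odot>\<^bsub>M\<^esub> x \<in> carrier M"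
    and smult_l_distr:
      "\<lbrakk>a \<in> carrier R; b \<in> carrier R; x \<in> carrier M\<rbrakk> \<Longrightarrow>
       (a \<oplus>\<^bsub>R\<^esub> b) \<odot>\<^bsub>M\<^esub> x = a \<odot>\<^bsub>M\<^esub> x \<oplus>\<^bsub>M\<^esub> b \<odot>\<^bsub>M\<^esub> x"
    and smult_r_distr:
      "\<lbrakk>a \<in> carrier R; x \<in> carrier M; y \<in> carrier M\<rbrakk> \<Longrightarrow>
       a \<odot>\<^bsub>M\<^esub> (x \<oplus>\<^bsub>M\<^esub> y) = a \<odot>\<^bsub>M\<^esub> x \<oplus>\<^bsub>M\<^esub> a \<odot>\<^bsub>M\<^esub> y"
    and smult_assoc:
      "\<lbrakk>a \<in> carrier R; b \<in> carrier R; x \<in> carrier M\<rbrakk> \<Longrightarrow>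
       (a \<otimes>\<^bsub>R\<^esub> b) \<odot>\<^bsub>M\<^esub> x = a \<odot>\<^bsub>M\<^esub> (b \<odot>\<^bsub>M\<^esub> x)"
    and smult_one:
      "x \<in> carrier M \<Longrightarrow> \<one>\<^bsub>R\<^esub> \<odot>\<^bsub>M\<^esub> x = x"

locale right_module = R?: ring R + M?: abelian_group M 
    for R :: "('a, 'x) ring_scheme" (structure) and M :: "('a, 'm, 'y) module_scheme" (structure) +
  assumes smult_closed:
      "\<lbrakk>a \<in> carrier R; x \<in> carrier M\<rbrakk> \<Longrightarrow> a \<odot>\<^bsub>M\<^esub> x \<in> carrier M"
    and smult_l_distr:
      "\<lbrakk>a \<in> carrier R; b \<in> carrier R; x \<in> carrier M\<rbrakk> \<Longrightarrow>
       (a \<oplus>\<^bsub>R\<^esub> b) \<odot>\<^bsub>M\<^esub> x = a \<odot>\<^bsub>M\<^esub> x \<oplus>\<^bsub>M\<^esub> b \<odot>\<^bsub>M\<^esub> x"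
    and smult_r_distr:
      "\<lbrakk>a \<in> carrier R; x \<in> carrier M; y \<in> carrier M\<rbrakk> \<Longrightarrow>
       a \<odot>\<^bsub>M\<^esub> (x \<oplus>\<^bsub>M\<^esub> y) = a \<odot>\<^bsub>M\<^esub> x \<oplus>\<^bsub>M\<^esub> a \<odot>\<^bsub>M\<^esub> y"
    and smult_assoc:
      "\<lbrakk>a \<in> carrier R; b \<in> carrier R; x \<in> carrier M\<rbrakk> \<Longrightarrow>
       (a \<otimes>\<^bsub>R\<^esub> b) \<odot>\<^bsub>M\<^esub> x = b \<odot>\<^bsub>M\<^esub> (a \<odot>\<^bsub>M\<^esub> x)"
    and smult_one:
      "x \<in> carrier M \<Longrightarrow> \<one>\<^bsub>R\<^esub> \<odot>\<^bsub>M\<^esub> x = x"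

definition with_smult :: "('m, 'x) ring_scheme \<Rightarrow> ('a \<Rightarrow> 'm \<Rightarrow> 'm) \<Rightarrow> ('a, 'm) module" where
  "with_smult G act = \<lparr>carrier = carrier G, monoid.mult = monoid.mult G, one = one G,
     ring.zero = ring.zero G, ring.add = ring.add G, smult = act\<rparr>"

text \<open>A bimodule is a left module \<open>M\<close> with a second scalar action; \<open>right_part M\<close> is the right module.\<close>

record ('a, 'b, 'm) bimod = "('a, 'm) module" +
  right_smult :: "'m \<Rightarrow> 'b \<Rightarrow> 'm"

definition right_part :: "('a, 'b, 'm) bimod \<Rightarrow> ('b, 'm) module" where
  "right_part M = with_smult M (\<lambda>b x. right_smult M x b)"

definition bimodule :: "'a ring \<Rightarrow> 'b ring \<Rightarrow> ('a, 'b, 'm) bimod \<Rightarrow> bool" where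
  "bimodule A B M \<longleftrightarrow> left_module A M \<and> right_module B (right_part M) \<and>
     (\<forall>a\<in>carrier A. \<forall>b\<in>carrier B. \<forall>x\<in>carrier M.
        right_smult M (a \<odot>\<^bsub>M\<^esub> x) b = a \<odot>\<^bsub>M\<^esub> right_smult M x b)"

text \<open>Homomorphisms of left modules or of right modules, made extensional so that equality of
  functions is equality of homomorphisms.\<close>

definition mod_hom ::
  "'r ring \<Rightarrow> ('r, 'm, 'x) module_scheme \<Rightarrow> ('r, 'n, 'y) module_scheme \<Rightarrow> ('m \<Rightarrow> 'n) set" where
  "mod_hom R M N = {f \<in> carrier M \<rightarrow>\<^sub>E carrier N.
     (\<forall>x\<in>carrier M. \<forall>y\<in>carrier M. f (x \<oplus>\<^bsub>M\<^esub> y) = f x \<oplus>\<^bsub>N\<^esub> f y) \<and>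
     (\<forall>r\<in>carrier R. \<forall>x\<in>carrier M. f (r \<odot>\<^bsub>M\<^esub> x) = r \<odot>\<^bsub>N\<^esub> f x)}"

text \<open>Abelian groups are kept in \<open>ring\<close> records, of which only the additive part is meaningful.\<close>

definition hom_group ::
  "'r ring \<Rightarrow> ('r, 'm, 'x) module_scheme \<Rightarrow> ('r, 'n, 'y) module_scheme \<Rightarrow> ('m \<Rightarrow> 'n) ring" where
  "hom_group R M N = \<lparr>carrier = mod_hom R M N, monoid.mult = undefined, one = undefined,
     ring.zero = (\<lambda>x\<in>carrier M. \<zero>\<^bsub>N\<^esub>),
     ring.add = (\<lambda>f g. \<lambda>x\<in>carrier M. f x \<oplus>\<^bsub>N\<^esub> g x)\<rparr>"

text \<open>The map \<open>Hom(h, X)\<close> for a homomorphism \<open>h\<close> with domain \<open>M\<close>.\<close>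

definition hom_precomp ::
  "('r, 'm, 'x) module_scheme \<Rightarrow> ('m \<Rightarrow> 'm') \<Rightarrow> ('m' \<Rightarrow> 'n) \<Rightarrow> ('m \<Rightarrow> 'n)" where
  "hom_precomp M h f = compose (carrier M) f h"

text \<open>For an \<open>R\<close>-\<open>S\<close>-bimodule \<open>M\<close> and a right \<open>S\<close>-module \<open>N\<close>, \<open>Hom\<^sub>S(M, N)\<close> is a right
  \<open>R\<close>-module by \<open>(f r)(x) = f (r x)\<close>; for an \<open>S\<close>-\<open>R\<close>-bimodule \<open>L\<close> and a left \<open>S\<close>-module \<open>N\<close>,
  \<open>Hom\<^sub>S(L, N)\<close> is a left \<open>R\<close>-module by \<open>(r f)(x) = f (x r)\<close>.\<close>

definition Hom_right :: "'s ring \<Rightarrow> ('r, 's, 'm) bimod \<Rightarrow> ('s, 'n) module \<Rightarrow> ('r, 'm \<Rightarrow> 'n) module" where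
  "Hom_right S M N = with_smult (hom_group S (right_part M) N)
     (\<lambda>r f. \<lambda>x\<in>carrier M. f (r \<odot>\<^bsub>M\<^esub> x))"

definition Hom_left :: "'s ring \<Rightarrow> ('s, 'r, 'm) bimod \<Rightarrow> ('s, 'n) module \<Rightarrow> ('r, 'm \<Rightarrow> 'n) module" where
  "Hom_left S L N = with_smult (hom_group S L N)
     (\<lambda>r f. \<lambda>x\<in>carrier L. f (right_smult L x r))"

definition additive_group :: "'a monoid \<Rightarrow> 'a ring" where
  "additive_group G = \<lparr>carrier = carrier G, monoid.mult = undefined, one = undefined,
     ring.zero = \<one>\<^bsub>G\<^esub>, ring.add = monoid.mult G\<rparr>"

text \<open>\<open>M \<otimes>\<^sub>R N\<close> for a right module \<open>M\<close> and a left module \<open>N\<close>: the free abelian group on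
  \<open>M \<times> N\<close> modulo the subgroup of tensor relations.\<close>

definition tensor_relations ::
  "'r ring \<Rightarrow> ('r, 'm, 'x) module_scheme \<Rightarrow> ('r, 'n, 'y) module_scheme \<Rightarrow> ('m \<times> 'n \<Rightarrow>\<^sub>0 int) set" where
  "tensor_relations R M N =
     {frag_of (x \<oplus>\<^bsub>M\<^esub> x', y) - frag_of (x, y) - frag_of (x', y) | x x' y.
        x \<in> carrier M \<and> x' \<in> carrier M \<and> y \<in> carrier N} \<union>
     {frag_of (x, y \<oplus>\<^bsub>N\<^esub> y') - frag_of (x, y) - frag_of (x, y') | x y y'.
        x \<in> carrier M \<and> y \<in> carrier N \<and> y' \<in> carrier N} \<union>
     {frag_of (r \<odot>\<^bsub>M\<^esub> x, y) - frag_of (x, r \<odot>\<^bsub>N\<^esub> y) | x r y.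
        x \<in> carrier M \<and> r \<in> carrier R \<and> y \<in> carrier N}"

definition tensor_kernel ::
  "'r ring \<Rightarrow> ('r, 'm, 'x) module_scheme \<Rightarrow> ('r, 'n, 'y) module_scheme \<Rightarrow> ('m \<times> 'n \<Rightarrow>\<^sub>0 int) set" where
  "tensor_kernel R M N =
     generate (free_Abelian_group (carrier M \<times> carrier N)) (tensor_relations R M N)"

definition tensor ::
  "'r ring \<Rightarrow> ('r, 'm, 'x) module_scheme \<Rightarrow> ('r, 'n, 'y) module_scheme \<Rightarrow> ('m \<times> 'n \<Rightarrow>\<^sub>0 int) set ring" where
  "tensor R M N =
     additive_group (free_Abelian_group (carrier M \<times> carrier N) Mod tensor_kernel R M N)"

text \<open>The map \<open>f \<otimes> g\<close> into \<open>M' \<otimes>\<^sub>R N'\<close>; an element of a tensor product is a coset \<open>X\<close>.\<close>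

definition tensor_map ::
  "'r ring \<Rightarrow> ('r, 'm', 'x) module_scheme \<Rightarrow> ('r, 'n', 'y) module_scheme \<Rightarrow>
   ('m \<Rightarrow> 'm') \<Rightarrow> ('n \<Rightarrow> 'n') \<Rightarrow> ('m \<times> 'n \<Rightarrow>\<^sub>0 int) set \<Rightarrow> ('m' \<times> 'n' \<Rightarrow>\<^sub>0 int) set" where
  "tensor_map R M' N' f g X =
     tensor_kernel R M' N' <#>\<^bsub>free_Abelian_group (carrier M' \<times> carrier N')\<^esub>
       (frag_extend (\<lambda>(x, y). frag_of (f x, g y)) ` X)"

text \<open>\<open>L \<otimes>\<^sub>R M\<close> as a right \<open>S\<close>-module for an \<open>R\<close>-\<open>S\<close>-bimodule \<open>M\<close>, and as a left
  \<open>S\<close>-module for an \<open>S\<close>-\<open>R\<close>-bimodule \<open>L\<close>.\<close>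

definition tensor_right :: "'r ring \<Rightarrow> ('r, 'l) module \<Rightarrow> ('r, 's, 'm) bimod \<Rightarrow>
    ('s, ('l \<times> 'm \<Rightarrow>\<^sub>0 int) set) module" where
  "tensor_right R L M = with_smult (tensor R L M)
     (\<lambda>s. tensor_map R L M (\<lambda>x. x) (\<lambda>y. right_smult M y s))"

definition tensor_left :: "'r ring \<Rightarrow> ('s, 'r, 'l) bimod \<Rightarrow> ('r, 'm) module \<Rightarrow>
    ('s, ('l \<times> 'm \<Rightarrow>\<^sub>0 int) set) module" where
  "tensor_left R L M = with_smult (tensor R (right_part L) M)
     (\<lambda>s. tensor_map R (right_part L) M (\<lambda>x. s \<odot>\<^bsub>L\<^esub> x) (\<lambda>y. y))"


text \<open>In a chain complex \<open>d n : C (n + 1) \<rightarrow> C n\<close>, in a cochain complex \<open>d n : C n \<rightarrow> C (n + 1)\<close>;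
  both are zero in negative degrees.\<close>

definition subquotient :: "('c, 'x) ring_scheme \<Rightarrow> 'c set \<Rightarrow> 'c set \<Rightarrow> 'c set ring" where
  "subquotient G Z B = additive_group ((add_monoid G)\<lparr>carrier := Z\<rparr> Mod B)"

definition homology :: "(nat \<Rightarrow> ('c, 'x) ring_scheme) \<Rightarrow> (nat \<Rightarrow> 'c \<Rightarrow> 'c) \<Rightarrow> nat \<Rightarrow> 'c set ring" where
  "homology C d n = subquotient (C n)
     (case n of 0 \<Rightarrow> carrier (C 0) | Suc k \<Rightarrow> {z \<in> carrier (C n). d k z = \<zero>\<^bsub>C k\<^esub>})
     (d n ` carrier (C (Suc n)))"

definition coboundaries :: "(nat \<Rightarrow> ('c, 'x) ring_scheme) \<Rightarrow> (nat \<Rightarrow> 'c \<Rightarrow> 'c) \<Rightarrow> nat \<Rightarrow> 'c set" where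
  "coboundaries C d n = (case n of 0 \<Rightarrow> {\<zero>\<^bsub>C 0\<^esub>} | Suc k \<Rightarrow> d k ` carrier (C k))"

definition cohomology :: "(nat \<Rightarrow> ('c, 'x) ring_scheme) \<Rightarrow> (nat \<Rightarrow> 'c \<Rightarrow> 'c) \<Rightarrow> nat \<Rightarrow> 'c set ring" where
  "cohomology C d n =
     subquotient (C n) {z \<in> carrier (C n). d n z = \<zero>\<^bsub>C (Suc n)\<^esub>} (coboundaries C d n)"

text \<open>For a complex of modules a scalar sends the class \<open>z + B\<close> to \<open>s z + B\<close>.\<close>

definition cohomology_module ::
  "(nat \<Rightarrow> ('s, 'c) module) \<Rightarrow> (nat \<Rightarrow> 'c \<Rightarrow> 'c) \<Rightarrow> nat \<Rightarrow> ('s, 'c set) module" where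
  "cohomology_module C d n = with_smult (cohomology C d n)
     (\<lambda>s X. coboundaries C d n <+>\<^bsub>C n\<^esub> ((\<lambda>z. s \<odot>\<^bsub>C n\<^esub> z) ` X))"

definition exact_at ::
  "('a, 'x) ring_scheme \<Rightarrow> ('a \<Rightarrow> 'b) \<Rightarrow> ('b, 'y) ring_scheme \<Rightarrow> ('b \<Rightarrow> 'c) \<Rightarrow> ('c, 'z) ring_scheme \<Rightarrow> bool"
  where "exact_at A f B g C \<longleftrightarrow> f ` carrier A = {b \<in> carrier B. g b = \<zero>\<^bsub>C\<^esub>}"


definition finitely_generated :: "'r ring \<Rightarrow> ('r, 'm) module \<Rightarrow> bool" where
  "finitely_generated R M \<longleftrightarrow> (\<exists>X. finite X \<and> X \<subseteq> carrier M \<and>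
     (\<forall>H. submodule H R M \<and> X \<subseteq> H \<longrightarrow> H = carrier M))"

text \<open>
  HOL cannot quantify over modules in all types inside a formula, so the following definitions fix
  types that are large enough for the quantifier to have its unrestricted meaning.

  Projectivity: the type of \<open>A\<close> accommodates the free module on the elements of \<open>P\<close>, that of \<open>B\<close>
  accommodates \<open>P\<close> itself.  Lifting the identity of \<open>P\<close> along the free cover exhibits \<open>P\<close> as a
  direct summand of a free module, so that \<open>P\<close> has the lifting property against all epimorphisms.
\<close>

definition projective :: "'r ring \<Rightarrow> ('r, 'p) module \<Rightarrow> bool" where
  "projective R P \<longleftrightarrow> left_module R P \<and>
     (\<forall>(A :: ('r, 'p \<Rightarrow> 'r) module) (B :: ('r, 'p) module). \<forall>g\<in>mod_hom R A B. \<forall>f\<in>mod_hom R P B.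
        left_module R A \<and> left_module R B \<and> g ` carrier A = carrier B \<longrightarrow>
        (\<exists>h\<in>mod_hom R P A. compose (carrier P) g h = f))"

text \<open>Injectivity: by Baer's criterion monomorphisms between modules whose elements lie in the type
  of the ring (among them the inclusions of one-sided ideals into the ring) suffice.\<close>

definition injective_left :: "'r ring \<Rightarrow> ('r, 'm) module \<Rightarrow> bool" where
  "injective_left R N \<longleftrightarrow> left_module R N \<and>
     (\<forall>(A :: ('r, 'r) module) (B :: ('r, 'r) module). \<forall>g\<in>mod_hom R A B. \<forall>f\<in>mod_hom R A N.
        left_module R A \<and> left_module R B \<and> inj_on g (carrier A) \<longrightarrow>
        (\<exists>h\<in>mod_hom R B N. compose (carrier A) h g = f))"

definition injective_right :: "'r ring \<Rightarrow> ('r, 'm) module \<Rightarrow> bool" where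
  "injective_right R N \<longleftrightarrow> right_module R N \<and>
     (\<forall>(A :: ('r, 'r) module) (B :: ('r, 'r) module). \<forall>g\<in>mod_hom R A B. \<forall>f\<in>mod_hom R A N.
        right_module R A \<and> right_module R B \<and> inj_on g (carrier A) \<longrightarrow>
        (\<exists>h\<in>mod_hom R B N. compose (carrier A) h g = f))"

definition projective_resolution ::
  "'r ring \<Rightarrow> (nat \<Rightarrow> ('r, 'p) module) \<Rightarrow> (nat \<Rightarrow> 'p \<Rightarrow> 'p) \<Rightarrow> ('p \<Rightarrow> 'f) \<Rightarrow> ('r, 'f) module \<Rightarrow> bool" where
  "projective_resolution R P d e F \<longleftrightarrow>
     (\<forall>n. projective R (P n)) \<and> (\<forall>n. d n \<in> mod_hom R (P (Suc n)) (P n)) \<and> e \<in> mod_hom R (P 0) F \<and>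
     e ` carrier (P 0) = carrier F \<and> exact_at (P 1) (d 0) (P 0) e F \<and>
     (\<forall>n. exact_at (P (Suc (Suc n))) (d (Suc n)) (P (Suc n)) (d n) (P n))"

text \<open>A finitely generated projective module is isomorphic to a submodule of some \<open>R\<^sup>k\<close>, hence
  to one with elements of type \<open>nat \<Rightarrow> 'r\<close>.\<close>

definition super_finitely_presented :: "'r ring \<Rightarrow> ('r, 'f) module \<Rightarrow> bool" where
  "super_finitely_presented R F \<longleftrightarrow> left_module R F \<and>
     (\<exists>(P :: nat \<Rightarrow> ('r, nat \<Rightarrow> 'r) module) d e.
        projective_resolution R P d e F \<and> (\<forall>n. finitely_generated R (P n)))"

text \<open>\<open>Ext\<^sup>n\<^sub>R(F, M)\<close> and \<open>Tor\<^sub>n\<^sup>R(M, F)\<close>, computed from a projective resolution \<open>(P, d)\<close> of \<open>F\<close>.\<close>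

definition Ext ::
  "'r ring \<Rightarrow> (nat \<Rightarrow> ('r, 'p) module) \<Rightarrow> (nat \<Rightarrow> 'p \<Rightarrow> 'p) \<Rightarrow> ('r, 'm) module \<Rightarrow> nat \<Rightarrow> ('p \<Rightarrow> 'm) set ring"
  where "Ext R P d M =
    cohomology (\<lambda>n. hom_group R (P n) M) (\<lambda>n. hom_precomp (P (Suc n)) (d n))"

definition Tor ::
  "'r ring \<Rightarrow> ('r, 'm) module \<Rightarrow> (nat \<Rightarrow> ('r, 'p) module) \<Rightarrow> (nat \<Rightarrow> 'p \<Rightarrow> 'p) \<Rightarrow> nat \<Rightarrow>
   ('m \<times> 'p \<Rightarrow>\<^sub>0 int) set set ring"
  where "Tor R M P d =
    homology (\<lambda>n. tensor R M (P n)) (\<lambda>n. tensor_map R M (P n) (\<lambda>x. x) (d n))"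

text \<open>Every super finitely presented module is isomorphic to a quotient of some \<open>R\<^sup>k\<close>, hence to one
  whose elements are cosets, of type \<open>(nat \<Rightarrow> 'r) set\<close>; it has a projective resolution by modules
  with elements in \<open>nat \<Rightarrow> 'r\<close>, and the result does not depend on which one is used.\<close>

definition weak_injective :: "'r ring \<Rightarrow> ('r, 'm) module \<Rightarrow> bool" where
  "weak_injective R M \<longleftrightarrow> left_module R M \<and>
     (\<forall>F :: ('r, (nat \<Rightarrow> 'r) set) module. super_finitely_presented R F \<longrightarrow>
        (\<forall>(P :: nat \<Rightarrow> ('r, nat \<Rightarrow> 'r) module) d e. projective_resolution R P d e F \<longrightarrow>
           carrier (Ext R P d M 1) = {\<zero>\<^bsub>Ext R P d M 1\<^esub>}))"

definition weak_flat :: "'r ring \<Rightarrow> ('r, 'm) module \<Rightarrow> bool" where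
  "weak_flat R M \<longleftrightarrow> right_module R M \<and>
     (\<forall>F :: ('r, (nat \<Rightarrow> 'r) set) module. super_finitely_presented R F \<longrightarrow>
        (\<forall>(P :: nat \<Rightarrow> ('r, nat \<Rightarrow> 'r) module) d e. projective_resolution R P d e F \<longrightarrow>
           carrier (Tor R M P d 1) = {\<zero>\<^bsub>Tor R M P d 1\<^esub>}))"

text \<open>
  A right resolution \<open>M \<rightarrow> W 0 \<rightarrow> W 1 \<rightarrow> \<dots>\<close>.  The two predicates \<open>\<C>\<close> and \<open>\<T>\<close> are the same class of
  modules, in the type of the \<open>W n\<close> and in the type of the modules \<open>X\<close> against which exactness of
  \<open>Hom(-, X)\<close> is tested.
\<close>

definition right_resolution ::
  "'r ring \<Rightarrow> (('r, 'u) module \<Rightarrow> bool) \<Rightarrow> (('r, 't) module \<Rightarrow> bool) \<Rightarrow>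
   ('r, 'm) module \<Rightarrow> ('m \<Rightarrow> 'u) \<Rightarrow> (nat \<Rightarrow> ('r, 'u) module) \<Rightarrow> (nat \<Rightarrow> 'u \<Rightarrow> 'u) \<Rightarrow> bool" where
  "right_resolution R \<C> \<T> M e W d \<longleftrightarrow>
     (\<forall>n. \<C> (W n)) \<and> e \<in> mod_hom R M (W 0) \<and> (\<forall>n. d n \<in> mod_hom R (W n) (W (Suc n))) \<and>
     (\<forall>x\<in>carrier M. d 0 (e x) = \<zero>\<^bsub>W 1\<^esub>) \<and>
     (\<forall>n. \<forall>x\<in>carrier (W n). d (Suc n) (d n x) = \<zero>\<^bsub>W (Suc (Suc n))\<^esub>) \<and>
     (\<forall>X. \<T> X \<longrightarrow>
        hom_precomp M e ` carrier (hom_group R (W 0) X) = carrier (hom_group R M X) \<and>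
        exact_at (hom_group R (W 1) X) (hom_precomp (W 0) (d 0))
          (hom_group R (W 0) X) (hom_precomp M e) (hom_group R M X) \<and>
        (\<forall>n. exact_at (hom_group R (W (Suc (Suc n))) X) (hom_precomp (W (Suc n)) (d (Suc n)))
          (hom_group R (W (Suc n)) X) (hom_precomp (W n) (d n)) (hom_group R (W n) X)))"

text \<open>
  The test modules have elements in \<open>('r + 'm + 'u) list\<close>, a type of cardinality
  \<open>max(\<aleph>\<^sub>0, |'r|, |'m|, |'u|)\<close>.  This amounts to testing against all modules of the class: the image of a
  homomorphism from \<open>M\<close> or \<open>W n\<close> to \<open>X\<close> lies in a pure submodule of \<open>X\<close> of at most that
  cardinality, and weak injective and weak flat modules are closed under pure submodules.
\<close>

definition right_WI_resolution ::
  "'r ring \<Rightarrow> ('r, 'm) module \<Rightarrow> ('m \<Rightarrow> 'u) \<Rightarrow> (nat \<Rightarrow> ('r, 'u) module) \<Rightarrow> (nat \<Rightarrow> 'u \<Rightarrow> 'u) \<Rightarrow> bool" where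
  "right_WI_resolution R M e W d \<longleftrightarrow> right_resolution R (weak_injective R)
     (weak_injective R :: ('r, ('r + 'm + 'u) list) module \<Rightarrow> bool) M e W d"

definition right_WF_resolution ::
  "'r ring \<Rightarrow> ('r, 'm) module \<Rightarrow> ('m \<Rightarrow> 'u) \<Rightarrow> (nat \<Rightarrow> ('r, 'u) module) \<Rightarrow> (nat \<Rightarrow> 'u \<Rightarrow> 'u) \<Rightarrow> bool" where
  "right_WF_resolution R M e W d \<longleftrightarrow> right_resolution R (weak_flat R)
     (weak_flat R :: ('r, ('r + 'm + 'u) list) module \<Rightarrow> bool) M e W d"

text \<open>The relative functors, computed from a deleted right resolution \<open>(W, d)\<close>.  With \<open>(W, d)\<close> a
  right \<open>\<W>\<I>\<close>-resolution (respectively \<open>\<W>\<F>\<close>-resolution) of \<open>M\<close>, \<open>rel_Ext R W d X n\<close>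
  is \<open>Ext\<^sub>n(M, X)\<close> relative to \<open>\<W>\<I>\<close> (respectively \<open>\<W>\<F>\<close>).\<close>

definition rel_Ext ::
  "'r ring \<Rightarrow> (nat \<Rightarrow> ('r, 'u) module) \<Rightarrow> (nat \<Rightarrow> 'u \<Rightarrow> 'u) \<Rightarrow> ('r, 'm) module \<Rightarrow> nat \<Rightarrow> ('u \<Rightarrow> 'm) set ring"
  where "rel_Ext R W d X =
    homology (\<lambda>n. hom_group R (W n) X) (\<lambda>n. hom_precomp (W n) (d n))"

text \<open>\<open>Tor\<^sup>n(L, M)\<close> is computed by resolving the argument that is not a bimodule, so that the complex
  itself consists of \<open>S\<close>-modules: \<open>rel_Tor_right\<close> uses a right \<open>\<W>\<F>\<close>-resolution \<open>(W, d)\<close> of \<open>L\<close>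
  when \<open>M\<close> is an \<open>R\<close>-\<open>S\<close>-bimodule, and \<open>rel_Tor_left\<close> a right \<open>\<W>\<I>\<close>-resolution \<open>(V, d)\<close> of \<open>M\<close>
  when \<open>L\<close> is an \<open>S\<close>-\<open>R\<close>-bimodule.\<close>

definition rel_Tor_right ::
  "'r ring \<Rightarrow> (nat \<Rightarrow> ('r, 'u) module) \<Rightarrow> (nat \<Rightarrow> 'u \<Rightarrow> 'u) \<Rightarrow> ('r, 's, 'm) bimod \<Rightarrow> nat \<Rightarrow>
   ('s, ('u \<times> 'm \<Rightarrow>\<^sub>0 int) set set) module"
  where "rel_Tor_right R W d M =
    cohomology_module (\<lambda>n. tensor_right R (W n) M)
      (\<lambda>n. tensor_map R (W (Suc n)) M (d n) (\<lambda>y. y))"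

definition rel_Tor_left ::
  "'r ring \<Rightarrow> ('s, 'r, 'l) bimod \<Rightarrow> (nat \<Rightarrow> ('r, 'u) module) \<Rightarrow> (nat \<Rightarrow> 'u \<Rightarrow> 'u) \<Rightarrow> nat \<Rightarrow>
   ('s, ('l \<times> 'u \<Rightarrow>\<^sub>0 int) set set) module"
  where "rel_Tor_left R L V d =
    cohomology_module (\<lambda>n. tensor_left R L (V n))
      (\<lambda>n. tensor_map R (right_part L) (V (Suc n)) (\<lambda>x. x) (d n))"

end

theory Submission
  imports Defs
begin

text \<open>
  Two independent facts combine.  Relative \<open>Ext\<close> does not depend on the right resolution that
  computes it, and for one fixed resolution the isomorphism is the tensor-hom adjunction followed by
  exactness of \<open>Hom\<^sub>S(-, N)\<close>:
  \<open>H\<^sub>n(Hom\<^sub>R(W, Hom\<^sub>S(M, N))) \<cong> H\<^sub>n(Hom\<^sub>S(W \<otimes>\<^sub>R M, N)) \<cong> Hom\<^sub>S(H\<^sup>n(W \<otimes>\<^sub>R M), N)\<close>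
  when \<open>M\<close> is the bimodule, and the same with the tensor factors exchanged when \<open>L\<close> is.

  The first isomorphism (\<open>bij_betw_curry_hom\<close>) rests on the universal property of the tensor product
  over a noncommutative ring (\<open>tensor_lift\<close>, \<open>tensor_ext\<close>).  The second
  (\<open>homology_hom_iso_hom_cohomology\<close>) holds because homomorphisms into \<open>N\<close> extend from submodules.
  As injectivity is tested on modules in the type of the ring only, this extension property needs
  Baer's argument (\<open>injective_left_extension\<close>).

  Independence of the resolution (\<open>rel_Ext_independent_of_resolution\<close>) is the comparison theorem of
  relative homological algebra: exactness of \<open>Hom(-, X)\<close> for all \<open>X\<close> in the class yields chain maps
  between two resolutions over the identity of the resolved module, unique up to homotopy.  Exactness is tested on
  modules in a type different from that of the resolutions, so the terms of a resolution are first
  copied into the type of the test modules; the classes of weak injective and weak flat modules are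
  closed under such copies because they are closed under retracts (\<open>weak_injective_retract\<close>,
  \<open>weak_flat_retract\<close>).

  A right module is a left module over the opposite ring, and homomorphism groups do not see the
  difference; the comparison of resolutions, Baer's argument and the adjunction are therefore
  carried out for left modules only.
\<close>

section \<open>Modules over the opposite ring\<close>

definition opposite_ring :: "'r ring \<Rightarrow> 'r ring" where
  "opposite_ring R = R\<lparr>monoid.mult := \<lambda>x y. y \<otimes>\<^bsub>R\<^esub> x\<rparr>"

lemma opposite_ring_simps [simp]:
  "carrier (opposite_ring R) = carrier R" "\<one>\<^bsub>opposite_ring R\<^esub> = \<one>\<^bsub>R\<^esub>"
  "\<zero>\<^bsub>opposite_ring R\<^esub> = \<zero>\<^bsub>R\<^esub>" "x \<oplus>\<^bsub>opposite_ring R\<^esub> y = x \<oplus>\<^bsub>R\<^esub> y"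
  "x \<otimes>\<^bsub>opposite_ring R\<^esub> y = y \<otimes>\<^bsub>R\<^esub> x" "opposite_ring (opposite_ring R) = R"
  by (simp_all add: opposite_ring_def)

lemma ring_opposite_ring:
  assumes "ring R"
  shows "ring (opposite_ring R)"
proof -
  interpret ring R by fact
  show ?thesis
  proof (rule ringI)
    show "abelian_group (opposite_ring R)"
      by (rule abelian_groupI) (auto simp: a_ac intro: l_neg)
    show "monoid (opposite_ring R)"
      by (rule monoidI) (auto simp: m_assoc)
  qed (auto simp: l_distr r_distr)
qed

lemma ring_opposite_ring_iff [simp]: "ring (opposite_ring R) \<longleftrightarrow> ring R"
  using ring_opposite_ring[of R] ring_opposite_ring[of "opposite_ring R"] by auto

lemma right_module_iff_left_module: "right_module R M \<longleftrightarrow> left_module (opposite_ring R) M"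
  unfolding right_module_def left_module_def right_module_axioms_def left_module_axioms_def
  by auto

lemma mod_hom_opposite_ring [simp]: "mod_hom (opposite_ring R) M N = mod_hom R M N"
  by (simp add: mod_hom_def)

lemma hom_group_opposite_ring [simp]: "hom_group (opposite_ring R) M N = hom_group R M N"
  by (simp add: hom_group_def)

lemma injective_right_iff_injective_left:
  "injective_right R N \<longleftrightarrow> injective_left (opposite_ring R) N"
  by (simp add: injective_right_def injective_left_def right_module_iff_left_module)

lemma right_resolution_opposite_ring:
  "right_resolution (opposite_ring R) \<C> \<T> M e W d \<longleftrightarrow> right_resolution R \<C> \<T> M e W d"
  by (simp add: right_resolution_def)

lemma rel_Ext_opposite_ring: "rel_Ext (opposite_ring R) W d X n = rel_Ext R W d X n"
  by (simp add: rel_Ext_def)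

section \<open>Linear maps\<close>

lemma (in left_module) smult_r_null: "a \<in> carrier R \<Longrightarrow> a \<odot>\<^bsub>M\<^esub> \<zero>\<^bsub>M\<^esub> = \<zero>\<^bsub>M\<^esub>"
  by (metis M.add.l_cancel_one' M.zero_closed smult_closed smult_r_distr M.l_zero)

lemma (in left_module) smult_l_null: "x \<in> carrier M \<Longrightarrow> \<zero>\<^bsub>R\<^esub> \<odot>\<^bsub>M\<^esub> x = \<zero>\<^bsub>M\<^esub>"
  by (metis M.add.l_cancel_one' R.zero_closed smult_closed smult_l_distr R.l_zero)

lemma (in left_module) smult_r_minus:
  "\<lbrakk>a \<in> carrier R; x \<in> carrier M\<rbrakk> \<Longrightarrow> a \<odot>\<^bsub>M\<^esub> (\<ominus>\<^bsub>M\<^esub> x) = \<ominus>\<^bsub>M\<^esub> (a \<odot>\<^bsub>M\<^esub> x)"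
  by (metis M.a_inv_closed M.add.inv_equality M.l_neg smult_closed smult_r_distr smult_r_null)

lemma (in left_module) smult_l_minus:
  "\<lbrakk>a \<in> carrier R; x \<in> carrier M\<rbrakk> \<Longrightarrow> (\<ominus>\<^bsub>R\<^esub> a) \<odot>\<^bsub>M\<^esub> x = \<ominus>\<^bsub>M\<^esub> (a \<odot>\<^bsub>M\<^esub> x)"
  by (metis R.a_inv_closed M.add.inv_equality R.l_neg smult_closed smult_l_distr smult_l_null)

lemma left_module_abelian_group: "left_module R M \<Longrightarrow> abelian_group M"
  by (simp add: left_module_def)

lemma left_module_ring: "left_module R M \<Longrightarrow> ring R"
  by (simp add: left_module_def)

text \<open>Linearity without extensionality, so that it is closed under composition of functions.\<close>

definition module_map ::
  "'r ring \<Rightarrow> ('r, 'm, 'x) module_scheme \<Rightarrow> ('r, 'n, 'y) module_scheme \<Rightarrow> ('m \<Rightarrow> 'n) \<Rightarrow> bool" where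
  "module_map R M N f \<longleftrightarrow> f \<in> carrier M \<rightarrow> carrier N \<and>
     (\<forall>x\<in>carrier M. \<forall>y\<in>carrier M. f (x \<oplus>\<^bsub>M\<^esub> y) = f x \<oplus>\<^bsub>N\<^esub> f y) \<and>
     (\<forall>r\<in>carrier R. \<forall>x\<in>carrier M. f (r \<odot>\<^bsub>M\<^esub> x) = r \<odot>\<^bsub>N\<^esub> f x)"

lemma mod_hom_iff: "f \<in> mod_hom R M N \<longleftrightarrow> module_map R M N f \<and> f \<in> extensional (carrier M)"
  by (auto simp: mod_hom_def module_map_def PiE_def)

lemma module_map_opposite_ring [simp]: "module_map (opposite_ring R) M N = module_map R M N"
  by (simp add: module_map_def fun_eq_iff)

lemma module_map_closed: "module_map R M N f \<Longrightarrow> x \<in> carrier M \<Longrightarrow> f x \<in> carrier N"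
  by (auto simp: module_map_def)

lemma module_map_add:
  "module_map R M N f \<Longrightarrow> x \<in> carrier M \<Longrightarrow> y \<in> carrier M \<Longrightarrow> f (x \<oplus>\<^bsub>M\<^esub> y) = f x \<oplus>\<^bsub>N\<^esub> f y"
  by (auto simp: module_map_def)

lemma module_map_smult:
  "module_map R M N f \<Longrightarrow> r \<in> carrier R \<Longrightarrow> x \<in> carrier M \<Longrightarrow> f (r \<odot>\<^bsub>M\<^esub> x) = r \<odot>\<^bsub>N\<^esub> f x"
  by (auto simp: module_map_def)

lemma module_mapI:
  assumes "\<And>x. x \<in> carrier M \<Longrightarrow> f x \<in> carrier N"
    "\<And>x y. x \<in> carrier M \<Longrightarrow> y \<in> carrier M \<Longrightarrow> f (x \<oplus>\<^bsub>M\<^esub> y) = f x \<oplus>\<^bsub>N\<^esub> f y"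
    "\<And>r x. r \<in> carrier R \<Longrightarrow> x \<in> carrier M \<Longrightarrow> f (r \<odot>\<^bsub>M\<^esub> x) = r \<odot>\<^bsub>N\<^esub> f x"
  shows "module_map R M N f"
  using assms by (auto simp: module_map_def)

lemma module_map_compose:
  "module_map R M N f \<Longrightarrow> module_map R N P g \<Longrightarrow> module_map R M P (\<lambda>x. g (f x))"
  by (simp add: module_map_def Pi_iff)

definition additive_map :: "('a, 'x) ring_scheme \<Rightarrow> ('b, 'y) ring_scheme \<Rightarrow> ('a \<Rightarrow> 'b) \<Rightarrow> bool" where
  "additive_map G H f \<longleftrightarrow> f \<in> carrier G \<rightarrow> carrier H \<and>
     (\<forall>x\<in>carrier G. \<forall>y\<in>carrier G. f (x \<oplus>\<^bsub>G\<^esub> y) = f x \<oplus>\<^bsub>H\<^esub> f y)"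

lemma additive_mapI:
  assumes "\<And>x. x \<in> carrier G \<Longrightarrow> f x \<in> carrier H"
    "\<And>x y. x \<in> carrier G \<Longrightarrow> y \<in> carrier G \<Longrightarrow> f (x \<oplus>\<^bsub>G\<^esub> y) = f x \<oplus>\<^bsub>H\<^esub> f y"
  shows "additive_map G H f"
  using assms by (auto simp: additive_map_def)

lemma additive_map_closed: "additive_map G H f \<Longrightarrow> x \<in> carrier G \<Longrightarrow> f x \<in> carrier H"
  by (auto simp: additive_map_def)

lemma additive_map_add:
  "additive_map G H f \<Longrightarrow> x \<in> carrier G \<Longrightarrow> y \<in> carrier G \<Longrightarrow> f (x \<oplus>\<^bsub>G\<^esub> y) = f x \<oplus>\<^bsub>H\<^esub> f y"
  by (auto simp: additive_map_def)

lemma additive_map_compose: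
  "additive_map G H f \<Longrightarrow> additive_map H K g \<Longrightarrow> additive_map G K (\<lambda>x. g (f x))"
  by (simp add: additive_map_def Pi_iff)

lemma module_map_additive_map: "module_map R M N f \<Longrightarrow> additive_map M N f"
  by (simp add: module_map_def additive_map_def)

lemma additive_zero:
  assumes "abelian_group G" "abelian_group H" and f: "additive_map G H f"
  shows "f \<zero>\<^bsub>G\<^esub> = \<zero>\<^bsub>H\<^esub>"
proof -
  interpret G: abelian_group G by fact
  interpret H: abelian_group H by fact
  have "f \<zero>\<^bsub>G\<^esub> \<oplus>\<^bsub>H\<^esub> f \<zero>\<^bsub>G\<^esub> = f \<zero>\<^bsub>G\<^esub>"
    using additive_map_add[OF f, of "\<zero>\<^bsub>G\<^esub>" "\<zero>\<^bsub>G\<^esub>"] by simp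
  then show ?thesis
    using additive_map_closed[OF f, of "\<zero>\<^bsub>G\<^esub>"] by (simp add: H.add.l_cancel_one)
qed

lemma additive_minus:
  assumes "abelian_group G" "abelian_group H" and f: "additive_map G H f" and x: "x \<in> carrier G"
  shows "f (\<ominus>\<^bsub>G\<^esub> x) = \<ominus>\<^bsub>H\<^esub> f x"
proof -
  interpret G: abelian_group G by fact
  interpret H: abelian_group H by fact
  have "f (\<ominus>\<^bsub>G\<^esub> x) \<oplus>\<^bsub>H\<^esub> f x = \<zero>\<^bsub>H\<^esub>"
    using additive_map_add[OF f, of "\<ominus>\<^bsub>G\<^esub> x" x] additive_zero[OF assms(1-3)] x by (simp add: G.l_neg)
  then show ?thesis
    using additive_map_closed[OF f] x by (metis G.a_inv_closed H.add.inv_equality)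
qed

lemma module_map_zero:
  "\<lbrakk>left_module R M; left_module R N; module_map R M N f\<rbrakk> \<Longrightarrow> f \<zero>\<^bsub>M\<^esub> = \<zero>\<^bsub>N\<^esub>"
  by (rule additive_zero) (auto simp: left_module_abelian_group module_map_additive_map)

lemma module_map_minus:
  "\<lbrakk>left_module R M; left_module R N; module_map R M N f; x \<in> carrier M\<rbrakk>
    \<Longrightarrow> f (\<ominus>\<^bsub>M\<^esub> x) = \<ominus>\<^bsub>N\<^esub> f x"
  by (rule additive_minus) (auto simp: left_module_abelian_group module_map_additive_map)

lemma module_map_diff:
  assumes "left_module R M" "left_module R N" "module_map R M N f" "x \<in> carrier M" "y \<in> carrier M"
  shows "f (x \<ominus>\<^bsub>M\<^esub> y) = f x \<ominus>\<^bsub>N\<^esub> f y"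
proof -
  interpret M: left_module R M by fact
  show ?thesis
    using assms by (simp add: a_minus_def module_map_add module_map_minus)
qed

lemma module_map_plus:
  assumes "left_module R N" "module_map R M N f" "module_map R M N g" "abelian_group M"
  shows "module_map R M N (\<lambda>x. f x \<oplus>\<^bsub>N\<^esub> g x)"
proof -
  interpret N: left_module R N by fact
  show ?thesis
    using assms
    by (intro module_mapI)
       (simp_all add: module_map_closed module_map_add module_map_smult N.M.a_ac N.smult_r_distr)
qed

lemma module_map_uminus:
  assumes "left_module R N" "module_map R M N f"
  shows "module_map R M N (\<lambda>x. \<ominus>\<^bsub>N\<^esub> f x)"
proof -
  interpret N: left_module R N by fact
  show ?thesis
    using assms
    by (intro module_mapI)
       (simp_all add: module_map_closed module_map_add module_map_smult N.M.minus_add N.smult_r_minus)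
qed

lemma module_map_minus_map:
  assumes "left_module R N" "module_map R M N f" "module_map R M N g" "abelian_group M"
  shows "module_map R M N (\<lambda>x. f x \<ominus>\<^bsub>N\<^esub> g x)"
  using module_map_plus[OF assms(1,2) module_map_uminus[OF assms(1,3)] assms(4)]
  by (simp add: a_minus_def)

lemma module_map_null:
  assumes "left_module R N"
  shows "module_map R M N (\<lambda>x. \<zero>\<^bsub>N\<^esub>)"
proof -
  interpret N: left_module R N by fact
  show ?thesis
    by (intro module_mapI) (simp_all add: N.smult_r_null)
qed

lemma module_map_ident: "module_map R M M (\<lambda>x. x)"
  by (simp add: module_map_def)

lemma module_map_cong:
  assumes "abelian_group M" "\<And>r x. r \<in> carrier R \<Longrightarrow> x \<in> carrier M \<Longrightarrow> r \<odot>\<^bsub>M\<^esub> x \<in> carrier M"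
    "\<And>x. x \<in> carrier M \<Longrightarrow> f x = g x"
  shows "module_map R M N f \<longleftrightarrow> module_map R M N g"
proof -
  interpret M: abelian_group M by fact
  show ?thesis
    using assms by (simp add: module_map_def Pi_iff)
qed

lemma module_map_restrict:
  assumes "left_module R M"
  shows "restrict f (carrier M) \<in> mod_hom R M N \<longleftrightarrow> module_map R M N f"
proof -
  interpret M: left_module R M by fact
  have "module_map R M N (restrict f (carrier M)) \<longleftrightarrow> module_map R M N f"
    by (rule module_map_cong) (auto simp: M.smult_closed intro: left_module_abelian_group[OF assms])
  then show ?thesis
    by (simp add: mod_hom_iff)
qed

lemma mod_hom_eqI:
  assumes "f \<in> mod_hom R M N" "g \<in> mod_hom R M N" "\<And>x. x \<in> carrier M \<Longrightarrow> f x = g x"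
  shows "f = g"
  using assms by (auto simp: mod_hom_iff intro: extensionalityI)

section \<open>Groups of homomorphisms\<close>

lemma hom_group_simps [simp]:
  "carrier (hom_group R M N) = mod_hom R M N"
  "\<zero>\<^bsub>hom_group R M N\<^esub> = (\<lambda>x\<in>carrier M. \<zero>\<^bsub>N\<^esub>)"
  "f \<oplus>\<^bsub>hom_group R M N\<^esub> g = (\<lambda>x\<in>carrier M. f x \<oplus>\<^bsub>N\<^esub> g x)"
  by (simp_all add: hom_group_def)

text \<open>The hypotheses on the source are those at hand for a cohomology group, whose elements are
  cosets on which the scalars act through representatives.\<close>

lemma abelian_group_hom_group:
  assumes "abelian_group M" "\<And>r x. r \<in> carrier R \<Longrightarrow> x \<in> carrier M \<Longrightarrow> r \<odot>\<^bsub>M\<^esub> x \<in> carrier M"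
    and N: "left_module R N"
  shows "abelian_group (hom_group R M N)"
proof -
  interpret M: abelian_group M by fact
  interpret N: left_module R N by fact
  have restr: "restrict f (carrier M) \<in> mod_hom R M N" if "module_map R M N f" for f
    using module_map_cong[OF assms(1,2), where f = f and g = "restrict f (carrier M)" and N = N] that
    by (simp add: mod_hom_iff)
  show ?thesis
  proof (rule abelian_groupI, unfold hom_group_simps)
    fix f g assume "f \<in> mod_hom R M N" "g \<in> mod_hom R M N"
    then show "(\<lambda>x\<in>carrier M. f x \<oplus>\<^bsub>N\<^esub> g x) \<in> mod_hom R M N"
      by (intro restr module_map_plus N M.abelian_group_axioms) (auto simp: mod_hom_iff)
    show "(\<lambda>x\<in>carrier M. f x \<oplus>\<^bsub>N\<^esub> g x) = (\<lambda>x\<in>carrier M. g x \<oplus>\<^bsub>N\<^esub> f x)"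
      using \<open>f \<in> _\<close> \<open>g \<in> _\<close> by (intro restrict_ext) (auto simp: mod_hom_iff module_map_closed N.M.a_comm)
  next
    show "(\<lambda>x\<in>carrier M. \<zero>\<^bsub>N\<^esub>) \<in> mod_hom R M N"
      by (intro restr module_map_null N)
  next
    fix f g h assume "f \<in> mod_hom R M N" "g \<in> mod_hom R M N" "h \<in> mod_hom R M N"
    then show "(\<lambda>x\<in>carrier M. (\<lambda>x\<in>carrier M. f x \<oplus>\<^bsub>N\<^esub> g x) x \<oplus>\<^bsub>N\<^esub> h x)
      = (\<lambda>x\<in>carrier M. f x \<oplus>\<^bsub>N\<^esub> (\<lambda>x\<in>carrier M. g x \<oplus>\<^bsub>N\<^esub> h x) x)"
      by (intro restrict_ext) (auto simp: mod_hom_iff module_map_closed N.M.a_assoc)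
  next
    fix f assume f: "f \<in> mod_hom R M N"
    then show "(\<lambda>x\<in>carrier M. (\<lambda>x\<in>carrier M. \<zero>\<^bsub>N\<^esub>) x \<oplus>\<^bsub>N\<^esub> f x) = f"
      by (intro extensionalityI[where A = "carrier M"]) (auto simp: mod_hom_iff module_map_closed)
    have "(\<lambda>x\<in>carrier M. \<ominus>\<^bsub>N\<^esub> f x) \<in> mod_hom R M N"
      using f by (intro restr module_map_uminus N) (simp add: mod_hom_iff)
    moreover have "(\<lambda>x\<in>carrier M. (\<lambda>x\<in>carrier M. \<ominus>\<^bsub>N\<^esub> f x) x \<oplus>\<^bsub>N\<^esub> f x) = (\<lambda>x\<in>carrier M. \<zero>\<^bsub>N\<^esub>)"
      using f by (intro restrict_ext) (auto simp: mod_hom_iff module_map_closed N.M.l_neg)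
    ultimately show "\<exists>g\<in>mod_hom R M N.
        (\<lambda>x\<in>carrier M. g x \<oplus>\<^bsub>N\<^esub> f x) = (\<lambda>x\<in>carrier M. \<zero>\<^bsub>N\<^esub>)"
      by blast
  qed
qed

lemma abelian_group_hom_group':
  "left_module R M \<Longrightarrow> left_module R N \<Longrightarrow> abelian_group (hom_group R M N)"
  by (rule abelian_group_hom_group)
     (auto simp: left_module_abelian_group left_module.smult_closed)

section \<open>Subquotients and homology\<close>

lemma add_monoid_additive_group: "add_monoid (additive_group G) = (G :: 'a monoid)"
  by (simp add: additive_group_def)

text \<open>A surjection from the cycles whose kernel is the group of boundaries identifies the
  subquotient.\<close>

lemma subquotient_iso_onto:
  fixes H :: "('h, 'y) monoid_scheme"
  assumes G: "abelian_group G" and Z: "additive_subgroup Z G" and B: "additive_subgroup B G"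
    and "B \<subseteq> Z" and H: "group H"
    and onto: "F ` Z = carrier H"
    and add: "\<And>x y. x \<in> Z \<Longrightarrow> y \<in> Z \<Longrightarrow> F (x \<oplus>\<^bsub>G\<^esub> y) = F x \<otimes>\<^bsub>H\<^esub> F y"
    and ker: "\<And>x. x \<in> Z \<Longrightarrow> F x = \<one>\<^bsub>H\<^esub> \<longleftrightarrow> x \<in> B"
  shows "add_monoid (subquotient G Z B) \<cong> H"
proof -
  interpret G: abelian_group G by fact
  interpret Z: additive_subgroup Z G by fact
  have grp: "group (add_monoid G\<lparr>carrier := Z\<rparr>)"
    using Z.a_subgroup by (rule subgroup.subgroup_is_group) (rule G.a_group)
  interpret F: group_hom "add_monoid G\<lparr>carrier := Z\<rparr>" H F
    using grp H onto add by (auto simp: group_hom_def group_hom_axioms_def hom_def)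
  have "kernel (add_monoid G\<lparr>carrier := Z\<rparr>) H F = B"
    using ker \<open>B \<subseteq> Z\<close> by (auto simp: kernel_def)
  moreover have "(add_monoid G\<lparr>carrier := Z\<rparr>) Mod kernel (add_monoid G\<lparr>carrier := Z\<rparr>) H F \<cong> H"
    using onto by (intro F.FactGroup_iso) simp
  ultimately show ?thesis
    unfolding subquotient_def add_monoid_additive_group by (simp only:)
qed

lemma subquotient_simps:
  "carrier (subquotient G Z B) = (\<lambda>x. B +>\<^bsub>G\<^esub> x) ` Z"
  "\<zero>\<^bsub>subquotient G Z B\<^esub> = B"
  "X \<oplus>\<^bsub>subquotient G Z B\<^esub> Y = X <+>\<^bsub>G\<^esub> Y"
  by (auto simp: subquotient_def additive_group_def FactGroup_def RCOSETS_def r_coset_def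
      a_r_coset_def set_add_def set_mult_def)

lemma abelian_group_additive_group: "comm_group G \<Longrightarrow> abelian_group (additive_group G)"
  for G :: "'a monoid"
  by (simp only: abelian_group_def abelian_monoid_def abelian_group_axioms_def
      add_monoid_additive_group comm_group_def)


lemma abelian_group_subquotient:
  assumes G: "abelian_group G" and Z: "additive_subgroup Z G" and B: "additive_subgroup B G"
    and "B \<subseteq> Z"
  shows "abelian_group (subquotient G Z B)"
proof -
  interpret G: abelian_group G by fact
  have sub: "subgroup B ((add_monoid G)\<lparr>carrier := Z\<rparr>)"
    using assms by (intro group.subgroup_incl G.a_group) (auto simp: additive_subgroup_def)
  have "comm_group ((add_monoid G)\<lparr>carrier := Z\<rparr>)"
    using Z by (intro group.group_comm_groupI subgroup.subgroup_is_group[OF _ G.a_group])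
      (auto simp: additive_subgroup_def G.a_comm additive_subgroup.a_Hcarr[OF Z])
  then show ?thesis
    unfolding subquotient_def
    by (intro abelian_group_additive_group comm_group.abelian_FactGroup sub)
qed

lemma coset_eq_iff:
  assumes G: "abelian_group G" and B: "additive_subgroup B G" and "x \<in> carrier G" "y \<in> carrier G"
  shows "B +>\<^bsub>G\<^esub> x = B +>\<^bsub>G\<^esub> y \<longleftrightarrow> (\<exists>b\<in>B. y = x \<oplus>\<^bsub>G\<^esub> b)"
proof -
  interpret G: abelian_group G by fact
  interpret B: abelian_subgroup B G
    using G B by (intro abelian_subgroupI3)
  have "y \<in> B +>\<^bsub>G\<^esub> x \<longleftrightarrow> (\<exists>b\<in>B. y = x \<oplus>\<^bsub>G\<^esub> b)"
    using assms by (auto simp: a_r_coset_def' G.a_comm B.a_Hcarr)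
  moreover have "B +>\<^bsub>G\<^esub> x = B +>\<^bsub>G\<^esub> y \<longleftrightarrow> y \<in> B +>\<^bsub>G\<^esub> x"
    using assms by (metis B.a_rcos_self B.a_subgroup G.a_repr_independence)
  ultimately show ?thesis by simp
qed

lemma coset_eq_self_iff:
  assumes G: "abelian_group G" and B: "additive_subgroup B G" and "x \<in> carrier G"
  shows "B +>\<^bsub>G\<^esub> x = B \<longleftrightarrow> x \<in> B"
proof -
  interpret G: abelian_group G by fact
  interpret B: abelian_subgroup B G
    using G B by (intro abelian_subgroupI3)
  show ?thesis
    using assms by (metis B.a_rcos_const B.a_rcos_self)
qed

text \<open>Maps that carry cycles to cycles and boundaries to boundaries, and that are mutually
  inverse up to boundaries, identify the subquotients.  Isomorphisms of complexes and homotopy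
  equivalences are both instances.\<close>

lemma subquotient_iso:
  assumes G: "abelian_group G" "additive_subgroup Z G" "additive_subgroup B G" "B \<subseteq> Z"
    and G': "abelian_group G'" "additive_subgroup Z' G'" "additive_subgroup B' G'" "B' \<subseteq> Z'"
    and f: "\<And>x. x \<in> Z \<Longrightarrow> f x \<in> Z'" "\<And>x. x \<in> B \<Longrightarrow> f x \<in> B'"
      "\<And>x y. x \<in> Z \<Longrightarrow> y \<in> Z \<Longrightarrow> f (x \<oplus>\<^bsub>G\<^esub> y) = f x \<oplus>\<^bsub>G'\<^esub> f y"
    and g: "\<And>y. y \<in> Z' \<Longrightarrow> g y \<in> Z" "\<And>y. y \<in> B' \<Longrightarrow> g y \<in> B"
    and gf: "\<And>x. x \<in> Z \<Longrightarrow> \<exists>b\<in>B. g (f x) = x \<oplus>\<^bsub>G\<^esub> b"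
    and fg: "\<And>y. y \<in> Z' \<Longrightarrow> \<exists>b\<in>B'. f (g y) = y \<oplus>\<^bsub>G'\<^esub> b"
  shows "add_monoid (subquotient G Z B) \<cong> add_monoid (subquotient G' Z' B')"
proof -
  interpret G: abelian_group G by fact
  interpret G': abelian_group G' by fact
  interpret Z: additive_subgroup Z G by fact
  interpret Z': additive_subgroup Z' G' by fact
  interpret B: additive_subgroup B G by fact
  interpret B': abelian_subgroup B' G'
    using G' by (intro abelian_subgroupI3)
  show ?thesis
  proof (rule subquotient_iso_onto[where F = "\<lambda>x. B' +>\<^bsub>G'\<^esub> f x"])
    show "group (add_monoid (subquotient G' Z' B'))"
      using abelian_group_subquotient[OF G'] by (rule abelian_group.a_group)
    show "(\<lambda>x. B' +>\<^bsub>G'\<^esub> f x) ` Z = carrier (add_monoid (subquotient G' Z' B'))"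
    proof -
      have "B' +>\<^bsub>G'\<^esub> y = B' +>\<^bsub>G'\<^esub> f (g y)" if "y \<in> Z'" for y
        using that fg[OF that] f(1) g(1) by (subst coset_eq_iff[OF G'(1,3)]) auto
      then show ?thesis
        using f(1) g(1) by (auto simp: subquotient_simps)
    qed
    show "B' +>\<^bsub>G'\<^esub> f (x \<oplus>\<^bsub>G\<^esub> y) =
        (B' +>\<^bsub>G'\<^esub> f x) \<otimes>\<^bsub>add_monoid (subquotient G' Z' B')\<^esub> (B' +>\<^bsub>G'\<^esub> f y)"
      if "x \<in> Z" "y \<in> Z" for x y
      using that f by (simp add: subquotient_simps B'.a_rcos_sum)
    show "B' +>\<^bsub>G'\<^esub> f x = \<one>\<^bsub>add_monoid (subquotient G' Z' B')\<^esub> \<longleftrightarrow> x \<in> B" if "x \<in> Z" for x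
    proof -
      obtain b where b: "b \<in> B" "g (f x) = x \<oplus>\<^bsub>G\<^esub> b"
        using gf \<open>x \<in> Z\<close> by blast
      have "x \<in> B" if "f x \<in> B'"
      proof -
        have "(x \<oplus>\<^bsub>G\<^esub> b) \<oplus>\<^bsub>G\<^esub> (\<ominus>\<^bsub>G\<^esub> b) \<in> B"
          using g(2)[OF that] b by (metis B.a_closed B.a_inv_closed)
        then show ?thesis
          using \<open>x \<in> Z\<close> b by (simp add: G.a_assoc G.r_neg)
      qed
      then show ?thesis
        using that f by (auto simp: subquotient_simps coset_eq_self_iff[OF G'(1,3)])
    qed
  qed (use G in auto)
qed

lemma additive_subgroup_carrier: "abelian_group G \<Longrightarrow> additive_subgroup (carrier G) G"
  using group.subgroup_self[OF abelian_group.a_group, of G] by (simp add: additive_subgroup_def)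

lemma additive_subgroupI:
  assumes G: "abelian_group G" and "H \<subseteq> carrier G" "\<zero>\<^bsub>G\<^esub> \<in> H"
    and "\<And>x. x \<in> H \<Longrightarrow> \<ominus>\<^bsub>G\<^esub> x \<in> H" "\<And>x y. x \<in> H \<Longrightarrow> y \<in> H \<Longrightarrow> x \<oplus>\<^bsub>G\<^esub> y \<in> H"
  shows "additive_subgroup H G"
proof -
  interpret G: abelian_group G by fact
  show ?thesis
    unfolding additive_subgroup_def
    using assms by (intro G.add.subgroupI) (auto simp: a_inv_def)
qed

lemma additive_subgroup_kernel:
  assumes G: "abelian_group G" and H: "abelian_group H" and f: "additive_map G H f"
  shows "additive_subgroup {x \<in> carrier G. f x = \<zero>\<^bsub>H\<^esub>} G"
proof -
  interpret G: abelian_group G by fact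
  interpret H: abelian_group H by fact
  show ?thesis
    using additive_zero[OF assms] additive_minus[OF assms] additive_map_add[OF f]
    by (intro additive_subgroupI G) auto
qed

lemma additive_subgroup_image:
  assumes G: "abelian_group G" and H: "abelian_group H" and f: "additive_map G H f"
  shows "additive_subgroup (f ` carrier G) H"
proof -
  interpret G: abelian_group G by fact
  interpret H: abelian_group H by fact
  show ?thesis
  proof (rule additive_subgroupI[OF H])
    show "\<zero>\<^bsub>H\<^esub> \<in> f ` carrier G"
      using additive_zero[OF assms] by (metis G.zero_closed image_eqI)
    show "\<ominus>\<^bsub>H\<^esub> y \<in> f ` carrier G" if "y \<in> f ` carrier G" for y
      using that by (auto simp flip: additive_minus[OF assms])
    show "y \<oplus>\<^bsub>H\<^esub> z \<in> f ` carrier G" if "y \<in> f ` carrier G" "z \<in> f ` carrier G" for y z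
      using that by (auto simp flip: additive_map_add[OF f])
  qed (use additive_map_closed[OF f] in auto)
qed

text \<open>The inverse bijections are again additive and commute with the differentials.\<close>

lemma homology_iso:
  fixes C :: "nat \<Rightarrow> ('c, 'x) ring_scheme" and C' :: "nat \<Rightarrow> ('d, 'y) ring_scheme"
  assumes C: "\<And>n. abelian_group (C n)" and C': "\<And>n. abelian_group (C' n)"
    and d: "\<And>n. additive_map (C (Suc n)) (C n) (d n)"
    and dd: "\<And>n x. x \<in> carrier (C (Suc (Suc n))) \<Longrightarrow> d n (d (Suc n) x) = \<zero>\<^bsub>C n\<^esub>"
    and bij: "\<And>n. bij_betw (\<alpha> n) (carrier (C n)) (carrier (C' n))"
    and \<alpha>: "\<And>n. additive_map (C n) (C' n) (\<alpha> n)"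
    and comm: "\<And>n x. x \<in> carrier (C (Suc n)) \<Longrightarrow> \<alpha> n (d n x) = d' n (\<alpha> (Suc n) x)"
  shows "add_monoid (homology C d n) \<cong> add_monoid (homology C' d' n)"
proof -
  define \<beta> where "\<beta> n = inv_into (carrier (C n)) (\<alpha> n)" for n
  have \<beta>: "\<beta> n y \<in> carrier (C n)" and \<alpha>\<beta>: "\<alpha> n (\<beta> n y) = y" if "y \<in> carrier (C' n)" for n y
    using bij[of n] that by (auto simp: bij_betw_def \<beta>_def inv_into_into f_inv_into_f)
  have \<beta>\<alpha>: "\<beta> n (\<alpha> n x) = x" if "x \<in> carrier (C n)" for n x
    using bij[of n] that by (auto simp: bij_betw_def \<beta>_def)
  have \<beta>_add: "additive_map (C' n) (C n) (\<beta> n)" for n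
  proof (rule additive_mapI)
    interpret abelian_group "C n" by (rule C)
    fix x y assume "x \<in> carrier (C' n)" "y \<in> carrier (C' n)"
    then show "\<beta> n (x \<oplus>\<^bsub>C' n\<^esub> y) = \<beta> n x \<oplus>\<^bsub>C n\<^esub> \<beta> n y"
      using additive_map_add[OF \<alpha>, of "\<beta> n x" n "\<beta> n y"] \<beta> \<alpha>\<beta> \<beta>\<alpha> by (metis a_closed)
  qed (rule \<beta>)
  have d'_eq: "d' n y = \<alpha> n (d n (\<beta> (Suc n) y))" if "y \<in> carrier (C' (Suc n))" for n y
    using that \<beta> \<alpha>\<beta> by (simp add: comm)
  have d': "additive_map (C' (Suc n)) (C' n) (d' n)" for n
  proof -
    interpret abelian_group "C' (Suc n)" by (rule C')
    have "additive_map (C' (Suc n)) (C' n) (\<lambda>y. \<alpha> n (d n (\<beta> (Suc n) y)))"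
      by (rule additive_map_compose[OF additive_map_compose[OF \<beta>_add d] \<alpha>])
    then show ?thesis
      by (simp add: additive_map_def d'_eq Pi_iff)
  qed
  note cl = additive_map_closed[OF \<alpha>] additive_map_closed[OF d] additive_map_closed[OF d'] \<beta>
  have \<alpha>0: "\<alpha> n \<zero>\<^bsub>C n\<^esub> = \<zero>\<^bsub>C' n\<^esub>" and \<beta>0: "\<beta> n \<zero>\<^bsub>C' n\<^esub> = \<zero>\<^bsub>C n\<^esub>" for n
    by (rule additive_zero[OF C C' \<alpha>] additive_zero[OF C' C \<beta>_add])+
  have dd': "d' n (d' (Suc n) y) = \<zero>\<^bsub>C' n\<^esub>" if "y \<in> carrier (C' (Suc (Suc n)))" for n y
    using that by (simp add: d'_eq[OF that] dd \<alpha>0 cl flip: comm)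
  define Z where "Z = (case n of 0 \<Rightarrow> carrier (C 0) | Suc k \<Rightarrow> {z \<in> carrier (C n). d k z = \<zero>\<^bsub>C k\<^esub>})"
  define Z' where "Z' = (case n of 0 \<Rightarrow> carrier (C' 0) | Suc k \<Rightarrow> {z \<in> carrier (C' n). d' k z = \<zero>\<^bsub>C' k\<^esub>})"
  have Zc: "x \<in> carrier (C n)" if "x \<in> Z" for x
    using that by (auto simp: Z_def split: nat.splits)
  have Zc': "x \<in> carrier (C' n)" if "x \<in> Z'" for x
    using that by (auto simp: Z'_def split: nat.splits)
  interpret Cn: abelian_group "C n" by (rule C)
  interpret Cn': abelian_group "C' n" by (rule C')
  have B: "additive_subgroup (d n ` carrier (C (Suc n))) (C n)"
    by (rule additive_subgroup_image[OF C C d])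
  have B': "additive_subgroup (d' n ` carrier (C' (Suc n))) (C' n)"
    by (rule additive_subgroup_image[OF C' C' d'])
  show ?thesis
    unfolding homology_def Z_def[symmetric] Z'_def[symmetric]
  proof (rule subquotient_iso[where f = "\<alpha> n" and g = "\<beta> n"])
    show "additive_subgroup Z (C n)"
      by (cases n) (auto simp: Z_def C additive_subgroup_carrier
          intro!: additive_subgroup_kernel[OF C C d])
    show "additive_subgroup Z' (C' n)"
      by (cases n) (auto simp: Z'_def C' additive_subgroup_carrier
          intro!: additive_subgroup_kernel[OF C' C' d'])
    show "d n ` carrier (C (Suc n)) \<subseteq> Z"
      by (cases n) (auto simp: Z_def cl dd)
    show "d' n ` carrier (C' (Suc n)) \<subseteq> Z'"
      by (cases n) (auto simp: Z'_def cl dd')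
    show "\<alpha> n x \<in> Z'" if "x \<in> Z" for x
      using that by (cases n) (auto simp: Z_def Z'_def cl \<alpha>0 simp flip: comm)
    show "\<beta> n y \<in> Z" if y: "y \<in> Z'" for y
    proof (cases n)
      case 0
      then show ?thesis using y by (simp add: Z_def Z'_def \<beta>)
    next
      case (Suc k)
      then have "y \<in> carrier (C' (Suc k))" "d' k y = \<zero>\<^bsub>C' k\<^esub>"
        using y by (auto simp: Z'_def)
      then have "d k (\<beta> (Suc k) y) = \<zero>\<^bsub>C k\<^esub>"
        using \<beta>\<alpha>[of "d k (\<beta> (Suc k) y)" k] \<beta>0 by (simp add: d'_eq cl)
      then show ?thesis
        using \<open>y \<in> carrier (C' (Suc k))\<close> Suc by (simp add: Z_def \<beta>)
    qed
    show "\<alpha> n x \<in> d' n ` carrier (C' (Suc n))" if "x \<in> d n ` carrier (C (Suc n))" for x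
      using that by (auto simp: comm cl)
    show "\<beta> n y \<in> d n ` carrier (C (Suc n))" if "y \<in> d' n ` carrier (C' (Suc n))" for y
      using that by (auto simp: d'_eq \<beta>\<alpha> cl)
    show "\<exists>b\<in>d n ` carrier (C (Suc n)). \<beta> n (\<alpha> n x) = x \<oplus>\<^bsub>C n\<^esub> b" if "x \<in> Z" for x
      using Zc[OF that] additive_subgroup.zero_closed[OF B] \<beta>\<alpha> by (metis Cn.r_zero)
    show "\<exists>b\<in>d' n ` carrier (C' (Suc n)). \<alpha> n (\<beta> n y) = y \<oplus>\<^bsub>C' n\<^esub> b" if "y \<in> Z'" for y
      using Zc'[OF that] additive_subgroup.zero_closed[OF B'] \<alpha>\<beta> by (metis Cn'.r_zero)
    show "\<alpha> n (x \<oplus>\<^bsub>C n\<^esub> y) = \<alpha> n x \<oplus>\<^bsub>C' n\<^esub> \<alpha> n y" if "x \<in> Z" "y \<in> Z" for x y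
      using that Zc by (simp add: additive_map_add[OF \<alpha>])
  qed (use C C' B B' in auto)
qed

section \<open>Baer's criterion\<close>

lemma submodule_iff:
  "submodule A R M \<longleftrightarrow> additive_subgroup A M \<and> (\<forall>r\<in>carrier R. \<forall>x\<in>A. r \<odot>\<^bsub>M\<^esub> x \<in> A)"
  by (auto simp: submodule_def submodule_axioms_def additive_subgroup_def)

text \<open>Apart from the empty set, these are the graphs of homomorphisms from submodules of \<open>B\<close> to \<open>N\<close>:
  for a submodule of \<open>B \<times> N\<close>, having no pair \<open>(0, y)\<close> with \<open>y \<noteq> 0\<close> means being single-valued.  In this
  form, a union of a chain is visibly of the same kind, as Zorn's lemma requires.\<close>

definition partial_hom_graph ::
  "'r ring \<Rightarrow> ('r, 'm, 'x) module_scheme \<Rightarrow> ('r, 'n, 'y) module_scheme \<Rightarrow> ('m \<times> 'n) set \<Rightarrow> bool" where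
  "partial_hom_graph R B N G \<longleftrightarrow> G \<subseteq> carrier B \<times> carrier N \<and>
     (\<forall>x y x' y'. (x, y) \<in> G \<longrightarrow> (x', y') \<in> G \<longrightarrow> (x \<oplus>\<^bsub>B\<^esub> x', y \<oplus>\<^bsub>N\<^esub> y') \<in> G) \<and>
     (\<forall>r\<in>carrier R. \<forall>x y. (x, y) \<in> G \<longrightarrow> (r \<odot>\<^bsub>B\<^esub> x, r \<odot>\<^bsub>N\<^esub> y) \<in> G) \<and>
     (\<forall>y. (\<zero>\<^bsub>B\<^esub>, y) \<in> G \<longrightarrow> y = \<zero>\<^bsub>N\<^esub>)"

lemma partial_hom_graphD:
  assumes "partial_hom_graph R B N G"
  shows "(x, y) \<in> G \<Longrightarrow> x \<in> carrier B" "(x, y) \<in> G \<Longrightarrow> y \<in> carrier N"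
    "\<lbrakk>(x, y) \<in> G; (x', y') \<in> G\<rbrakk> \<Longrightarrow> (x \<oplus>\<^bsub>B\<^esub> x', y \<oplus>\<^bsub>N\<^esub> y') \<in> G"
    "\<lbrakk>r \<in> carrier R; (x, y) \<in> G\<rbrakk> \<Longrightarrow> (r \<odot>\<^bsub>B\<^esub> x, r \<odot>\<^bsub>N\<^esub> y) \<in> G"
    "(\<zero>\<^bsub>B\<^esub>, y) \<in> G \<Longrightarrow> y = \<zero>\<^bsub>N\<^esub>"
  using assms unfolding partial_hom_graph_def by blast+

lemma left_module_ring_self:
  "ring R \<Longrightarrow> left_module R (with_smult R (\<lambda>r x. r \<otimes>\<^bsub>R\<^esub> x))"
proof -
  assume "ring R"
  then interpret ring R .
  have "abelian_group (with_smult R (\<lambda>r x. r \<otimes>\<^bsub>R\<^esub> x))"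
    by (rule abelian_groupI) (auto simp: with_smult_def a_ac intro: l_neg)
  then show ?thesis
    using \<open>ring R\<close>
    by (auto simp: left_module_def left_module_axioms_def with_smult_def l_distr r_distr m_assoc)
qed

lemma left_module_submodule:
  assumes M: "left_module R M" and A: "submodule A R M"
  shows "left_module R (M\<lparr>carrier := A\<rparr>)"
proof -
  interpret M: left_module R M by fact
  interpret A: additive_subgroup A M
    using A by (simp add: submodule_iff)
  have "abelian_group (M\<lparr>carrier := A\<rparr>)"
  proof (rule abelian_groupI)
    fix x assume "x \<in> carrier (M\<lparr>carrier := A\<rparr>)"
    then show "\<exists>y\<in>carrier (M\<lparr>carrier := A\<rparr>). y \<oplus>\<^bsub>M\<lparr>carrier := A\<rparr>\<^esub> x = \<zero>\<^bsub>M\<lparr>carrier := A\<rparr>\<^esub>"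
      by (intro bexI[of _ "\<ominus>\<^bsub>M\<^esub> x"]) (simp_all add: M.M.l_neg)
  qed (auto simp: M.M.a_ac)
  then show ?thesis
    using A M.R.ring_axioms
    by (auto simp: left_module_def left_module_axioms_def submodule_iff M.smult_l_distr
        M.smult_r_distr M.smult_assoc M.smult_one)
qed

lemma partial_hom_graph_unique:
  assumes B: "left_module R B" and N: "left_module R N" and G: "partial_hom_graph R B N G"
    and "(x, y) \<in> G" "(x, y') \<in> G"
  shows "y = y'"
proof -
  interpret B: left_module R B by fact
  interpret N: left_module R N by fact
  note GD = partial_hom_graphD[OF G]
  have c: "x \<in> carrier B" "y \<in> carrier N" "y' \<in> carrier N"
    using assms(4,5) GD by auto
  \<comment> \<open>Negation is the action of \<open>- 1\<close>, so a graph is closed under it.\<close>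
  have "(\<ominus>\<^bsub>R\<^esub> \<one>\<^bsub>R\<^esub> \<odot>\<^bsub>B\<^esub> x, \<ominus>\<^bsub>R\<^esub> \<one>\<^bsub>R\<^esub> \<odot>\<^bsub>N\<^esub> y') \<in> G"
    using assms(5) by (intro GD(4)) auto
  then have "(\<ominus>\<^bsub>B\<^esub> x, \<ominus>\<^bsub>N\<^esub> y') \<in> G"
    using c by (simp add: B.smult_l_minus N.smult_l_minus B.smult_one N.smult_one)
  from GD(3)[OF assms(4) this] have "y \<oplus>\<^bsub>N\<^esub> \<ominus>\<^bsub>N\<^esub> y' = \<zero>\<^bsub>N\<^esub>"
    using c by (intro GD(5)) (simp add: B.M.r_neg)
  then show ?thesis
    using c by (metis N.M.a_inv_closed N.M.minus_equality N.M.minus_minus N.M.a_comm)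
qed

text \<open>The extension step of Baer's argument: a partial homomorphism \<open>g\<close> induces a homomorphism
  \<open>r \<mapsto> g(r b)\<close> on the ideal of all \<open>r\<close> with \<open>r b\<close> in its domain; extending this to the ring gives,
  at \<open>1\<close>, an admissible value at \<open>b\<close>.\<close>

lemma partial_hom_graph_extend:
  assumes inj: "injective_left R N" and B: "left_module R B" and G: "partial_hom_graph R B N G"
    and zero: "(\<zero>\<^bsub>B\<^esub>, \<zero>\<^bsub>N\<^esub>) \<in> G" and b: "b \<in> carrier B"
  obtains G' n where "partial_hom_graph R B N G'" "G \<subseteq> G'" "(b, n) \<in> G'"
proof -
  have N: "left_module R N"
    using inj by (simp add: injective_left_def)
  interpret B: left_module R B by fact
  interpret N: left_module R N by fact
  note GD = partial_hom_graphD[OF G]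
  note Gu = partial_hom_graph_unique[OF B N G]
  define RR where "RR = with_smult R (\<lambda>r x. r \<otimes>\<^bsub>R\<^esub> x)"
  define I where "I = {r \<in> carrier R. \<exists>y. (r \<odot>\<^bsub>B\<^esub> b, y) \<in> G}"
  define \<phi> where "\<phi> = (\<lambda>r. THE y. (r \<odot>\<^bsub>B\<^esub> b, y) \<in> G)"
  have \<phi>: "\<phi> r = y" if "(r \<odot>\<^bsub>B\<^esub> b, y) \<in> G" for r y
    unfolding \<phi>_def using that Gu by blast
  have \<phi>G: "(r \<odot>\<^bsub>B\<^esub> b, \<phi> r) \<in> G" if "r \<in> I" for r
    using that \<phi> unfolding I_def by blast
  have RR: "left_module R RR"
    unfolding RR_def by (rule left_module_ring_self) (rule B.R.ring_axioms)
  interpret RR: left_module R RR by fact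
  have RR_simps: "carrier RR = carrier R" "\<And>x y. x \<oplus>\<^bsub>RR\<^esub> y = x \<oplus>\<^bsub>R\<^esub> y"
    "\<And>x y. x \<odot>\<^bsub>RR\<^esub> y = x \<otimes>\<^bsub>R\<^esub> y" "\<zero>\<^bsub>RR\<^esub> = \<zero>\<^bsub>R\<^esub>"
    by (simp_all add: RR_def with_smult_def)
  have Iadd: "r \<oplus>\<^bsub>R\<^esub> s \<in> I \<and> \<phi> (r \<oplus>\<^bsub>R\<^esub> s) = \<phi> r \<oplus>\<^bsub>N\<^esub> \<phi> s" if "r \<in> I" "s \<in> I" for r s
  proof -
    have "((r \<oplus>\<^bsub>R\<^esub> s) \<odot>\<^bsub>B\<^esub> b, \<phi> r \<oplus>\<^bsub>N\<^esub> \<phi> s) \<in> G"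
      using GD(3)[OF \<phi>G[OF that(1)] \<phi>G[OF that(2)]] that b
      by (simp add: I_def B.smult_l_distr)
    then show ?thesis
      using that \<phi> by (auto simp: I_def)
  qed
  have Ismult: "s \<otimes>\<^bsub>R\<^esub> r \<in> I \<and> \<phi> (s \<otimes>\<^bsub>R\<^esub> r) = s \<odot>\<^bsub>N\<^esub> \<phi> r" if "s \<in> carrier R" "r \<in> I" for r s
  proof -
    have "((s \<otimes>\<^bsub>R\<^esub> r) \<odot>\<^bsub>B\<^esub> b, s \<odot>\<^bsub>N\<^esub> \<phi> r) \<in> G"
      using GD(4)[OF that(1) \<phi>G[OF that(2)]] that b
      by (simp add: I_def B.smult_assoc)
    then show ?thesis
      using that \<phi> by (auto simp: I_def)
  qed
  have Isub: "submodule I R RR"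
  proof -
    have "\<ominus>\<^bsub>RR\<^esub> r \<in> I" if "r \<in> I" for r
    proof -
      have r: "r \<in> carrier R" using that by (simp add: I_def)
      have "\<ominus>\<^bsub>R\<^esub> \<one>\<^bsub>R\<^esub> \<odot>\<^bsub>RR\<^esub> r = \<ominus>\<^bsub>RR\<^esub> r"
        using r RR.smult_l_minus[of "\<one>\<^bsub>R\<^esub>" r] RR.smult_one[of r] by (simp add: RR_simps(1))
      then show ?thesis
        using Ismult[of "\<ominus>\<^bsub>R\<^esub> \<one>\<^bsub>R\<^esub>" r] that by (simp add: RR_simps(3))
    qed
    moreover have "\<zero>\<^bsub>R\<^esub> \<in> I"
      using zero b by (auto simp: I_def B.smult_l_null)
    ultimately show ?thesis
      unfolding submodule_iff using Iadd Ismult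
      by (intro conjI additive_subgroupI RR.M.abelian_group_axioms) (auto simp: RR_simps I_def)
  qed
  have J: "left_module R (RR\<lparr>carrier := I\<rparr>)"
    by (rule left_module_submodule[OF RR Isub])
  have IR: "I \<subseteq> carrier R" by (auto simp: I_def)
  have inc: "(\<lambda>x\<in>I. x) \<in> mod_hom R (RR\<lparr>carrier := I\<rparr>) RR"
    using IR Iadd Ismult by (auto simp: mod_hom_def RR_simps)
  have f: "restrict \<phi> I \<in> mod_hom R (RR\<lparr>carrier := I\<rparr>) N"
    using Iadd Ismult GD(2)[OF \<phi>G] by (auto simp: mod_hom_def RR_simps)
  have "\<exists>h\<in>mod_hom R RR N. compose (carrier (RR\<lparr>carrier := I\<rparr>)) h (\<lambda>x\<in>I. x) = restrict \<phi> I"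
    by (rule inj[unfolded injective_left_def, THEN conjunct2, rule_format, OF inc f])
      (simp add: J RR inj_on_def)
  then obtain h where hom: "h \<in> mod_hom R RR N" and comp: "compose I h (\<lambda>x\<in>I. x) = restrict \<phi> I"
    by auto
  have h: "module_map R RR N h" "\<And>r. r \<in> I \<Longrightarrow> h r = \<phi> r"
    subgoal using hom by (simp add: mod_hom_iff)
    subgoal for r using fun_cong[OF comp, of r] by (simp add: compose_eq)
    done
  define n where "n = h \<one>\<^bsub>R\<^esub>"
  have n: "n \<in> carrier N"
    unfolding n_def by (rule module_map_closed[OF h(1)]) (simp add: RR_simps)
  have hr: "h r = r \<odot>\<^bsub>N\<^esub> n" if "r \<in> carrier R" for r
    using module_map_smult[OF h(1), of r "\<one>\<^bsub>R\<^esub>"] that by (simp add: RR_simps n_def)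
  define G' where "G' = {(x \<oplus>\<^bsub>B\<^esub> r \<odot>\<^bsub>B\<^esub> b, y \<oplus>\<^bsub>N\<^esub> r \<odot>\<^bsub>N\<^esub> n) | x y r. (x, y) \<in> G \<and> r \<in> carrier R}"
  show thesis
  proof
    show "G \<subseteq> G'"
    proof
      fix p assume p: "p \<in> G"
      obtain x y where xy: "p = (x, y)" by (cases p)
      have "(x, y) = (x \<oplus>\<^bsub>B\<^esub> \<zero>\<^bsub>R\<^esub> \<odot>\<^bsub>B\<^esub> b, y \<oplus>\<^bsub>N\<^esub> \<zero>\<^bsub>R\<^esub> \<odot>\<^bsub>N\<^esub> n)"
        using GD(1,2) p b n by (simp add: B.smult_l_null N.smult_l_null xy)
      then show "p \<in> G'"
        using p xy unfolding G'_def by blast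
    qed
    have "(b, n) = (\<zero>\<^bsub>B\<^esub> \<oplus>\<^bsub>B\<^esub> \<one>\<^bsub>R\<^esub> \<odot>\<^bsub>B\<^esub> b, \<zero>\<^bsub>N\<^esub> \<oplus>\<^bsub>N\<^esub> \<one>\<^bsub>R\<^esub> \<odot>\<^bsub>N\<^esub> n)"
      using b n by (simp add: B.smult_one N.smult_one)
    then show "(b, n) \<in> G'"
      using zero unfolding G'_def by blast
    show "partial_hom_graph R B N G'"
      unfolding partial_hom_graph_def
    proof (intro conjI allI impI ballI)
      show "G' \<subseteq> carrier B \<times> carrier N"
        using GD(1,2) b n by (auto simp: G'_def B.smult_closed N.smult_closed)
    next
      fix u v u' v' assume "(u, v) \<in> G'" "(u', v') \<in> G'"
      then obtain x y r x' y' r' where *: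
        "u = x \<oplus>\<^bsub>B\<^esub> r \<odot>\<^bsub>B\<^esub> b" "v = y \<oplus>\<^bsub>N\<^esub> r \<odot>\<^bsub>N\<^esub> n" "(x, y) \<in> G" "r \<in> carrier R"
        "u' = x' \<oplus>\<^bsub>B\<^esub> r' \<odot>\<^bsub>B\<^esub> b" "v' = y' \<oplus>\<^bsub>N\<^esub> r' \<odot>\<^bsub>N\<^esub> n" "(x', y') \<in> G" "r' \<in> carrier R"
        unfolding G'_def by blast
      have "u \<oplus>\<^bsub>B\<^esub> u' = (x \<oplus>\<^bsub>B\<^esub> x') \<oplus>\<^bsub>B\<^esub> (r \<oplus>\<^bsub>R\<^esub> r') \<odot>\<^bsub>B\<^esub> b"
        "v \<oplus>\<^bsub>N\<^esub> v' = (y \<oplus>\<^bsub>N\<^esub> y') \<oplus>\<^bsub>N\<^esub> (r \<oplus>\<^bsub>R\<^esub> r') \<odot>\<^bsub>N\<^esub> n"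
        using * GD(1,2) b n
        by (simp_all add: B.smult_l_distr N.smult_l_distr B.smult_closed N.smult_closed
            B.M.a_ac N.M.a_ac)
      then show "(u \<oplus>\<^bsub>B\<^esub> u', v \<oplus>\<^bsub>N\<^esub> v') \<in> G'"
        using GD(3) * unfolding G'_def by blast
    next
      fix s u v assume s: "s \<in> carrier R" and "(u, v) \<in> G'"
      then obtain x y r where *:
        "u = x \<oplus>\<^bsub>B\<^esub> r \<odot>\<^bsub>B\<^esub> b" "v = y \<oplus>\<^bsub>N\<^esub> r \<odot>\<^bsub>N\<^esub> n" "(x, y) \<in> G" "r \<in> carrier R"
        unfolding G'_def by blast
      have "s \<odot>\<^bsub>B\<^esub> u = s \<odot>\<^bsub>B\<^esub> x \<oplus>\<^bsub>B\<^esub> (s \<otimes>\<^bsub>R\<^esub> r) \<odot>\<^bsub>B\<^esub> b"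
        "s \<odot>\<^bsub>N\<^esub> v = s \<odot>\<^bsub>N\<^esub> y \<oplus>\<^bsub>N\<^esub> (s \<otimes>\<^bsub>R\<^esub> r) \<odot>\<^bsub>N\<^esub> n"
        using * s GD(1,2) b n
        by (simp_all add: B.smult_r_distr N.smult_r_distr B.smult_assoc N.smult_assoc
            B.smult_closed N.smult_closed)
      moreover have "(s \<odot>\<^bsub>B\<^esub> x, s \<odot>\<^bsub>N\<^esub> y) \<in> G" "s \<otimes>\<^bsub>R\<^esub> r \<in> carrier R"
        using s * GD(4) by auto
      ultimately show "(s \<odot>\<^bsub>B\<^esub> u, s \<odot>\<^bsub>N\<^esub> v) \<in> G'"
        unfolding G'_def by blast
    next
      fix v assume "(\<zero>\<^bsub>B\<^esub>, v) \<in> G'"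
      then obtain x y r where *:
        "\<zero>\<^bsub>B\<^esub> = x \<oplus>\<^bsub>B\<^esub> r \<odot>\<^bsub>B\<^esub> b" "v = y \<oplus>\<^bsub>N\<^esub> r \<odot>\<^bsub>N\<^esub> n" "(x, y) \<in> G" "r \<in> carrier R"
        unfolding G'_def by blast
      have c: "x \<in> carrier B" "y \<in> carrier N" "r \<odot>\<^bsub>B\<^esub> b \<in> carrier B"
        using * GD b by (auto simp: B.smult_closed)
      \<comment> \<open>Here \<open>(- r) b = x\<close> lies in the domain, so the extension of \<open>\<phi>\<close> forces
          \<open>(- r) n = \<phi> (- r) = y\<close>.\<close>
      have "(\<ominus>\<^bsub>R\<^esub> r) \<odot>\<^bsub>B\<^esub> b = x"
        using * b c by (metis B.M.minus_equality B.smult_l_minus)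
      then have "((\<ominus>\<^bsub>R\<^esub> r) \<odot>\<^bsub>B\<^esub> b, y) \<in> G"
        using * by simp
      moreover from this have "\<ominus>\<^bsub>R\<^esub> r \<in> I"
        using * by (auto simp: I_def)
      ultimately have "(\<ominus>\<^bsub>R\<^esub> r) \<odot>\<^bsub>N\<^esub> n = y"
        using \<phi> h(2) hr * by (metis B.R.a_inv_closed)
      then show "v = \<zero>\<^bsub>N\<^esub>"
        using * n by (auto simp: N.smult_l_minus N.smult_closed N.M.l_neg)
    qed
  qed
qed

text \<open>A maximal graph above that of \<open>f\<close> is total, since otherwise it could be extended by one more
  element.  The type of \<open>B\<close> is arbitrary, whereas injectivity only speaks of modules in the type of
  the ring.\<close>

theorem injective_left_extension:
  fixes B :: "('r, 'b, 'x) module_scheme"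
  assumes inj: "injective_left R N" and B: "left_module R B" and A: "submodule A R B"
    and f: "module_map R (B\<lparr>carrier := A\<rparr>) N f"
  obtains h where "h \<in> mod_hom R B N" "\<And>x. x \<in> A \<Longrightarrow> h x = f x"
proof -
  have N: "left_module R N"
    using inj by (simp add: injective_left_def)
  interpret B: left_module R B by fact
  interpret N: left_module R N by fact
  interpret A: additive_subgroup A B
    using A by (simp add: submodule_iff)
  define G0 where "G0 = (\<lambda>x. (x, f x)) ` A"
  have f0: "f \<zero>\<^bsub>B\<^esub> = \<zero>\<^bsub>N\<^esub>"
    using module_map_zero[OF left_module_submodule[OF B A] N f] by simp
  have G0: "partial_hom_graph R B N G0"
    using f A f0 unfolding partial_hom_graph_def G0_def
    by (auto simp: submodule_iff module_map_def image_iff)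
  have "\<exists>M\<in>{G. partial_hom_graph R B N G \<and> G0 \<subseteq> G}.
      \<forall>X\<in>{G. partial_hom_graph R B N G \<and> G0 \<subseteq> G}. M \<subseteq> X \<longrightarrow> X = M"
  proof (rule subset_Zorn_nonempty)
    show "{G. partial_hom_graph R B N G \<and> G0 \<subseteq> G} \<noteq> {}"
      using G0 by blast
    fix \<C> assume ne: "\<C> \<noteq> {}"
      and ch: "subset.chain {G. partial_hom_graph R B N G \<and> G0 \<subseteq> G} \<C>"
    have g: "partial_hom_graph R B N G" "G0 \<subseteq> G" if "G \<in> \<C>" for G
      using ch that by (auto simp: subset.chain_def)
    have "partial_hom_graph R B N (\<Union>\<C>)"
      unfolding partial_hom_graph_def
    proof (intro conjI allI impI ballI)
      show "\<Union>\<C> \<subseteq> carrier B \<times> carrier N"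
        using partial_hom_graphD(1,2)[OF g(1)] by auto
    next
      fix x y x' y' assume "(x, y) \<in> \<Union>\<C>" "(x', y') \<in> \<Union>\<C>"
      then obtain G G' where "G \<in> \<C>" "G' \<in> \<C>" "(x, y) \<in> G" "(x', y') \<in> G'" by blast
      moreover from this ch have "G \<subseteq> G' \<or> G' \<subseteq> G"
        by (auto simp: subset_chain_def)
      ultimately obtain K where "K \<in> \<C>" "(x, y) \<in> K" "(x', y') \<in> K"
        by blast
      then show "(x \<oplus>\<^bsub>B\<^esub> x', y \<oplus>\<^bsub>N\<^esub> y') \<in> \<Union>\<C>"
        using partial_hom_graphD(3)[OF g(1)] by blast
    next
      fix r x y assume "r \<in> carrier R" "(x, y) \<in> \<Union>\<C>"
      then show "(r \<odot>\<^bsub>B\<^esub> x, r \<odot>\<^bsub>N\<^esub> y) \<in> \<Union>\<C>"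
        using partial_hom_graphD(4)[OF g(1)] by blast
    next
      fix y assume "(\<zero>\<^bsub>B\<^esub>, y) \<in> \<Union>\<C>"
      then show "y = \<zero>\<^bsub>N\<^esub>"
        using partial_hom_graphD(5)[OF g(1)] by blast
    qed
    then show "\<Union>\<C> \<in> {G. partial_hom_graph R B N G \<and> G0 \<subseteq> G}"
      using ne g(2) by blast
  qed
  then obtain G where G: "partial_hom_graph R B N G" "G0 \<subseteq> G"
    and max: "\<And>X. partial_hom_graph R B N X \<Longrightarrow> G0 \<subseteq> X \<Longrightarrow> G \<subseteq> X \<Longrightarrow> X = G"
    by (elim bexE CollectE conjE) simp
  note GD = partial_hom_graphD[OF G(1)]
  note Gu = partial_hom_graph_unique[OF B N G(1)]
  have zero: "(\<zero>\<^bsub>B\<^esub>, \<zero>\<^bsub>N\<^esub>) \<in> G"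
    using G(2) f0 A.zero_closed unfolding G0_def by (metis image_eqI subsetD)
  have total: "\<exists>n. (b, n) \<in> G" if "b \<in> carrier B" for b
  proof -
    obtain G' n where "partial_hom_graph R B N G'" "G \<subseteq> G'" "(b, n) \<in> G'"
      using partial_hom_graph_extend[OF inj B G(1) zero \<open>b \<in> carrier B\<close>] .
    moreover from this have "G' = G"
      using G(2) by (intro max) auto
    ultimately show ?thesis by blast
  qed
  define h where "h = (\<lambda>x\<in>carrier B. THE y. (x, y) \<in> G)"
  have h: "h x = y" if "(x, y) \<in> G" for x y
    unfolding h_def using that Gu GD(1)[OF that] by (simp add: the_equality)
  have hG: "(x, h x) \<in> G" if "x \<in> carrier B" for x
    using total[OF that] h by blast
  show thesis
  proof
    show "h x = f x" if "x \<in> A" for x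
      using that G(2) by (intro h) (auto simp: G0_def)
    have "module_map R B N h"
      by (intro module_mapI) (blast intro: h GD(3,4) GD(2)[OF hG] hG)+
    then show "h \<in> mod_hom R B N"
      by (simp add: mod_hom_iff h_def)
  qed
qed

section \<open>Duality between cohomology and the homology of Hom complexes\<close>

lemma with_smult_simps [simp]:
  "carrier (with_smult G act) = carrier G" "\<zero>\<^bsub>with_smult G act\<^esub> = \<zero>\<^bsub>G\<^esub>"
  "x \<oplus>\<^bsub>with_smult G act\<^esub> y = x \<oplus>\<^bsub>G\<^esub> y" "r \<odot>\<^bsub>with_smult G act\<^esub> x = act r x"
  by (simp_all add: with_smult_def)

lemma abelian_group_with_smult:
  assumes "abelian_group G"
  shows "abelian_group (with_smult G act)"
proof -
  interpret G: abelian_group G by fact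
  show ?thesis
    by (rule abelian_groupI) (auto simp: G.a_ac intro: G.l_neg)
qed

lemma minus_eq_zero_iff:
  assumes "abelian_group G" "x \<in> carrier G" "y \<in> carrier G"
  shows "x \<ominus>\<^bsub>G\<^esub> y = \<zero>\<^bsub>G\<^esub> \<longleftrightarrow> x = y"
proof -
  interpret G: abelian_group G by fact
  show ?thesis
    using assms(2,3) by (metis G.a_inv_closed G.minus_equality G.minus_minus G.r_neg a_minus_def)
qed

lemma hom_group_minus:
  assumes M: "left_module R M" and N: "left_module R N" and f: "f \<in> mod_hom R M N"
  shows "\<ominus>\<^bsub>hom_group R M N\<^esub> f = (\<lambda>x\<in>carrier M. \<ominus>\<^bsub>N\<^esub> f x)"
proof -
  interpret H: abelian_group "hom_group R M N"
    by (rule abelian_group_hom_group'[OF M N])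
  interpret N: left_module R N by fact
  have g: "(\<lambda>x\<in>carrier M. \<ominus>\<^bsub>N\<^esub> f x) \<in> carrier (hom_group R M N)"
    using f by (simp add: module_map_restrict[OF M] module_map_uminus[OF N] mod_hom_iff[of f])
  have "(\<lambda>x\<in>carrier M. \<ominus>\<^bsub>N\<^esub> f x) \<oplus>\<^bsub>hom_group R M N\<^esub> f = \<zero>\<^bsub>hom_group R M N\<^esub>"
    unfolding hom_group_simps using f
    by (intro restrict_ext) (auto simp: mod_hom_iff module_map_closed N.M.l_neg)
  then show ?thesis
    using g f by (metis H.minus_equality hom_group_simps(1))
qed

lemma hom_precomp_mod_hom:
  assumes M: "left_module R M" and h: "module_map R M M' h" and f: "f \<in> mod_hom R M' N"
  shows "hom_precomp M h f \<in> mod_hom R M N"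
proof -
  have "module_map R M N (\<lambda>x. f (h x))"
    using h f by (intro module_map_compose[of R M M' h N f]) (auto simp: mod_hom_iff)
  then show ?thesis
    by (simp add: hom_precomp_def compose_def module_map_restrict[OF M])
qed

lemma hom_precomp_apply [simp]: "x \<in> carrier M \<Longrightarrow> hom_precomp M h f x = f (h x)"
  by (simp add: hom_precomp_def compose_def)

lemma hom_precomp_extensional: "hom_precomp M h f \<in> extensional (carrier M)"
  by (simp add: hom_precomp_def compose_def)

lemma additive_map_hom_precomp:
  assumes "left_module R M" "module_map R M M' h"
  shows "additive_map (hom_group R M' N) (hom_group R M N) (hom_precomp M h)"
proof (rule additive_mapI)
  fix f g
  show "hom_precomp M h (f \<oplus>\<^bsub>hom_group R M' N\<^esub> g) =
      hom_precomp M h f \<oplus>\<^bsub>hom_group R M N\<^esub> hom_precomp M h g"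
    using module_map_closed[OF assms(2)]
    by (intro extensionalityI[where A = "carrier M"]) (auto simp: hom_precomp_extensional)
qed (use hom_precomp_mod_hom[OF assms] in simp)

locale cochain_complex =
  fixes R :: "'r ring" and C :: "nat \<Rightarrow> ('r, 'c) module" and d :: "nat \<Rightarrow> 'c \<Rightarrow> 'c"
  assumes module: "left_module R (C n)"
    and map: "module_map R (C n) (C (Suc n)) (d n)"
    and square_zero: "x \<in> carrier (C n) \<Longrightarrow> d (Suc n) (d n x) = \<zero>\<^bsub>C (Suc (Suc n))\<^esub>"
begin

definition cocycles :: "nat \<Rightarrow> 'c set" where
  "cocycles n = {z \<in> carrier (C n). d n z = \<zero>\<^bsub>C (Suc n)\<^esub>}"

lemma group: "abelian_group (C n)"
  by (rule left_module_abelian_group[OF module])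

lemma closed: "x \<in> carrier (C n) \<Longrightarrow> d n x \<in> carrier (C (Suc n))"
  by (rule module_map_closed[OF map])

lemma add: "x \<in> carrier (C n) \<Longrightarrow> y \<in> carrier (C n) \<Longrightarrow> d n (x \<oplus>\<^bsub>C n\<^esub> y) = d n x \<oplus>\<^bsub>C (Suc n)\<^esub> d n y"
  by (rule module_map_add[OF map])

lemma smult_closed: "r \<in> carrier R \<Longrightarrow> x \<in> carrier (C n) \<Longrightarrow> r \<odot>\<^bsub>C n\<^esub> x \<in> carrier (C n)"
  by (rule left_module.smult_closed[OF module])

lemma submodule_image: "submodule (d n ` carrier (C n)) R (C (Suc n))"
  unfolding submodule_iff
  using additive_subgroup_image[OF group group module_map_additive_map[OF map]] module_map_smult[OF map] smult_closed
  by (auto simp: image_iff) metis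

lemma submodule_cocycles: "submodule (cocycles n) R (C n)"
  unfolding submodule_iff cocycles_def
  using additive_subgroup_kernel[OF group group module_map_additive_map[OF map]] module_map_smult[OF map] smult_closed
    left_module.smult_r_null[OF module]
  by auto

lemma submodule_coboundaries: "submodule (coboundaries C d n) R (C n)"
proof (cases n)
  case 0
  interpret M: left_module R "C 0" by (rule module)
  have "submodule {\<zero>\<^bsub>C 0\<^esub>} R (C 0)"
    unfolding submodule_iff
    by (intro conjI additive_subgroupI M.M.abelian_group_axioms) (auto simp: M.smult_r_null)
  then show ?thesis
    by (simp add: coboundaries_def 0)
next
  case (Suc k)
  then show ?thesis
    using submodule_image[of k] by (simp add: coboundaries_def)
qed

lemma coboundaries_subset_cocycles: "coboundaries C d n \<subseteq> cocycles n"
  using module_map_zero[OF module module map, of 0] closed square_zero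
    abelian_monoid.zero_closed[OF abelian_group.axioms(1)[OF group]]
  by (auto simp: coboundaries_def cocycles_def split: nat.split)

text \<open>The cycles of \<open>Hom(C, N)\<close> are the homomorphisms that annihilate the coboundaries of \<open>C\<close>, in
  degree \<open>0\<close> as well.\<close>

definition hom_cycles :: "('r, 'n) module \<Rightarrow> nat \<Rightarrow> ('c \<Rightarrow> 'n) set" where
  "hom_cycles N n = {f \<in> mod_hom R (C n) N. \<forall>b\<in>coboundaries C d n. f b = \<zero>\<^bsub>N\<^esub>}"

definition hom_boundaries :: "('r, 'n) module \<Rightarrow> nat \<Rightarrow> ('c \<Rightarrow> 'n) set" where
  "hom_boundaries N n = hom_precomp (C n) (d n) ` mod_hom R (C (Suc n)) N"

lemma homology_hom:
  assumes N: "left_module R N"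
  shows "homology (\<lambda>n. hom_group R (C n) N) (\<lambda>n. hom_precomp (C n) (d n)) n
    = subquotient (hom_group R (C n) N) (hom_cycles N n) (hom_boundaries N n)"
proof (cases n)
  case 0
  have "f \<zero>\<^bsub>C 0\<^esub> = \<zero>\<^bsub>N\<^esub>" if "f \<in> mod_hom R (C 0) N" for f
    using that module_map_zero[OF module N] by (auto simp: mod_hom_iff)
  then show ?thesis
    by (auto simp: homology_def 0 hom_cycles_def hom_boundaries_def coboundaries_def
        intro!: arg_cong[where f = "\<lambda>Z. subquotient _ Z _"])
next
  case (Suc k)
  have "hom_precomp (C k) (d k) f = (\<lambda>x\<in>carrier (C k). \<zero>\<^bsub>N\<^esub>) \<longleftrightarrow>
      (\<forall>x\<in>carrier (C k). f (d k x) = \<zero>\<^bsub>N\<^esub>)" for f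
    by (auto simp: hom_precomp_def compose_def restrict_def fun_eq_iff)
  then show ?thesis
    by (auto simp: homology_def Suc hom_cycles_def hom_boundaries_def coboundaries_def
        intro!: arg_cong[where f = "\<lambda>Z. subquotient _ Z _"])
qed

lemma additive_subgroup_hom_cycles:
  assumes N: "left_module R N"
  shows "additive_subgroup (hom_cycles N n) (hom_group R (C n) N)"
proof -
  interpret N: left_module R N by fact
  interpret H: abelian_group "hom_group R (C n) N"
    by (rule abelian_group_hom_group'[OF module N])
  have sub: "coboundaries C d n \<subseteq> carrier (C n)"
    using coboundaries_subset_cocycles by (auto simp: cocycles_def)
  show ?thesis
  proof (rule additive_subgroupI[OF H.abelian_group_axioms])
    show "\<zero>\<^bsub>hom_group R (C n) N\<^esub> \<in> hom_cycles N n"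
      using H.zero_closed sub by (auto simp: hom_cycles_def)
    show "\<ominus>\<^bsub>hom_group R (C n) N\<^esub> f \<in> hom_cycles N n" if "f \<in> hom_cycles N n" for f
      using that H.a_inv_closed[of f] sub
      by (auto simp: hom_cycles_def hom_group_minus[OF module N] subset_iff)
    show "f \<oplus>\<^bsub>hom_group R (C n) N\<^esub> g \<in> hom_cycles N n"
      if "f \<in> hom_cycles N n" "g \<in> hom_cycles N n" for f g
      using that H.a_closed[of f g] sub by (auto simp: hom_cycles_def subset_iff)
  qed (auto simp: hom_cycles_def)
qed

lemma additive_subgroup_hom_boundaries:
  assumes N: "left_module R N"
  shows "additive_subgroup (hom_boundaries N n) (hom_group R (C n) N)"
  unfolding hom_boundaries_def hom_group_simps(1)[symmetric]
  by (intro additive_subgroup_image abelian_group_hom_group' additive_map_hom_precomp module map N)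

lemma hom_boundaries_subset_hom_cycles:
  assumes N: "left_module R N"
  shows "hom_boundaries N n \<subseteq> hom_cycles N n"
proof -
  have "f \<zero>\<^bsub>C (Suc n)\<^esub> = \<zero>\<^bsub>N\<^esub>" if "f \<in> mod_hom R (C (Suc n)) N" for f
    using that module_map_zero[OF module N] by (auto simp: mod_hom_iff)
  then show ?thesis
    using coboundaries_subset_cocycles[of n] hom_precomp_mod_hom[OF module map]
    by (auto simp: hom_boundaries_def hom_cycles_def cocycles_def)
qed

lemma hom_boundariesI:
  assumes "f \<in> mod_hom R (C n) N" "k \<in> mod_hom R (C (Suc n)) N"
    "\<And>x. x \<in> carrier (C n) \<Longrightarrow> f x = k (d n x)"
  shows "f \<in> hom_boundaries N n"
proof -
  have "f = hom_precomp (C n) (d n) k"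
    using assms by (intro mod_hom_eqI[of f R "C n" N]) (auto intro: hom_precomp_mod_hom module map)
  then show ?thesis
    using assms(2) by (auto simp: hom_boundaries_def)
qed

lemma cohomology_module_simps:
  "carrier (cohomology_module C d n) = (\<lambda>z. coboundaries C d n +>\<^bsub>C n\<^esub> z) ` cocycles n"
  "\<zero>\<^bsub>cohomology_module C d n\<^esub> = coboundaries C d n"
  "X \<oplus>\<^bsub>cohomology_module C d n\<^esub> Y = X <+>\<^bsub>C n\<^esub> Y"
  "s \<odot>\<^bsub>cohomology_module C d n\<^esub> X = coboundaries C d n <+>\<^bsub>C n\<^esub> ((\<lambda>z. s \<odot>\<^bsub>C n\<^esub> z) ` X)"
  by (simp_all add: cohomology_module_def cohomology_def subquotient_simps cocycles_def)

lemma abelian_group_cohomology_module: "abelian_group (cohomology_module C d n)"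
  unfolding cohomology_module_def cohomology_def cocycles_def[symmetric]
  using submodule_cocycles submodule_coboundaries coboundaries_subset_cocycles group
  by (intro abelian_group_with_smult abelian_group_subquotient) (auto simp: submodule_iff)

lemma cohomology_class_add:
  assumes "x \<in> carrier (C n)" "y \<in> carrier (C n)"
  shows "(coboundaries C d n +>\<^bsub>C n\<^esub> x) \<oplus>\<^bsub>cohomology_module C d n\<^esub> (coboundaries C d n +>\<^bsub>C n\<^esub> y)
    = coboundaries C d n +>\<^bsub>C n\<^esub> (x \<oplus>\<^bsub>C n\<^esub> y)"
proof -
  interpret B: abelian_subgroup "coboundaries C d n" "C n"
    using submodule_coboundaries group by (intro abelian_subgroupI3) (auto simp: submodule_iff)
  show ?thesis
    using assms by (simp add: cohomology_module_simps B.a_rcos_sum)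
qed

text \<open>A scalar maps \<open>B + x\<close> into \<open>B + s x\<close> because \<open>s B \<subseteq> B\<close>; adding \<open>B\<close> again, as in the definition
  of the action, gives the whole coset.\<close>

lemma cohomology_class_smult:
  assumes s: "s \<in> carrier R" and x: "x \<in> carrier (C n)"
  shows "s \<odot>\<^bsub>cohomology_module C d n\<^esub> (coboundaries C d n +>\<^bsub>C n\<^esub> x)
    = coboundaries C d n +>\<^bsub>C n\<^esub> (s \<odot>\<^bsub>C n\<^esub> x)"
proof -
  interpret C: left_module R "C n" by (rule module)
  interpret B: additive_subgroup "coboundaries C d n" "C n"
    using submodule_coboundaries by (auto simp: submodule_iff)
  have sB: "s \<odot>\<^bsub>C n\<^esub> b \<in> coboundaries C d n" if "b \<in> coboundaries C d n" for b
    using that s submodule_coboundaries by (auto simp: submodule_iff)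
  show ?thesis
    unfolding cohomology_module_simps
  proof (intro equalityI subsetI)
    fix y assume "y \<in> coboundaries C d n <+>\<^bsub>C n\<^esub> ((\<lambda>z. s \<odot>\<^bsub>C n\<^esub> z) ` (coboundaries C d n +>\<^bsub>C n\<^esub> x))"
    then obtain b b' where b: "b \<in> coboundaries C d n" "b' \<in> coboundaries C d n"
      "y = b \<oplus>\<^bsub>C n\<^esub> s \<odot>\<^bsub>C n\<^esub> (b' \<oplus>\<^bsub>C n\<^esub> x)"
      by (auto simp: set_add_def' a_r_coset_def')
    then have "y = (b \<oplus>\<^bsub>C n\<^esub> s \<odot>\<^bsub>C n\<^esub> b') \<oplus>\<^bsub>C n\<^esub> s \<odot>\<^bsub>C n\<^esub> x"
      using s x by (simp add: C.smult_r_distr C.M.a_assoc C.smult_closed B.a_Hcarr)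
    then show "y \<in> coboundaries C d n +>\<^bsub>C n\<^esub> (s \<odot>\<^bsub>C n\<^esub> x)"
      using b sB by (auto simp: a_r_coset_def')
  next
    fix y assume "y \<in> coboundaries C d n +>\<^bsub>C n\<^esub> (s \<odot>\<^bsub>C n\<^esub> x)"
    then obtain b where b: "b \<in> coboundaries C d n" "y = b \<oplus>\<^bsub>C n\<^esub> s \<odot>\<^bsub>C n\<^esub> x"
      by (auto simp: a_r_coset_def')
    moreover have "x \<in> coboundaries C d n +>\<^bsub>C n\<^esub> x"
      using x B.zero_closed by (force simp: a_r_coset_def')
    ultimately show "y \<in> coboundaries C d n <+>\<^bsub>C n\<^esub> ((\<lambda>z. s \<odot>\<^bsub>C n\<^esub> z) ` (coboundaries C d n +>\<^bsub>C n\<^esub> x))"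
      by (auto simp: set_add_def')
  qed
qed

lemma cohomology_class_eq_iff:
  assumes "x \<in> carrier (C n)" "y \<in> carrier (C n)"
  shows "coboundaries C d n +>\<^bsub>C n\<^esub> x = coboundaries C d n +>\<^bsub>C n\<^esub> y \<longleftrightarrow>
    (\<exists>b\<in>coboundaries C d n. y = x \<oplus>\<^bsub>C n\<^esub> b)"
  using assms submodule_coboundaries group by (intro coset_eq_iff) (auto simp: submodule_iff)

text \<open>For injective \<open>N\<close> the functor \<open>Hom(-, N)\<close> is exact, so it commutes with taking cohomology.
  A homomorphism that annihilates the coboundaries is sent to the map it induces on the cosets of
  cocycles.  It induces zero exactly if it factors through the differential, because a homomorphism
  on the image of the differential extends to the next module; every homomorphism on cohomology is
  induced, because a homomorphism on the cocycles extends.\<close>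

theorem homology_hom_iso_hom_cohomology:
  fixes N :: "('r, 'n) module"
  assumes inj: "injective_left R N"
  shows "add_monoid (homology (\<lambda>n. hom_group R (C n) N) (\<lambda>n. hom_precomp (C n) (d n)) n)
    \<cong> add_monoid (hom_group R (cohomology_module C d n) N)"
proof -
  have N: "left_module R N"
    using inj by (simp add: injective_left_def)
  interpret C: left_module R "C n" by (rule module)
  interpret N: left_module R N by fact
  define B where "B = coboundaries C d n"
  define Z where "Z = cocycles n"
  define K where "K = cohomology_module C d n"
  interpret B: additive_subgroup B "C n"
    using submodule_coboundaries by (auto simp: submodule_iff B_def)
  interpret Z: additive_subgroup Z "C n"
    using submodule_cocycles by (auto simp: submodule_iff Z_def)
  have BZ: "B \<subseteq> Z"
    unfolding B_def Z_def by (rule coboundaries_subset_cocycles)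
  have sZ: "s \<odot>\<^bsub>C n\<^esub> z \<in> Z" if "s \<in> carrier R" "z \<in> Z" for s z
    using submodule_cocycles that by (auto simp: submodule_iff Z_def)
  have K_carrier: "carrier K = (\<lambda>z. B +>\<^bsub>C n\<^esub> z) ` Z"
    by (simp add: K_def cohomology_module_simps B_def Z_def)
  have K_add: "(B +>\<^bsub>C n\<^esub> x) \<oplus>\<^bsub>K\<^esub> (B +>\<^bsub>C n\<^esub> y) = B +>\<^bsub>C n\<^esub> (x \<oplus>\<^bsub>C n\<^esub> y)" if "x \<in> Z" "y \<in> Z" for x y
    using that unfolding K_def B_def by (intro cohomology_class_add) auto
  have K_smult: "s \<odot>\<^bsub>K\<^esub> (B +>\<^bsub>C n\<^esub> x) = B +>\<^bsub>C n\<^esub> (s \<odot>\<^bsub>C n\<^esub> x)" if "s \<in> carrier R" "x \<in> Z" for s x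
    using that unfolding K_def B_def by (intro cohomology_class_smult) auto
  have K_zero: "\<zero>\<^bsub>K\<^esub> = B"
    by (simp add: K_def cohomology_module_simps B_def)
  have K_group: "abelian_group K"
    unfolding K_def by (rule abelian_group_cohomology_module)
  define F where "F = (\<lambda>f :: 'c \<Rightarrow> 'n. \<lambda>X\<in>carrier K. f (SOME z. z \<in> Z \<and> X = B +>\<^bsub>C n\<^esub> z))"
  have F: "F f (B +>\<^bsub>C n\<^esub> z) = f z" if f: "f \<in> hom_cycles N n" and z: "z \<in> Z" for f z
  proof -
    define w where "w = (SOME w. w \<in> Z \<and> B +>\<^bsub>C n\<^esub> z = B +>\<^bsub>C n\<^esub> w)"
    have w: "w \<in> Z \<and> B +>\<^bsub>C n\<^esub> z = B +>\<^bsub>C n\<^esub> w"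
      unfolding w_def by (rule someI[of _ z]) (use z in auto)
    then obtain b where b: "b \<in> B" "w = z \<oplus>\<^bsub>C n\<^esub> b"
      using cohomology_class_eq_iff[of z n w] z by (auto simp: B_def)
    have "f w = f z \<oplus>\<^bsub>N\<^esub> f b"
      using b z f by (auto simp: hom_cycles_def mod_hom_iff module_map_add)
    moreover have "f z \<in> carrier N"
      using f z by (auto simp: hom_cycles_def mod_hom_iff module_map_closed)
    ultimately have "f w = f z"
      using b f by (simp add: hom_cycles_def B_def)
    then show ?thesis
      using z by (simp add: F_def w_def K_carrier)
  qed
  have F_ext: "F f \<in> extensional (carrier K)" for f
    by (simp add: F_def)
  have F_hom: "F f \<in> mod_hom R K N" if f: "f \<in> hom_cycles N n" for f
  proof -
    have "module_map R (C n) N f"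
      using f by (simp add: hom_cycles_def mod_hom_iff)
    then have "module_map R K N (F f)"
      by (intro module_mapI)
        (auto simp: K_carrier K_add K_smult F[OF f] sZ module_map_closed module_map_add module_map_smult)
    then show ?thesis
      using F_ext by (simp add: mod_hom_iff)
  qed
  have onto: "\<exists>f\<in>hom_cycles N n. F f = g" if g: "g \<in> mod_hom R K N" for g
  proof -
    have gm: "module_map R K N g"
      using g by (simp add: mod_hom_iff)
    have "module_map R (C n\<lparr>carrier := Z\<rparr>) N (\<lambda>z. g (B +>\<^bsub>C n\<^esub> z))"
      using module_map_closed[OF gm] module_map_add[OF gm] module_map_smult[OF gm]
      by (intro module_mapI) (auto simp: K_carrier simp flip: K_add K_smult)
    then obtain h where h: "h \<in> mod_hom R (C n) N" "\<And>z. z \<in> Z \<Longrightarrow> h z = g (B +>\<^bsub>C n\<^esub> z)"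
      using injective_left_extension[OF inj module submodule_cocycles[of n, folded Z_def]] by blast
    have "g B = \<zero>\<^bsub>N\<^esub>"
      using additive_zero[OF K_group N.M.abelian_group_axioms module_map_additive_map[OF gm]]
      by (simp add: K_zero)
    moreover have "B +>\<^bsub>C n\<^esub> b = B" if "b \<in> B" for b
      using that by (subst coset_eq_self_iff[OF group]) (auto intro: B.additive_subgroup_axioms)
    ultimately have hc: "h \<in> hom_cycles N n"
      using h BZ by (auto simp: hom_cycles_def simp flip: B_def)
    moreover have "F h = g"
      using g F_ext F[OF hc] h(2)
      by (intro extensionalityI[where A = "carrier K"]) (auto simp: mod_hom_iff K_carrier)
    ultimately show ?thesis by blast
  qed
  have ker: "(\<forall>z\<in>Z. f z = \<zero>\<^bsub>N\<^esub>) \<longleftrightarrow> f \<in> hom_boundaries N n" if f: "f \<in> hom_cycles N n" for f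
  proof
    assume "f \<in> hom_boundaries N n"
    then obtain k where k: "module_map R (C (Suc n)) N k" "f = hom_precomp (C n) (d n) k"
      by (auto simp: hom_boundaries_def mod_hom_iff)
    show "\<forall>z\<in>Z. f z = \<zero>\<^bsub>N\<^esub>"
    proof
      fix z assume "z \<in> Z"
      then have "z \<in> carrier (C n)" "d n z = \<zero>\<^bsub>C (Suc n)\<^esub>"
        unfolding Z_def cocycles_def by blast+
      then have "f z = k \<zero>\<^bsub>C (Suc n)\<^esub>"
        unfolding k(2) by simp
      also have "\<dots> = \<zero>\<^bsub>N\<^esub>"
        by (rule module_map_zero[OF module N k(1)])
      finally show "f z = \<zero>\<^bsub>N\<^esub>" .
    qed
  next
    assume zero: "\<forall>z\<in>Z. f z = \<zero>\<^bsub>N\<^esub>"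
    have fm: "module_map R (C n) N f"
      using f by (simp add: hom_cycles_def mod_hom_iff)
    \<comment> \<open>\<open>f\<close> vanishes on the kernel of \<open>d n\<close>, so it descends to the image of \<open>d n\<close> and extends from there.\<close>
    define A where "A = d n ` carrier (C n)"
    define \<phi> where "\<phi> = (\<lambda>y. f (SOME x. x \<in> carrier (C n) \<and> d n x = y))"
    have \<phi>: "\<phi> (d n x) = f x" if x: "x \<in> carrier (C n)" for x
    proof -
      define w where "w = (SOME w. w \<in> carrier (C n) \<and> d n w = d n x)"
      have w: "w \<in> carrier (C n) \<and> d n w = d n x"
        unfolding w_def by (rule someI[of _ x]) (use x in auto)
      interpret C': left_module R "C (Suc n)" by (rule module)
      have "w \<ominus>\<^bsub>C n\<^esub> x \<in> Z"
        using w x closed[OF x] module_map_diff[OF module module map, of w n x]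
        unfolding Z_def cocycles_def by (simp add: minus_eq_zero_iff C'.M.abelian_group_axioms)
      then have "f w \<ominus>\<^bsub>N\<^esub> f x = \<zero>\<^bsub>N\<^esub>"
        using zero w x module_map_diff[OF module N fm, of w x] by simp
      then have "f w = f x"
        using w x module_map_closed[OF fm] by (simp add: minus_eq_zero_iff N.M.abelian_group_axioms)
      then show ?thesis
        by (simp add: \<phi>_def w_def)
    qed
    have "module_map R (C (Suc n)\<lparr>carrier := A\<rparr>) N \<phi>"
      using module_map_closed[OF fm] module_map_add[OF fm] module_map_smult[OF fm] \<phi>
      by (intro module_mapI)
        (auto simp: A_def smult_closed simp flip: add module_map_smult[OF map])
    then obtain h where h: "h \<in> mod_hom R (C (Suc n)) N" "\<And>y. y \<in> A \<Longrightarrow> h y = \<phi> y"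
      using injective_left_extension[OF inj module submodule_image[of n, folded A_def]] by blast
    show "f \<in> hom_boundaries N n"
      using f h by (intro hom_boundariesI[of _ _ _ h]) (auto simp: hom_cycles_def A_def \<phi>)
  qed
  have F_zero: "F f = (\<lambda>X\<in>carrier K. \<zero>\<^bsub>N\<^esub>) \<longleftrightarrow> (\<forall>z\<in>Z. f z = \<zero>\<^bsub>N\<^esub>)" if f: "f \<in> hom_cycles N n" for f
  proof
    assume "F f = (\<lambda>X\<in>carrier K. \<zero>\<^bsub>N\<^esub>)"
    then show "\<forall>z\<in>Z. f z = \<zero>\<^bsub>N\<^esub>"
      by (auto simp: K_carrier simp flip: F[OF f])
  next
    assume "\<forall>z\<in>Z. f z = \<zero>\<^bsub>N\<^esub>"
    then show "F f = (\<lambda>X\<in>carrier K. \<zero>\<^bsub>N\<^esub>)"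
      using F_ext by (intro extensionalityI[where A = "carrier K"]) (auto simp: K_carrier F[OF f])
  qed
  show ?thesis
    unfolding homology_hom[OF N] K_def[symmetric]
  proof (rule subquotient_iso_onto[where F = F])
    show "abelian_group (hom_group R (C n) N)"
      by (rule abelian_group_hom_group'[OF module N])
    have "abelian_group (hom_group R K N)"
      by (rule abelian_group_hom_group[OF K_group _ N]) (auto simp: K_carrier K_smult sZ)
    then show "group (add_monoid (hom_group R K N))"
      by (rule abelian_group.a_group)
    show "F ` hom_cycles N n = carrier (add_monoid (hom_group R K N))"
      using F_hom onto by force
    show "F (f \<oplus>\<^bsub>hom_group R (C n) N\<^esub> g) = F f \<otimes>\<^bsub>add_monoid (hom_group R K N)\<^esub> F g"
      if "f \<in> hom_cycles N n" "g \<in> hom_cycles N n" for f g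
    proof -
      have fg: "f \<oplus>\<^bsub>hom_group R (C n) N\<^esub> g \<in> hom_cycles N n"
        by (rule additive_subgroup.a_closed[OF additive_subgroup_hom_cycles[OF N] that])
      show ?thesis
        using F[OF fg] F[OF that(1)] F[OF that(2)] F_ext
        by (intro extensionalityI[where A = "carrier K"]) (auto simp: K_carrier)
    qed
  qed (use N ker F_zero in \<open>auto intro: additive_subgroup_hom_cycles additive_subgroup_hom_boundaries
      hom_boundaries_subset_hom_cycles[THEN subsetD]\<close>)
qed

end

section \<open>Comparison of relative resolutions\<close>

definition chain_map ::
  "'r ring \<Rightarrow> (nat \<Rightarrow> ('r, 'c) module) \<Rightarrow> (nat \<Rightarrow> 'c \<Rightarrow> 'c) \<Rightarrow>
   (nat \<Rightarrow> ('r, 'd) module) \<Rightarrow> (nat \<Rightarrow> 'd \<Rightarrow> 'd) \<Rightarrow> (nat \<Rightarrow> 'c \<Rightarrow> 'd) \<Rightarrow> bool" where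
  "chain_map R W d W' d' f \<longleftrightarrow> (\<forall>n. module_map R (W n) (W' n) (f n)) \<and>
     (\<forall>n. \<forall>x\<in>carrier (W n). f (Suc n) (d n x) = d' n (f n x))"

lemma chain_map_compose:
  assumes "chain_map R W d W' d' f" "chain_map R W' d' W'' d'' g"
  shows "chain_map R W d W'' d'' (\<lambda>n x. g n (f n x))"
proof -
  have "module_map R (W n) (W'' n) (\<lambda>x. g n (f n x))" for n
    using assms by (intro module_map_compose[of R "W n" "W' n" "f n" "W'' n" "g n"])
      (auto simp: chain_map_def)
  moreover have "f n x \<in> carrier (W' n)" if "x \<in> carrier (W n)" for n x
    using assms(1) that module_map_closed[of R "W n" "W' n" "f n" x] by (simp add: chain_map_def)
  ultimately show ?thesis
    using assms by (simp add: chain_map_def)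
qed

text \<open>The defining exactness of a relative resolution \<open>L \<rightarrow> W 0 \<rightarrow> W 1 \<rightarrow> \<dots>\<close>, tested on a single
  module \<open>Y\<close> and read as an extension property: a map from \<open>L\<close>, or a map from \<open>W n\<close> that vanishes on
  the image of the preceding term, factors through the next term.\<close>

definition incoming_image ::
  "('r, 'l) module \<Rightarrow> ('l \<Rightarrow> 'u) \<Rightarrow> (nat \<Rightarrow> ('r, 'u) module) \<Rightarrow> (nat \<Rightarrow> 'u \<Rightarrow> 'u) \<Rightarrow> nat \<Rightarrow> 'u set" where
  "incoming_image L e W d n = (case n of 0 \<Rightarrow> e ` carrier L | Suc k \<Rightarrow> d k ` carrier (W k))"

definition exact_against ::
  "'r ring \<Rightarrow> ('r, 'l) module \<Rightarrow> ('l \<Rightarrow> 'u) \<Rightarrow> (nat \<Rightarrow> ('r, 'u) module) \<Rightarrow> (nat \<Rightarrow> 'u \<Rightarrow> 'u) \<Rightarrow>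
   ('r, 'y) module \<Rightarrow> bool" where
  "exact_against R L e W d Y \<longleftrightarrow>
     (\<forall>g. module_map R L Y g \<longrightarrow>
        (\<exists>h. module_map R (W 0) Y h \<and> (\<forall>x\<in>carrier L. h (e x) = g x))) \<and>
     (\<forall>n h. module_map R (W n) Y h \<longrightarrow> (\<forall>x\<in>incoming_image L e W d n. h x = \<zero>\<^bsub>Y\<^esub>) \<longrightarrow>
        (\<exists>k. module_map R (W (Suc n)) Y k \<and> (\<forall>x\<in>carrier (W n). k (d n x) = h x)))"

lemma exact_at_hom_precompD:
  assumes ex: "exact_at (hom_group R W2 Y) (hom_precomp W1 d) (hom_group R W1 Y) (hom_precomp W0 c)
      (hom_group R W0 Y)"
    and W1: "left_module R W1" and h: "module_map R W1 Y h"
    and c: "\<And>x. x \<in> carrier W0 \<Longrightarrow> c x \<in> carrier W1"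
    and zero: "\<And>x. x \<in> carrier W0 \<Longrightarrow> h (c x) = \<zero>\<^bsub>Y\<^esub>"
  obtains k where "module_map R W2 Y k" "\<And>x. x \<in> carrier W1 \<Longrightarrow> k (d x) = h x"
proof -
  have "restrict h (carrier W1) \<in> mod_hom R W1 Y"
    using h by (simp add: module_map_restrict[OF W1])
  moreover have "hom_precomp W0 c (restrict h (carrier W1)) = (\<lambda>x\<in>carrier W0. \<zero>\<^bsub>Y\<^esub>)"
    using zero c by (intro extensionalityI[where A = "carrier W0"]) (auto simp: hom_precomp_extensional)
  ultimately have "restrict h (carrier W1) \<in> hom_precomp W1 d ` mod_hom R W2 Y"
    using ex by (simp add: exact_at_def)
  then obtain k where "k \<in> mod_hom R W2 Y" "restrict h (carrier W1) = hom_precomp W1 d k"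
    by blast
  moreover from this have "k (d x) = h x" if "x \<in> carrier W1" for x
    using that by (metis hom_precomp_apply restrict_apply')
  ultimately show thesis
    using that by (auto simp: mod_hom_iff)
qed

lemma right_resolution_cochain_complex:
  assumes "right_resolution R \<C> \<T> L e W d" and "\<And>A. \<C> A \<Longrightarrow> left_module R A"
  shows "cochain_complex R W d"
  using assms by (auto simp: cochain_complex_def right_resolution_def mod_hom_iff)

lemma right_resolution_exact_against:
  assumes res: "right_resolution R \<C> \<T> L e W d" and "\<T> Y"
    and L: "left_module R L" and W: "\<And>n. left_module R (W n)"
  shows "exact_against R L e W d Y"
  unfolding exact_against_def
proof (intro conjI allI impI)
  have e: "module_map R L (W 0) e" and d: "\<And>n. module_map R (W n) (W (Suc n)) (d n)"
    using res by (auto simp: right_resolution_def mod_hom_iff)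
  {
    fix g assume g: "module_map R L Y g"
    have "restrict g (carrier L) \<in> hom_precomp L e ` mod_hom R (W 0) Y"
      using res \<open>\<T> Y\<close> g by (simp add: right_resolution_def module_map_restrict[OF L])
    then obtain h where h: "h \<in> mod_hom R (W 0) Y" "restrict g (carrier L) = hom_precomp L e h"
      by blast
    moreover from h(2) have "h (e x) = g x" if "x \<in> carrier L" for x
      using that by (metis hom_precomp_apply restrict_apply')
    ultimately show "\<exists>h. module_map R (W 0) Y h \<and> (\<forall>x\<in>carrier L. h (e x) = g x)"
      by (auto simp: mod_hom_iff)
  }
  fix n h
  assume h: "module_map R (W n) Y h" and zero: "\<forall>x\<in>incoming_image L e W d n. h x = \<zero>\<^bsub>Y\<^esub>"
  show "\<exists>k. module_map R (W (Suc n)) Y k \<and> (\<forall>x\<in>carrier (W n). k (d n x) = h x)"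
  proof (cases n)
    case 0
    have "exact_at (hom_group R (W 1) Y) (hom_precomp (W 0) (d 0)) (hom_group R (W 0) Y)
        (hom_precomp L e) (hom_group R L Y)"
      using res \<open>\<T> Y\<close> by (simp add: right_resolution_def)
    then show ?thesis
      using h zero module_map_closed[OF e] unfolding 0
      by (elim exact_at_hom_precompD[OF _ W, where h = h]) (auto simp: incoming_image_def)
  next
    case (Suc k)
    have "exact_at (hom_group R (W (Suc (Suc k))) Y) (hom_precomp (W (Suc k)) (d (Suc k)))
        (hom_group R (W (Suc k)) Y) (hom_precomp (W k) (d k)) (hom_group R (W k) Y)"
      using res \<open>\<T> Y\<close> by (simp add: right_resolution_def)
    then show ?thesis
      using h zero module_map_closed[OF d] unfolding Suc
      by (elim exact_at_hom_precompD[OF _ W, where h = h]) (auto simp: incoming_image_def)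
  qed
qed

text \<open>Maps into a retract \<open>Y\<close> of \<open>X\<close> are extended after composing with the inclusion and then
  projected back.\<close>

lemma exact_against_retract:
  assumes ex: "exact_against R L e W d X" and X: "left_module R X" and Y: "left_module R Y"
    and i: "module_map R Y X i" and p: "module_map R X Y p"
    and pi: "\<And>y. y \<in> carrier Y \<Longrightarrow> p (i y) = y"
    and e: "\<And>x. x \<in> carrier L \<Longrightarrow> e x \<in> carrier (W 0)"
    and d: "\<And>n x. x \<in> carrier (W n) \<Longrightarrow> d n x \<in> carrier (W (Suc n))"
  shows "exact_against R L e W d Y"
  unfolding exact_against_def
proof (intro conjI allI impI)
  fix g assume g: "module_map R L Y g"
  obtain h where "module_map R (W 0) X h" "\<forall>x\<in>carrier L. h (e x) = i (g x)"
    using ex module_map_compose[OF g i] unfolding exact_against_def by blast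
  then show "\<exists>h. module_map R (W 0) Y h \<and> (\<forall>x\<in>carrier L. h (e x) = g x)"
    using module_map_compose[OF _ p] pi module_map_closed[OF g]
    by (intro exI[of _ "\<lambda>x. p (h x)"]) auto
next
  fix n h
  assume h: "module_map R (W n) Y h" and zero: "\<forall>x\<in>incoming_image L e W d n. h x = \<zero>\<^bsub>Y\<^esub>"
  have "\<forall>x\<in>incoming_image L e W d n. i (h x) = \<zero>\<^bsub>X\<^esub>"
    using zero module_map_zero[OF Y X i] by simp
  then obtain k where "module_map R (W (Suc n)) X k" "\<forall>x\<in>carrier (W n). k (d n x) = i (h x)"
    using ex module_map_compose[OF h i] unfolding exact_against_def by blast
  then show "\<exists>k. module_map R (W (Suc n)) Y k \<and> (\<forall>x\<in>carrier (W n). k (d n x) = h x)"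
    using module_map_compose[OF _ p] pi module_map_closed[OF h]
    by (intro exI[of _ "\<lambda>x. p (k x)"]) auto
qed

text \<open>The comparison theorem: maps from \<open>L\<close> lift to chain maps, and a chain map that vanishes on
  \<open>L\<close> is null-homotopic.  Both are built degree by degree from the extension property.\<close>

lemma comparison_chain_map:
  fixes W :: "nat \<Rightarrow> ('r, 'u) module" and V :: "nat \<Rightarrow> ('r, 'v) module"
  assumes V: "cochain_complex R V dV" and e': "module_map R L (V 0) e'"
    and zero: "\<And>x. x \<in> carrier L \<Longrightarrow> dV 0 (e' x) = \<zero>\<^bsub>V 1\<^esub>"
    and ex: "\<And>n. exact_against R L e W d (V n)"
  obtains f where "chain_map R W d V dV f" "\<And>x. x \<in> carrier L \<Longrightarrow> f 0 (e x) = e' x"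
proof -
  interpret V: cochain_complex R V dV by fact
  \<comment> \<open>The second conjunct of \<open>P\<close> is what allows \<open>dV n \<circ> f\<close> to factor through \<open>d n\<close>.\<close>
  define P where "P n f \<longleftrightarrow> module_map R (W n) (V n) f \<and>
    (\<forall>x\<in>incoming_image L e W d n. dV n (f x) = \<zero>\<^bsub>V (Suc n)\<^esub>) \<and>
    (n = 0 \<longrightarrow> (\<forall>x\<in>carrier L. f (e x) = e' x))" for n f
  define Q where "Q n f f' \<longleftrightarrow> (\<forall>x\<in>carrier (W n). f' (d n x) = dV n (f x))"
    for n and f f' :: "'u \<Rightarrow> 'v"
  have "\<exists>f. \<forall>n. P n (f n) \<and> Q n (f n) (f (Suc n))"
  proof (rule dependent_nat_choice)
    obtain h where "module_map R (W 0) (V 0) h" "\<forall>x\<in>carrier L. h (e x) = e' x"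
      using ex[of 0] e' unfolding exact_against_def by blast
    then show "\<exists>f. P 0 f"
      using zero by (auto simp: P_def incoming_image_def)
  next
    fix f n assume P: "P n f"
    then have f: "module_map R (W n) (V n) f" by (simp add: P_def)
    obtain k where "module_map R (W (Suc n)) (V (Suc n)) k" "\<forall>x\<in>carrier (W n). k (d n x) = dV n (f x)"
      using ex[of "Suc n"] module_map_compose[OF f V.map] P
      unfolding exact_against_def P_def by blast
    then show "\<exists>f'. P (Suc n) f' \<and> Q n f f'"
      using V.square_zero module_map_closed[OF f] by (auto simp: P_def Q_def incoming_image_def)
  qed
  then obtain f where "\<And>n. P n (f n)" "\<And>n. Q n (f n) (f (Suc n))" by blast
  then show thesis
    by (intro that[of f]) (auto simp: P_def Q_def chain_map_def)
qed

lemma null_homotopy: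
  fixes W :: "nat \<Rightarrow> ('r, 'u) module" and V :: "nat \<Rightarrow> ('r, 'v) module"
  assumes W: "cochain_complex R W d" and V: "cochain_complex R V dV"
    and \<phi>: "chain_map R W d V dV \<phi>" and zero: "\<And>x. x \<in> carrier L \<Longrightarrow> \<phi> 0 (e x) = \<zero>\<^bsub>V 0\<^esub>"
    and ex: "\<And>n. exact_against R L e W d (V n)"
  obtains s where "\<And>n. module_map R (W (Suc n)) (V n) (s n)"
    "\<And>x. x \<in> carrier (W 0) \<Longrightarrow> \<phi> 0 x = s 0 (d 0 x)"
    "\<And>n x. x \<in> carrier (W (Suc n)) \<Longrightarrow> \<phi> (Suc n) x = s (Suc n) (d (Suc n) x) \<oplus>\<^bsub>V (Suc n)\<^esub> dV n (s n x)"
proof -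
  interpret W: cochain_complex R W d by fact
  interpret V: cochain_complex R V dV by fact
  have \<phi>m: "module_map R (W n) (V n) (\<phi> n)" for n
    using \<phi> by (simp add: chain_map_def)
  have \<phi>d: "\<phi> (Suc n) (d n x) = dV n (\<phi> n x)" if "x \<in> carrier (W n)" for n x
    using \<phi> that by (simp add: chain_map_def)
  \<comment> \<open>\<open>s n\<close> lowers the degree, from \<open>W (n + 1)\<close> to \<open>V n\<close>.  The second conjunct of \<open>P\<close> says that
      \<open>\<phi> (n + 1) - dV n \<circ> s\<close> vanishes on the image of \<open>d n\<close>, so that it factors through \<open>d (n + 1)\<close>.\<close>
  define P where "P n s \<longleftrightarrow> module_map R (W (Suc n)) (V n) s \<and>
    (\<forall>x\<in>carrier (W n). dV n (s (d n x)) = \<phi> (Suc n) (d n x)) \<and>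
    (n = 0 \<longrightarrow> (\<forall>x\<in>carrier (W 0). \<phi> 0 x = s (d 0 x)))" for n s
  define Q where "Q n s s' \<longleftrightarrow> (\<forall>x\<in>carrier (W (Suc n)).
    \<phi> (Suc n) x = s' (d (Suc n) x) \<oplus>\<^bsub>V (Suc n)\<^esub> dV n (s x))" for n and s s' :: "'u \<Rightarrow> 'v"
  have "\<exists>s. \<forall>n. P n (s n) \<and> Q n (s n) (s (Suc n))"
  proof (rule dependent_nat_choice)
    obtain s where "module_map R (W (Suc 0)) (V 0) s" "\<forall>x\<in>carrier (W 0). s (d 0 x) = \<phi> 0 x"
      using ex[of 0] \<phi>m[of 0] zero unfolding exact_against_def
      by (force simp: incoming_image_def)
    then show "\<exists>s. P 0 s"
      using \<phi>d[of _ 0] by (auto simp: P_def)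
  next
    fix s n assume P: "P n s"
    then have s: "module_map R (W (Suc n)) (V n) s" by (simp add: P_def)
    interpret Vn: abelian_group "V (Suc n)" by (rule V.group)
    have ds: "module_map R (W (Suc n)) (V (Suc n)) (\<lambda>x. dV n (s x))"
      by (rule module_map_compose[OF s V.map])
    define h where "h x = \<phi> (Suc n) x \<ominus>\<^bsub>V (Suc n)\<^esub> dV n (s x)" for x
    have h: "module_map R (W (Suc n)) (V (Suc n)) h"
      unfolding h_def by (intro module_map_minus_map V.module \<phi>m ds W.group)
    have "h x = \<zero>\<^bsub>V (Suc n)\<^esub>" if x: "x \<in> incoming_image L e W d (Suc n)" for x
    proof -
      obtain y where "y \<in> carrier (W n)" "x = d n y"
        using x by (auto simp: incoming_image_def)
      then show ?thesis
        using P module_map_closed[OF \<phi>m] W.closed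
        by (simp add: h_def P_def minus_eq_zero_iff V.group)
    qed
    then obtain s' where s': "module_map R (W (Suc (Suc n))) (V (Suc n)) s'"
      "\<forall>x\<in>carrier (W (Suc n)). s' (d (Suc n) x) = h x"
      using ex[of "Suc n"] h unfolding exact_against_def by blast
    have "Q n s s'"
      using s'(2) module_map_closed[OF \<phi>m] module_map_closed[OF ds]
      by (simp add: Q_def h_def a_minus_def Vn.a_assoc Vn.l_neg)
    moreover have "dV (Suc n) (s' (d (Suc n) x)) = \<phi> (Suc (Suc n)) (d (Suc n) x)"
      if x: "x \<in> carrier (W (Suc n))" for x
    proof -
      interpret Vn': abelian_group "V (Suc (Suc n))" by (rule V.group)
      have "dV (Suc n) (s' (d (Suc n) x)) =
          dV (Suc n) (\<phi> (Suc n) x) \<ominus>\<^bsub>V (Suc (Suc n))\<^esub> dV (Suc n) (dV n (s x))"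
        using s'(2) x module_map_closed[OF \<phi>m] module_map_closed[OF ds]
        by (simp add: h_def module_map_diff[OF V.module V.module V.map])
      then show ?thesis
        using x V.square_zero module_map_closed[OF s] module_map_closed[OF \<phi>m] V.closed
        by (simp add: \<phi>d a_minus_def)
    qed
    ultimately show "\<exists>s'. P (Suc n) s' \<and> Q n s s'"
      using s'(1) by (auto simp: P_def)
  qed
  then obtain s where "\<And>n. P n (s n)" "\<And>n. Q n (s n) (s (Suc n))" by blast
  then show thesis
    by (intro that[of s]) (auto simp: P_def Q_def)
qed

text \<open>The homotopy has no term of negative degree, whence the separate equation in degree \<open>0\<close>.\<close>

definition homotopic_to_identity ::
  "'r ring \<Rightarrow> (nat \<Rightarrow> ('r, 'c) module) \<Rightarrow> (nat \<Rightarrow> 'c \<Rightarrow> 'c) \<Rightarrow> (nat \<Rightarrow> 'c \<Rightarrow> 'c) \<Rightarrow> bool" where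
  "homotopic_to_identity R W d h \<longleftrightarrow> (\<exists>s. (\<forall>n. module_map R (W (Suc n)) (W n) (s n)) \<and>
     (\<forall>x\<in>carrier (W 0). h 0 x = x \<oplus>\<^bsub>W 0\<^esub> s 0 (d 0 x)) \<and>
     (\<forall>n. \<forall>x\<in>carrier (W (Suc n)).
        h (Suc n) x = x \<oplus>\<^bsub>W (Suc n)\<^esub> (s (Suc n) (d (Suc n) x) \<oplus>\<^bsub>W (Suc n)\<^esub> d n (s n x))))"

text \<open>\<open>h - id\<close> vanishes on \<open>L\<close>, hence is null-homotopic.\<close>

lemma chain_map_homotopic_to_identity:
  assumes W: "cochain_complex R W d" and h: "chain_map R W d W d h"
    and e: "\<And>x. x \<in> carrier L \<Longrightarrow> e x \<in> carrier (W 0)"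
    and he: "\<And>x. x \<in> carrier L \<Longrightarrow> h 0 (e x) = e x"
    and ex: "\<And>n. exact_against R L e W d (W n)"
  shows "homotopic_to_identity R W d h"
proof -
  interpret W: cochain_complex R W d by fact
  have hm: "module_map R (W n) (W n) (h n)" and hd: "x \<in> carrier (W n) \<Longrightarrow> h (Suc n) (d n x) = d n (h n x)"
    for n x
    using h by (simp_all add: chain_map_def)
  define \<phi> where "\<phi> n x = h n x \<ominus>\<^bsub>W n\<^esub> x" for n x
  have \<phi>: "chain_map R W d W d \<phi>"
    unfolding chain_map_def \<phi>_def
    using hd W.closed module_map_closed[OF hm]
    by (auto intro!: module_map_minus_map hm module_map_ident W.module W.group
        simp: module_map_diff[OF W.module W.module W.map])
  have hx: "h n x = x \<oplus>\<^bsub>W n\<^esub> \<phi> n x" if "x \<in> carrier (W n)" for n x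
  proof -
    interpret Wn: abelian_group "W n" by (rule W.group)
    show ?thesis
      using that module_map_closed[OF hm that]
      by (simp add: \<phi>_def a_minus_def Wn.a_lcomm[of x] Wn.r_neg)
  qed
  have "\<phi> 0 (e x) = \<zero>\<^bsub>W 0\<^esub>" if "x \<in> carrier L" for x
    using that e he by (simp add: \<phi>_def minus_eq_zero_iff W.group)
  then obtain s where "\<And>n. module_map R (W (Suc n)) (W n) (s n)"
    "\<And>x. x \<in> carrier (W 0) \<Longrightarrow> \<phi> 0 x = s 0 (d 0 x)"
    "\<And>n x. x \<in> carrier (W (Suc n)) \<Longrightarrow> \<phi> (Suc n) x = s (Suc n) (d (Suc n) x) \<oplus>\<^bsub>W (Suc n)\<^esub> d n (s n x)"
    using null_homotopy[OF W W \<phi> _ ex] by blast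
  then show ?thesis
    unfolding homotopic_to_identity_def by (intro exI[of _ s]) (auto simp: hx)
qed

text \<open>Homotopic maps differ on a cycle of \<open>Hom(C, N)\<close> by a boundary, because a cycle annihilates
  the part of the homotopy that lies in the image of the differential.\<close>

lemma (in cochain_complex) hom_cycle_homotopic:
  assumes N: "left_module R N" and h: "homotopic_to_identity R C d h" and z: "z \<in> hom_cycles N n"
  shows "\<exists>b\<in>hom_boundaries N n. \<forall>x\<in>carrier (C n). z (h n x) = z x \<oplus>\<^bsub>N\<^esub> b x"
proof -
  obtain s where s: "\<And>n. module_map R (C (Suc n)) (C n) (s n)"
    and h0: "\<And>x. x \<in> carrier (C 0) \<Longrightarrow> h 0 x = x \<oplus>\<^bsub>C 0\<^esub> s 0 (d 0 x)"
    and hS: "\<And>n x. x \<in> carrier (C (Suc n)) \<Longrightarrow>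
      h (Suc n) x = x \<oplus>\<^bsub>C (Suc n)\<^esub> (s (Suc n) (d (Suc n) x) \<oplus>\<^bsub>C (Suc n)\<^esub> d n (s n x))"
    using h unfolding homotopic_to_identity_def by blast
  interpret N: left_module R N by fact
  have zm: "module_map R (C n) N z"
    using z by (simp add: hom_cycles_def mod_hom_iff)
  define k where "k = restrict (\<lambda>y. z (s n y)) (carrier (C (Suc n)))"
  have k: "k \<in> mod_hom R (C (Suc n)) N"
    unfolding k_def using module_map_compose[OF s zm] by (simp add: module_map_restrict[OF module])
  have "z (h n x) = z x \<oplus>\<^bsub>N\<^esub> k (d n x)" if x: "x \<in> carrier (C n)" for x
  proof (cases n)
    case 0
    then show ?thesis
      using x zm module_map_closed[OF s, of "d 0 x" 0] closed[of x 0]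
      by (simp add: h0 module_map_add k_def)
  next
    case (Suc m)
    interpret Cn: abelian_group "C (Suc m)" by (rule group)
    have sx: "s m x \<in> carrier (C m)" "s (Suc m) (d (Suc m) x) \<in> carrier (C (Suc m))"
      "d m (s m x) \<in> carrier (C (Suc m))"
      using x Suc by (auto intro!: module_map_closed[OF s] closed)
    have "z (d m (s m x)) = \<zero>\<^bsub>N\<^esub>"
      using z sx(1) by (auto simp: hom_cycles_def coboundaries_def Suc)
    then show ?thesis
      using x zm sx closed[of x "Suc m"] module_map_closed[OF zm]
      by (simp add: hS module_map_add k_def Suc)
  qed
  then show ?thesis
    using k hom_precomp_mod_hom[OF module map k] by (intro bexI[of _ "hom_precomp (C n) (d n) k"])
      (auto simp: hom_boundaries_def)
qed

lemma chain_map_hom_cycles: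
  assumes C: "cochain_complex R C d" and D: "cochain_complex R D d'" and N: "left_module R N"
    and g: "chain_map R D d' C d g" and f: "f \<in> cochain_complex.hom_cycles R C d N n"
  shows "hom_precomp (D n) (g n) f \<in> cochain_complex.hom_cycles R D d' N n"
proof -
  interpret C: cochain_complex R C d by fact
  interpret D: cochain_complex R D d' by fact
  have gm: "module_map R (D n) (C n) (g n)" for n
    using g by (simp add: chain_map_def)
  have "g n b \<in> coboundaries C d n" if "b \<in> coboundaries D d' n" for b
    using that g module_map_zero[OF D.module C.module gm] module_map_closed[OF gm]
    by (auto simp: coboundaries_def chain_map_def split: nat.splits)
  moreover have "coboundaries D d' n \<subseteq> carrier (D n)"
    using D.coboundaries_subset_cocycles by (auto simp: D.cocycles_def)
  ultimately show ?thesis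
    using f hom_precomp_mod_hom[OF D.module gm]
    by (auto simp: C.hom_cycles_def D.hom_cycles_def subset_iff)
qed

lemma chain_map_hom_boundaries:
  assumes C: "cochain_complex R C d" and D: "cochain_complex R D d'" and N: "left_module R N"
    and g: "chain_map R D d' C d g" and f: "f \<in> cochain_complex.hom_boundaries R C d N n"
  shows "hom_precomp (D n) (g n) f \<in> cochain_complex.hom_boundaries R D d' N n"
proof -
  interpret C: cochain_complex R C d by fact
  interpret D: cochain_complex R D d' by fact
  have gm: "module_map R (D n) (C n) (g n)" for n
    using g by (simp add: chain_map_def)
  obtain k where k: "k \<in> mod_hom R (C (Suc n)) N" "f = hom_precomp (C n) (d n) k"
    using f by (auto simp: C.hom_boundaries_def)
  show ?thesis
  proof (rule D.hom_boundariesI)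
    show "hom_precomp (D n) (g n) f \<in> mod_hom R (D n) N"
      unfolding k(2) by (intro hom_precomp_mod_hom[OF D.module gm] hom_precomp_mod_hom[OF C.module C.map] k)
    show "hom_precomp (D (Suc n)) (g (Suc n)) k \<in> mod_hom R (D (Suc n)) N"
      by (intro hom_precomp_mod_hom[OF D.module gm] k)
    show "hom_precomp (D n) (g n) f x = hom_precomp (D (Suc n)) (g (Suc n)) k (d' n x)"
      if "x \<in> carrier (D n)" for x
      using that g D.closed module_map_closed[OF gm] by (simp add: k(2) chain_map_def)
  qed
qed

lemma hom_precomp_homotopic_to_identity:
  assumes W: "cochain_complex R W d" and X: "left_module R X"
    and f: "\<And>x. x \<in> carrier (W n) \<Longrightarrow> f n x \<in> carrier (W' n)"
    and gf: "homotopic_to_identity R W d (\<lambda>n x. g n (f n x))"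
    and z: "z \<in> cochain_complex.hom_cycles R W d X n"
  shows "\<exists>b\<in>cochain_complex.hom_boundaries R W d X n.
    hom_precomp (W n) (f n) (hom_precomp (W' n) (g n) z) = z \<oplus>\<^bsub>hom_group R (W n) X\<^esub> b"
proof -
  interpret W: cochain_complex R W d by fact
  obtain b where b: "b \<in> W.hom_boundaries X n" "\<forall>x\<in>carrier (W n). z (g n (f n x)) = z x \<oplus>\<^bsub>X\<^esub> b x"
    using W.hom_cycle_homotopic[OF X gf z] by blast
  have "hom_precomp (W n) (f n) (hom_precomp (W' n) (g n) z) = z \<oplus>\<^bsub>hom_group R (W n) X\<^esub> b"
    using b(2) f
    by (intro extensionalityI[where A = "carrier (W n)"]) (auto simp: hom_precomp_extensional)
  then show ?thesis using b(1) by blast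
qed

lemma rel_Ext_homotopy_equivalence:
  assumes W: "cochain_complex R W d" and W': "cochain_complex R W' d'" and X: "left_module R X"
    and f: "chain_map R W d W' d' f" and g: "chain_map R W' d' W d g"
    and gf: "homotopic_to_identity R W d (\<lambda>n x. g n (f n x))"
    and fg: "homotopic_to_identity R W' d' (\<lambda>n x. f n (g n x))"
  shows "add_monoid (rel_Ext R W d X n) \<cong> add_monoid (rel_Ext R W' d' X n)"
proof -
  interpret W: cochain_complex R W d by fact
  interpret W': cochain_complex R W' d' by fact
  have fm: "module_map R (W n) (W' n) (f n)" and gm: "module_map R (W' n) (W n) (g n)" for n
    using f g by (auto simp: chain_map_def)
  have add: "hom_precomp (W' n) (g n) (z \<oplus>\<^bsub>hom_group R (W n) X\<^esub> z') =
      hom_precomp (W' n) (g n) z \<oplus>\<^bsub>hom_group R (W' n) X\<^esub> hom_precomp (W' n) (g n) z'"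
    if "z \<in> W.hom_cycles X n" "z' \<in> W.hom_cycles X n" for z z'
    by (rule additive_map_add[OF additive_map_hom_precomp[OF W'.module gm]])
      (use that in \<open>simp_all add: W.hom_cycles_def\<close>)
  show ?thesis
    unfolding rel_Ext_def W.homology_hom[OF X] W'.homology_hom[OF X]
    using X
    by (intro subquotient_iso[where f = "hom_precomp (W' n) (g n)" and g = "hom_precomp (W n) (f n)"]
        abelian_group_hom_group'[OF W.module] abelian_group_hom_group'[OF W'.module]
        W.additive_subgroup_hom_cycles W.additive_subgroup_hom_boundaries
        W.hom_boundaries_subset_hom_cycles W'.additive_subgroup_hom_cycles
        W'.additive_subgroup_hom_boundaries W'.hom_boundaries_subset_hom_cycles
        chain_map_hom_cycles[OF W W' X g] chain_map_hom_boundaries[OF W W' X g]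
        chain_map_hom_cycles[OF W' W X f] chain_map_hom_boundaries[OF W' W X f] add
        hom_precomp_homotopic_to_identity[OF W X module_map_closed[OF fm] gf]
        hom_precomp_homotopic_to_identity[OF W' X module_map_closed[OF gm] fg])
qed

text \<open>Transport of structure along an injection \<open>\<phi>\<close> with left inverse \<open>\<psi>\<close>.  Only the additive part and
  the scalar action of the record are meaningful.\<close>

definition copy_module :: "('m \<Rightarrow> 'n) \<Rightarrow> ('n \<Rightarrow> 'm) \<Rightarrow> ('r, 'm) module \<Rightarrow> ('r, 'n) module" where
  "copy_module \<phi> \<psi> M = \<lparr>carrier = \<phi> ` carrier M, monoid.mult = undefined, one = undefined,
     ring.zero = \<phi> \<zero>\<^bsub>M\<^esub>, ring.add = (\<lambda>x y. \<phi> (\<psi> x \<oplus>\<^bsub>M\<^esub> \<psi> y)), smult = (\<lambda>r x. \<phi> (r \<odot>\<^bsub>M\<^esub> \<psi> x))\<rparr>"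

lemma left_module_copy_module:
  assumes M: "left_module R M" and inv: "\<And>x. \<psi> (\<phi> x) = x"
  shows "left_module R (copy_module \<phi> \<psi> M)"
    and "module_map R M (copy_module \<phi> \<psi> M) \<phi>" and "module_map R (copy_module \<phi> \<psi> M) M \<psi>"
proof -
  let ?C = "copy_module \<phi> \<psi> M"
  interpret M: left_module R M by fact
  have "abelian_group ?C"
  proof (rule abelian_groupI)
    fix x assume "x \<in> carrier ?C"
    then show "\<exists>y\<in>carrier ?C. y \<oplus>\<^bsub>?C\<^esub> x = \<zero>\<^bsub>?C\<^esub>"
      by (intro bexI[of _ "\<phi> (\<ominus>\<^bsub>M\<^esub> \<psi> x)"]) (auto simp: copy_module_def inv M.M.l_neg)
  qed (auto simp: copy_module_def inv M.M.a_ac)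
  then show "left_module R ?C"
    using M.R.ring_axioms
    by (auto simp: left_module_def left_module_axioms_def copy_module_def inv M.smult_closed
        M.smult_l_distr M.smult_r_distr M.smult_assoc M.smult_one)
  show "module_map R M ?C \<phi>" "module_map R ?C M \<psi>"
    by (auto simp: module_map_def copy_module_def inv)
qed

text \<open>The hypothesis \<open>copy\<close> moves the terms of a resolution into the type of the test modules; as
  the originals are retracts of the copies, both resolutions are exact against them.  The comparison
  maps in the two directions are then mutually inverse up to homotopy.\<close>

theorem rel_Ext_independent_of_resolution:
  fixes \<phi> :: "'u \<Rightarrow> 't"
  assumes mods: "\<And>A. \<C> A \<Longrightarrow> left_module R A"
    and copy: "\<And>A. \<C> A \<Longrightarrow> \<T> (copy_module \<phi> \<psi> A)" and inv: "\<And>u. \<psi> (\<phi> u) = u"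
    and L: "left_module R L" and X: "left_module R X"
    and W: "right_resolution R \<C> \<T> L e W d" and W': "right_resolution R \<C> \<T> L e' W' d'"
  shows "add_monoid (rel_Ext R W d X n) \<cong> add_monoid (rel_Ext R W' d' X n)"
proof -
  have res: "cochain_complex R V dV" "module_map R L (V 0) \<epsilon>"
    "\<And>x. x \<in> carrier L \<Longrightarrow> dV 0 (\<epsilon> x) = \<zero>\<^bsub>V 1\<^esub>" "\<And>Y. \<C> Y \<Longrightarrow> exact_against R L \<epsilon> V dV Y"
    "\<And>n. \<C> (V n)"
    if V: "right_resolution R \<C> \<T> L \<epsilon> V dV" for \<epsilon> V dV
  proof -
    have mod: "left_module R (V n)" for n
      using V mods by (simp add: right_resolution_def)
    show c: "cochain_complex R V dV"
      by (rule right_resolution_cochain_complex[OF V mods])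
    show e: "module_map R L (V 0) \<epsilon>" "\<And>x. x \<in> carrier L \<Longrightarrow> dV 0 (\<epsilon> x) = \<zero>\<^bsub>V 1\<^esub>" "\<And>n. \<C> (V n)"
      using V by (auto simp: right_resolution_def mod_hom_iff)
    show "exact_against R L \<epsilon> V dV Y" if Y: "\<C> Y" for Y
    proof (rule exact_against_retract[where X = "copy_module \<phi> \<psi> Y" and i = \<phi> and p = \<psi>])
      show "exact_against R L \<epsilon> V dV (copy_module \<phi> \<psi> Y)"
        by (rule right_resolution_exact_against[OF V copy[OF Y] L mod])
    qed (use left_module_copy_module[of R Y \<psi> \<phi>, OF mods[OF Y] inv] mods[OF Y] inv module_map_closed[OF e(1)]
        cochain_complex.closed[OF c] in auto)
  qed
  note r = res[OF W] and r' = res[OF W']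
  obtain f where f: "chain_map R W d W' d' f" "\<And>x. x \<in> carrier L \<Longrightarrow> f 0 (e x) = e' x"
    using comparison_chain_map[OF r'(1-3) r(4)[OF r'(5)]] by blast
  obtain g where g: "chain_map R W' d' W d g" "\<And>x. x \<in> carrier L \<Longrightarrow> g 0 (e' x) = e x"
    using comparison_chain_map[OF r(1-3) r'(4)[OF r(5)]] by blast
  show ?thesis
  proof (rule rel_Ext_homotopy_equivalence[OF r(1) r'(1) X f(1) g(1)])
    show "homotopic_to_identity R W d (\<lambda>n x. g n (f n x))"
    proof (rule chain_map_homotopic_to_identity[OF r(1) chain_map_compose[OF f(1) g(1)]])
      show "e x \<in> carrier (W 0)" if "x \<in> carrier L" for x
        by (rule module_map_closed[OF r(2) that])
      show "g 0 (f 0 (e x)) = e x" if "x \<in> carrier L" for x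
        using that f(2) g(2) by simp
      show "exact_against R L e W d (W k)" for k
        by (rule r(4)[OF r(5)])
    qed
    show "homotopic_to_identity R W' d' (\<lambda>n x. f n (g n x))"
    proof (rule chain_map_homotopic_to_identity[OF r'(1) chain_map_compose[OF g(1) f(1)]])
      show "e' x \<in> carrier (W' 0)" if "x \<in> carrier L" for x
        by (rule module_map_closed[OF r'(2) that])
      show "f 0 (g 0 (e' x)) = e' x" if "x \<in> carrier L" for x
        using that f(2) g(2) by simp
      show "exact_against R L e' W' d' (W' k)" for k
        by (rule r'(4)[OF r'(5)])
    qed
  qed
qed

section \<open>Tensor products over a noncommutative ring\<close>

lemma tensor_relations_intros:
  "\<lbrakk>x \<in> carrier M; x' \<in> carrier M; y \<in> carrier N\<rbrakk> \<Longrightarrow>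
    frag_of (x \<oplus>\<^bsub>M\<^esub> x', y) - frag_of (x, y) - frag_of (x', y) \<in> tensor_relations R M N"
  "\<lbrakk>x \<in> carrier M; y \<in> carrier N; y' \<in> carrier N\<rbrakk> \<Longrightarrow>
    frag_of (x, y \<oplus>\<^bsub>N\<^esub> y') - frag_of (x, y) - frag_of (x, y') \<in> tensor_relations R M N"
  "\<lbrakk>x \<in> carrier M; r \<in> carrier R; y \<in> carrier N\<rbrakk> \<Longrightarrow>
    frag_of (r \<odot>\<^bsub>M\<^esub> x, y) - frag_of (x, r \<odot>\<^bsub>N\<^esub> y) \<in> tensor_relations R M N"
  unfolding tensor_relations_def by blast+

lemma tensor_relations_cases:
  assumes "c \<in> tensor_relations R M N"
  obtains x x' y where "x \<in> carrier M" "x' \<in> carrier M" "y \<in> carrier N"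
      "c = frag_of (x \<oplus>\<^bsub>M\<^esub> x', y) - frag_of (x, y) - frag_of (x', y)"
    | x y y' where "x \<in> carrier M" "y \<in> carrier N" "y' \<in> carrier N"
      "c = frag_of (x, y \<oplus>\<^bsub>N\<^esub> y') - frag_of (x, y) - frag_of (x, y')"
    | x r y where "x \<in> carrier M" "r \<in> carrier R" "y \<in> carrier N"
      "c = frag_of (r \<odot>\<^bsub>M\<^esub> x, y) - frag_of (x, r \<odot>\<^bsub>N\<^esub> y)"
  using assms unfolding tensor_relations_def by blast

text \<open>The action on the second argument is a parameter because that argument will often carry the
  module structure of a second ring.\<close>

definition balanced_map ::
  "'r ring \<Rightarrow> ('r, 'a, 'x) module_scheme \<Rightarrow> ('b, 'y) ring_scheme \<Rightarrow> ('r \<Rightarrow> 'b \<Rightarrow> 'b) \<Rightarrow>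
   ('g, 'z) ring_scheme \<Rightarrow> ('a \<Rightarrow> 'b \<Rightarrow> 'g) \<Rightarrow> bool" where
  "balanced_map R A B act G b \<longleftrightarrow>
     (\<forall>x\<in>carrier A. additive_map B G (\<lambda>y. b x y)) \<and>
     (\<forall>y\<in>carrier B. additive_map A G (\<lambda>x. b x y)) \<and>
     (\<forall>r\<in>carrier R. \<forall>x\<in>carrier A. \<forall>y\<in>carrier B. b (r \<odot>\<^bsub>A\<^esub> x) y = b x (act r y))"

lemma balanced_mapD:
  assumes "balanced_map R A B act G b"
  shows "\<lbrakk>x \<in> carrier A; y \<in> carrier B\<rbrakk> \<Longrightarrow> b x y \<in> carrier G"
    "\<lbrakk>x \<in> carrier A; x' \<in> carrier A; y \<in> carrier B\<rbrakk> \<Longrightarrow> b (x \<oplus>\<^bsub>A\<^esub> x') y = b x y \<oplus>\<^bsub>G\<^esub> b x' y"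
    "\<lbrakk>x \<in> carrier A; y \<in> carrier B; y' \<in> carrier B\<rbrakk> \<Longrightarrow> b x (y \<oplus>\<^bsub>B\<^esub> y') = b x y \<oplus>\<^bsub>G\<^esub> b x y'"
    "\<lbrakk>r \<in> carrier R; x \<in> carrier A; y \<in> carrier B\<rbrakk> \<Longrightarrow> b (r \<odot>\<^bsub>A\<^esub> x) y = b x (act r y)"
  using assms by (auto simp: balanced_map_def additive_map_def)

text \<open>These closure properties place the tensor relations in the free abelian group \<open>F\<close>.\<close>

locale tensor_factors =
  fixes R :: "'r ring" and M :: "('r, 'm, 'x) module_scheme" and N :: "('r, 'n, 'y) module_scheme"
  assumes M_group: "abelian_group M" and N_group: "abelian_group N"
    and M_smult: "r \<in> carrier R \<Longrightarrow> x \<in> carrier M \<Longrightarrow> r \<odot>\<^bsub>M\<^esub> x \<in> carrier M"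
    and N_smult: "r \<in> carrier R \<Longrightarrow> y \<in> carrier N \<Longrightarrow> r \<odot>\<^bsub>N\<^esub> y \<in> carrier N"
begin

sublocale M: abelian_group M by (rule M_group)
sublocale N: abelian_group N by (rule N_group)

abbreviation "F \<equiv> free_Abelian_group (carrier M \<times> carrier N)"
abbreviation "K \<equiv> tensor_kernel R M N"

sublocale F: comm_group F by (rule abelian_free_Abelian_group)

definition pure_tensor :: "'m \<Rightarrow> 'n \<Rightarrow> ('m \<times> 'n \<Rightarrow>\<^sub>0 int) set" where
  "pure_tensor x y = K #>\<^bsub>F\<^esub> frag_of (x, y)"

lemma keys_diff_subset: "Poly_Mapping.keys a \<subseteq> A \<Longrightarrow> Poly_Mapping.keys b \<subseteq> A \<Longrightarrow> Poly_Mapping.keys (a - b) \<subseteq> A"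
  for a b :: "'z \<Rightarrow>\<^sub>0 int"
  using keys_diff[of a b] by blast

lemma tensor_relations_subset: "tensor_relations R M N \<subseteq> carrier F"
proof
  fix c assume "c \<in> tensor_relations R M N"
  then have "Poly_Mapping.keys c \<subseteq> carrier M \<times> carrier N"
    by (cases rule: tensor_relations_cases; hypsubst; intro keys_diff_subset; simp add: M_smult N_smult)
  then show "c \<in> carrier F" by simp
qed

lemma kernel_subgroup: "subgroup K F"
  unfolding tensor_kernel_def by (intro F.generate_is_subgroup tensor_relations_subset)

lemma kernel_normal: "K \<lhd> F"
  by (intro F.subgroup_imp_normal kernel_subgroup)

lemma abelian_group_tensor: "abelian_group (tensor R M N)"
  unfolding tensor_def by (intro abelian_group_additive_group F.abelian_FactGroup kernel_subgroup)

sublocale T: abelian_group "tensor R M N" by (rule abelian_group_tensor)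

lemma carrier_tensor: "carrier (tensor R M N) = (\<lambda>c. K #>\<^bsub>F\<^esub> c) ` carrier F"
  by (simp add: tensor_def additive_group_def carrier_FactGroup)

lemma coset_add:
  assumes "a \<in> carrier F" "b \<in> carrier F"
  shows "(K #>\<^bsub>F\<^esub> a) \<oplus>\<^bsub>tensor R M N\<^esub> (K #>\<^bsub>F\<^esub> b) = K #>\<^bsub>F\<^esub> (a + b)"
  using normal.rcos_sum[OF kernel_normal assms] by (simp add: tensor_def additive_group_def)

lemma zero_tensor: "\<zero>\<^bsub>tensor R M N\<^esub> = K #>\<^bsub>F\<^esub> 0"
  using F.coset_mult_one[OF subgroup.subset[OF kernel_subgroup]]
  by (simp add: tensor_def additive_group_def)

lemma coset_eqI:
  assumes "a \<in> carrier F" "b \<in> carrier F" "a - b \<in> K"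
  shows "K #>\<^bsub>F\<^esub> a = K #>\<^bsub>F\<^esub> b"
proof -
  have "a \<in> K #>\<^bsub>F\<^esub> b"
    using assms(3) by (force simp: r_coset_def)
  then show ?thesis
    using F.repr_independence[OF _ assms(2) kernel_subgroup] by simp
qed

lemma pure_tensor_closed:
  "x \<in> carrier M \<Longrightarrow> y \<in> carrier N \<Longrightarrow> pure_tensor x y \<in> carrier (tensor R M N)"
  by (simp add: pure_tensor_def carrier_tensor)

lemma keys_add_subset: "Poly_Mapping.keys a \<subseteq> A \<Longrightarrow> Poly_Mapping.keys b \<subseteq> A \<Longrightarrow> Poly_Mapping.keys (a + b) \<subseteq> A"
  for a b :: "'z \<Rightarrow>\<^sub>0 int"
  using keys_add[of a b] by blast

lemma pure_tensor_add_left: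
  assumes "x \<in> carrier M" "x' \<in> carrier M" "y \<in> carrier N"
  shows "pure_tensor (x \<oplus>\<^bsub>M\<^esub> x') y = pure_tensor x y \<oplus>\<^bsub>tensor R M N\<^esub> pure_tensor x' y"
proof -
  have "frag_of (x \<oplus>\<^bsub>M\<^esub> x', y) - frag_of (x, y) - frag_of (x', y) \<in> K"
    unfolding tensor_kernel_def by (intro generate.incl tensor_relations_intros assms)
  then have "frag_of (x \<oplus>\<^bsub>M\<^esub> x', y) - (frag_of (x, y) + frag_of (x', y)) \<in> K"
    by (simp add: diff_diff_eq)
  with assms show ?thesis
    unfolding pure_tensor_def
    by (subst coset_add, simp_all, intro coset_eqI) (simp_all add: keys_add_subset)
qed

lemma pure_tensor_add_right:
  assumes "x \<in> carrier M" "y \<in> carrier N" "y' \<in> carrier N"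
  shows "pure_tensor x (y \<oplus>\<^bsub>N\<^esub> y') = pure_tensor x y \<oplus>\<^bsub>tensor R M N\<^esub> pure_tensor x y'"
proof -
  have "frag_of (x, y \<oplus>\<^bsub>N\<^esub> y') - frag_of (x, y) - frag_of (x, y') \<in> K"
    unfolding tensor_kernel_def by (intro generate.incl tensor_relations_intros assms)
  then have "frag_of (x, y \<oplus>\<^bsub>N\<^esub> y') - (frag_of (x, y) + frag_of (x, y')) \<in> K"
    by (simp add: diff_diff_eq)
  with assms show ?thesis
    unfolding pure_tensor_def
    by (subst coset_add, simp_all, intro coset_eqI) (simp_all add: keys_add_subset)
qed

lemma pure_tensor_balanced:
  assumes "x \<in> carrier M" "r \<in> carrier R" "y \<in> carrier N"
  shows "pure_tensor (r \<odot>\<^bsub>M\<^esub> x) y = pure_tensor x (r \<odot>\<^bsub>N\<^esub> y)"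
proof -
  have "frag_of (r \<odot>\<^bsub>M\<^esub> x, y) - frag_of (x, r \<odot>\<^bsub>N\<^esub> y) \<in> K"
    unfolding tensor_kernel_def by (intro generate.incl tensor_relations_intros assms)
  with assms show ?thesis
    unfolding pure_tensor_def by (intro coset_eqI) (simp_all add: M_smult N_smult)
qed

lemma tensor_induct [consumes 1, case_names zero pure diff]:
  assumes X: "X \<in> carrier (tensor R M N)" and zero: "P \<zero>\<^bsub>tensor R M N\<^esub>"
    and pure: "\<And>x y. x \<in> carrier M \<Longrightarrow> y \<in> carrier N \<Longrightarrow> P (pure_tensor x y)"
    and diff: "\<And>X Y. \<lbrakk>X \<in> carrier (tensor R M N); Y \<in> carrier (tensor R M N); P X; P Y\<rbrakk>
      \<Longrightarrow> P (X \<ominus>\<^bsub>tensor R M N\<^esub> Y)"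
  shows "P X"
proof -
  obtain c where c: "Poly_Mapping.keys c \<subseteq> carrier M \<times> carrier N" "X = K #>\<^bsub>F\<^esub> c"
    using X by (auto simp: carrier_tensor)
  note step = diff
  have "c \<in> carrier F \<and> P (K #>\<^bsub>F\<^esub> c)"
    using c(1)
  proof (induction c rule: frag_induction)
    case zero
    then show ?case using \<open>P \<zero>\<^bsub>tensor R M N\<^esub>\<close> by (simp add: zero_tensor)
  next
    case (one p)
    then show ?case using pure by (cases p) (auto simp: pure_tensor_def)
  next
    case (diff a b)
    have ab: "a \<in> carrier F" "b \<in> carrier F" "a - b \<in> carrier F"
      using diff by (simp_all add: keys_diff_subset)
    have cl: "K #>\<^bsub>F\<^esub> a \<in> carrier (tensor R M N)" "K #>\<^bsub>F\<^esub> b \<in> carrier (tensor R M N)"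
      "K #>\<^bsub>F\<^esub> (a - b) \<in> carrier (tensor R M N)"
      using ab by (auto simp only: carrier_tensor)
    have "(K #>\<^bsub>F\<^esub> (a - b)) \<oplus>\<^bsub>tensor R M N\<^esub> (K #>\<^bsub>F\<^esub> b) = K #>\<^bsub>F\<^esub> a"
      using coset_add[OF ab(3,2)] by simp
    then have "K #>\<^bsub>F\<^esub> (a - b) = (K #>\<^bsub>F\<^esub> a) \<ominus>\<^bsub>tensor R M N\<^esub> (K #>\<^bsub>F\<^esub> b)"
      using cl by (metis T.a_assoc T.a_inv_closed T.r_neg T.r_zero a_minus_def)
    then show ?case
      using step[OF cl(1,2)] diff ab(3) by simp
  qed
  then show ?thesis using c(2) by simp
qed

lemma balanced_map_pure_tensor:
  "balanced_map R M N (\<lambda>r y. r \<odot>\<^bsub>N\<^esub> y) (tensor R M N) pure_tensor"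
  unfolding balanced_map_def
  by (auto intro!: additive_mapI
      simp: pure_tensor_closed pure_tensor_add_left pure_tensor_add_right pure_tensor_balanced)

text \<open>Pure tensors generate the tensor product.\<close>

lemma tensor_ext:
  assumes G: "abelian_group G"
    and f: "additive_map (tensor R M N) G f" and g: "additive_map (tensor R M N) G g"
    and eq: "\<And>x y. x \<in> carrier M \<Longrightarrow> y \<in> carrier N \<Longrightarrow> f (pure_tensor x y) = g (pure_tensor x y)"
    and X: "X \<in> carrier (tensor R M N)"
  shows "f X = g X"
  using X
proof (induction X rule: tensor_induct)
  case zero
  then show ?case
    by (simp add: additive_zero[OF T.abelian_group_axioms G] f g)
next
  case (pure x y)
  then show ?case by (rule eq)
next
  case (diff X Y)
  then show ?case
    by (simp add: a_minus_def additive_map_add[OF f] additive_map_add[OF g]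
        additive_minus[OF T.abelian_group_axioms G f] additive_minus[OF T.abelian_group_axioms G g])
qed

text \<open>The free abelian group maps to \<open>G\<close> by \<open>b\<close>; a balanced map sends the tensor relations, and with
  them the subgroup that they generate, to zero.\<close>

theorem tensor_lift:
  assumes G: "abelian_group G" and b: "balanced_map R M N (\<lambda>r y. r \<odot>\<^bsub>N\<^esub> y) G b"
  obtains h where "additive_map (tensor R M N) G h"
    "\<And>x y. x \<in> carrier M \<Longrightarrow> y \<in> carrier N \<Longrightarrow> h (pure_tensor x y) = b x y"
proof -
  let ?b = "\<lambda>(x, y). b x y"
  interpret G: abelian_group G by fact
  have "?b ` (carrier M \<times> carrier N) \<subseteq> carrier (add_monoid G)"
    using balanced_mapD(1)[OF b] by auto
  then obtain h0 where h0: "h0 \<in> hom F (add_monoid G)"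
    and h0_of: "\<And>p. p \<in> carrier M \<times> carrier N \<Longrightarrow> h0 (frag_of p) = ?b p"
    using comm_group.free_Abelian_group_universal[OF G.a_comm_group] by metis
  interpret h0: group_hom F "add_monoid G" h0
    using h0 G.a_group F.group_axioms by (simp add: group_hom_def group_hom_axioms_def)
  have h0_diff: "h0 (u - v) = h0 u \<ominus>\<^bsub>G\<^esub> h0 v" if "u \<in> carrier F" "v \<in> carrier F" for u v
  proof -
    have "- v \<in> carrier F" using that by simp
    then have "h0 (u + - v) = h0 u \<oplus>\<^bsub>G\<^esub> h0 (- v)"
      using that h0.hom_mult[of u "- v"] by simp
    moreover have "h0 (- v) = \<ominus>\<^bsub>G\<^esub> h0 v"
      using that h0.hom_inv[of v] by (simp add: a_inv_def)
    ultimately show ?thesis by (simp add: a_minus_def)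
  qed
  have rel: "h0 c = \<zero>\<^bsub>G\<^esub>" if c: "c \<in> tensor_relations R M N" for c
  proof -
    have fr: "frag_of (x, y) \<in> carrier F" if "x \<in> carrier M" "y \<in> carrier N" for x y
      using that by simp
    have eq3: "h0 (frag_of p - frag_of q - frag_of r) = \<zero>\<^bsub>G\<^esub>"
      if "p \<in> carrier M \<times> carrier N" "q \<in> carrier M \<times> carrier N" "r \<in> carrier M \<times> carrier N"
        "?b p = ?b q \<oplus>\<^bsub>G\<^esub> ?b r" for p q r
    proof -
      have f: "frag_of p \<in> carrier F" "frag_of q \<in> carrier F" "frag_of r \<in> carrier F"
        "frag_of p - frag_of q \<in> carrier F"
        using that by (simp_all add: keys_diff_subset)
      have bc: "?b q \<in> carrier G" "?b r \<in> carrier G"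
        using that balanced_mapD(1)[OF b] by auto
      show ?thesis
        unfolding h0_diff[OF f(4,3)] h0_diff[OF f(1,2)] h0_of[OF that(1)] h0_of[OF that(2)]
          h0_of[OF that(3)] that(4)
        using bc
        by (simp only: a_minus_def G.a_comm[OF bc] G.a_assoc G.a_closed G.a_inv_closed G.r_neg G.r_zero)
    qed
    have eq2: "h0 (frag_of p - frag_of q) = \<zero>\<^bsub>G\<^esub>"
      if "p \<in> carrier M \<times> carrier N" "q \<in> carrier M \<times> carrier N"
        "?b p = ?b q" for p q
    proof -
      have f: "frag_of p \<in> carrier F" "frag_of q \<in> carrier F"
        using that by auto
      have "?b q \<in> carrier G"
        using that balanced_mapD(1)[OF b] by auto
      then show ?thesis
        unfolding h0_diff[OF f] h0_of[OF that(1)] h0_of[OF that(2)] that(3)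
        by (simp add: a_minus_def G.r_neg)
    qed
    show ?thesis
      using c by (cases rule: tensor_relations_cases; hypsubst)
        (auto intro!: eq2 eq3 simp: M_smult N_smult balanced_mapD[OF b])
  qed
  have "K \<subseteq> kernel F (add_monoid G) h0"
    unfolding tensor_kernel_def
    using rel subsetD[OF tensor_relations_subset]
    by (intro F.generate_subgroup_incl h0.subgroup_kernel) (auto simp: kernel_def simp del: carrier_free_Abelian_group_iff)
  then have K0: "h0 k = \<zero>\<^bsub>G\<^esub>" "k \<in> carrier F" if "k \<in> K" for k
    using that by (auto simp: kernel_def)
  define h where "h X = the_elem (h0 ` X)" for X
  have h: "h (K #>\<^bsub>F\<^esub> c) = h0 c" if c: "c \<in> carrier F" for c
  proof -
    have "h0 ` (K #>\<^bsub>F\<^esub> c) = {h0 c}"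
    proof (intro equalityI subsetI)
      fix y assume "y \<in> h0 ` (K #>\<^bsub>F\<^esub> c)"
      then obtain k where k: "k \<in> K" "y = h0 (k + c)"
        by (auto simp: r_coset_def)
      then show "y \<in> {h0 c}"
        using h0.hom_mult[OF K0(2)[OF k(1)] c] K0(1)[OF k(1)] h0.hom_closed[OF c] by simp
    next
      fix y assume "y \<in> {h0 c}"
      moreover have "c \<in> K #>\<^bsub>F\<^esub> c"
        by (rule F.rcos_self[OF c kernel_subgroup])
      ultimately show "y \<in> h0 ` (K #>\<^bsub>F\<^esub> c)" by blast
    qed
    then show ?thesis by (simp add: h_def)
  qed
  have "additive_map (tensor R M N) G h"
  proof (rule additive_mapI; unfold carrier_tensor)
    fix X assume "X \<in> (\<lambda>c. K #>\<^bsub>F\<^esub> c) ` carrier F"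
    then obtain c where c: "c \<in> carrier F" "X = K #>\<^bsub>F\<^esub> c" by blast
    show "h X \<in> carrier G"
      using h[OF c(1)] h0.hom_closed[OF c(1)] c(2) by simp
    fix Y assume "Y \<in> (\<lambda>c. K #>\<^bsub>F\<^esub> c) ` carrier F"
    then obtain c' where c': "c' \<in> carrier F" "Y = K #>\<^bsub>F\<^esub> c'" by blast
    have "h (K #>\<^bsub>F\<^esub> (c + c')) = h0 (c + c')"
      using keys_add_subset c(1) c'(1) by (intro h) simp
    then show "h (X \<oplus>\<^bsub>tensor R M N\<^esub> Y) = h X \<oplus>\<^bsub>G\<^esub> h Y"
      using h0.hom_mult[OF c(1) c'(1)]
      by (simp add: c(2) c'(2) coset_add[OF c(1) c'(1)] h[OF c(1)] h[OF c'(1)])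
  qed
  moreover have "h (pure_tensor x y) = b x y" if "x \<in> carrier M" "y \<in> carrier N" for x y
    unfolding pure_tensor_def using that by (subst h) (auto simp: h0_of)
  ultimately show thesis by (rule that)
qed

end

lemma (in tensor_factors) pure_tensor_zero_left:
  assumes "y \<in> carrier N"
  shows "pure_tensor \<zero>\<^bsub>M\<^esub> y = \<zero>\<^bsub>tensor R M N\<^esub>"
  using assms by (intro additive_zero[where f = "\<lambda>x. pure_tensor x y"] additive_mapI)
    (auto simp: pure_tensor_closed pure_tensor_add_left M_group abelian_group_tensor)

lemma (in tensor_factors) pure_tensor_zero_right:
  assumes "x \<in> carrier M"
  shows "pure_tensor x \<zero>\<^bsub>N\<^esub> = \<zero>\<^bsub>tensor R M N\<^esub>"
  using assms by (intro additive_zero[where f = "\<lambda>y. pure_tensor x y"] additive_mapI)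
    (auto simp: pure_tensor_closed pure_tensor_add_right N_group abelian_group_tensor)

locale tensor_factors_map = source: tensor_factors R M N + target: tensor_factors R M' N'
  for R :: "'r ring" and M :: "('r, 'm, 'x) module_scheme" and N :: "('r, 'n, 'y) module_scheme"
    and M' :: "('r, 'm', 'x') module_scheme" and N' :: "('r, 'n', 'y') module_scheme" +
  fixes f g
  assumes f: "module_map R M M' f" and g: "module_map R N N' g"
begin

abbreviation "\<phi> \<equiv> frag_extend (\<lambda>(x, y). frag_of (f x, g y))"

lemma \<phi>_closed:
  assumes "c \<in> carrier source.F"
  shows "\<phi> c \<in> carrier target.F"
proof -
  have c: "Poly_Mapping.keys c \<subseteq> carrier M \<times> carrier N"
    using assms by simp
  have "Poly_Mapping.keys (case p of (x, y) \<Rightarrow> frag_of (f x, g y)) \<subseteq> carrier M' \<times> carrier N'"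
    if "p \<in> Poly_Mapping.keys c" for p
    using that c module_map_closed[OF f] module_map_closed[OF g] by (cases p) auto
  then show ?thesis
    using keys_frag_extend[of "\<lambda>(x, y). frag_of (f x, g y)" c] by simp blast
qed

text \<open>Linear maps send tensor relations to tensor relations, so \<open>f \<otimes> g\<close> is well defined on cosets.\<close>

lemma \<phi>_kernel:
  assumes "c \<in> source.K"
  shows "\<phi> c \<in> target.K"
proof -
  let ?H = "{c \<in> carrier source.F. \<phi> c \<in> target.K}"
  interpret K': subgroup target.K target.F by (rule target.kernel_subgroup)
  have rel: "\<phi> c \<in> tensor_relations R M' N'" if "c \<in> tensor_relations R M N" for c
    using that
  proof (cases rule: tensor_relations_cases)
    case (1 x x' y)
    then show ?thesis
      using tensor_relations_intros(1)[of "f x" M' "f x'" "g y" N' R]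
      by (simp add: frag_extend_diff module_map_add[OF f] module_map_closed[OF f] module_map_closed[OF g])
  next
    case (2 x y y')
    then show ?thesis
      using tensor_relations_intros(2)[of "f x" M' "g y" N' "g y'" R]
      by (simp add: frag_extend_diff module_map_add[OF g] module_map_closed[OF f] module_map_closed[OF g])
  next
    case (3 x r y)
    then show ?thesis
      using tensor_relations_intros(3)[of "f x" M' r R "g y" N']
      by (simp add: frag_extend_diff module_map_smult[OF f] module_map_smult[OF g]
          module_map_closed[OF f] module_map_closed[OF g])
  qed
  have "subgroup ?H source.F"
  proof (rule source.F.subgroupI)
    have "0 \<in> target.K"
      using K'.one_closed by simp
    then show "?H \<noteq> {}"
      by (auto intro!: exI[of _ 0])
  next
    fix a assume "a \<in> ?H"
    then have a: "Poly_Mapping.keys a \<subseteq> carrier M \<times> carrier N" "\<phi> a \<in> target.K"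
      by auto
    then have "inv\<^bsub>target.F\<^esub> (\<phi> a) = - \<phi> a"
      using \<phi>_closed[of a] by simp
    then have "- \<phi> a \<in> target.K"
      using K'.m_inv_closed[OF a(2)] by metis
    then show "inv\<^bsub>source.F\<^esub> a \<in> ?H"
      using a by (simp add: frag_extend_minus)
  next
    fix a b assume "a \<in> ?H" "b \<in> ?H"
    then have ab: "Poly_Mapping.keys a \<subseteq> carrier M \<times> carrier N" "\<phi> a \<in> target.K"
      "Poly_Mapping.keys b \<subseteq> carrier M \<times> carrier N" "\<phi> b \<in> target.K"
      by auto
    have "\<phi> a \<otimes>\<^bsub>target.F\<^esub> \<phi> b \<in> target.K"
      by (rule K'.m_closed[OF ab(2,4)])
    then show "a \<otimes>\<^bsub>source.F\<^esub> b \<in> ?H"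
      using source.keys_add_subset[OF ab(1,3)] by (simp add: frag_extend_add)
  qed auto
  moreover have "tensor_relations R M N \<subseteq> ?H"
    using rel subsetD[OF source.tensor_relations_subset] unfolding tensor_kernel_def
    by (blast intro: generate.incl)
  ultimately have "source.K \<subseteq> ?H"
    unfolding tensor_kernel_def[of R M N] by (intro source.F.generate_subgroup_incl)
  then show ?thesis using assms by blast
qed

lemma tensor_map_coset:
  assumes c: "c \<in> carrier source.F"
  shows "tensor_map R M' N' f g (source.K #>\<^bsub>source.F\<^esub> c) = target.K #>\<^bsub>target.F\<^esub> \<phi> c"
proof -
  interpret K: subgroup source.K source.F by (rule source.kernel_subgroup)
  interpret K': subgroup target.K target.F by (rule target.kernel_subgroup)
  show ?thesis
    unfolding tensor_map_def
  proof (intro equalityI subsetI)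
    fix z assume "z \<in> target.K <#>\<^bsub>target.F\<^esub> \<phi> ` (source.K #>\<^bsub>source.F\<^esub> c)"
    then obtain k k' where k: "k \<in> source.K" "k' \<in> target.K" "z = k' + \<phi> (k + c)"
      by (auto simp: set_mult_def r_coset_def)
    then have "z = (k' + \<phi> k) + \<phi> c"
      by (simp add: frag_extend_add add.assoc)
    moreover have "k' + \<phi> k \<in> target.K"
      using K'.m_closed[OF k(2) \<phi>_kernel[OF k(1)]] unfolding mult_free_Abelian_group .
    ultimately show "z \<in> target.K #>\<^bsub>target.F\<^esub> \<phi> c"
      by (auto simp: r_coset_def)
  next
    fix z assume "z \<in> target.K #>\<^bsub>target.F\<^esub> \<phi> c"
    then obtain k' where "k' \<in> target.K" "z = k' + \<phi> c"
      by (auto simp: r_coset_def)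
    moreover have "c \<in> source.K #>\<^bsub>source.F\<^esub> c"
      by (rule source.F.rcos_self[OF c source.kernel_subgroup])
    ultimately show "z \<in> target.K <#>\<^bsub>target.F\<^esub> \<phi> ` (source.K #>\<^bsub>source.F\<^esub> c)"
      by (auto simp: set_mult_def)
  qed
qed

lemma additive_map_tensor_map: "additive_map (tensor R M N) (tensor R M' N') (tensor_map R M' N' f g)"
proof (rule additive_mapI; unfold source.carrier_tensor)
  fix X assume "X \<in> (\<lambda>c. source.K #>\<^bsub>source.F\<^esub> c) ` carrier source.F"
  then obtain a where a: "a \<in> carrier source.F" "X = source.K #>\<^bsub>source.F\<^esub> a" by blast
  show "tensor_map R M' N' f g X \<in> carrier (tensor R M' N')"
    unfolding a(2) tensor_map_coset[OF a(1)] target.carrier_tensor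
    by (intro imageI \<phi>_closed a(1))
  fix Y assume "Y \<in> (\<lambda>c. source.K #>\<^bsub>source.F\<^esub> c) ` carrier source.F"
  then obtain b where b: "b \<in> carrier source.F" "Y = source.K #>\<^bsub>source.F\<^esub> b" by blast
  have ab: "a + b \<in> carrier source.F"
    using source.F.m_closed[OF a(1) b(1)] by simp
  show "tensor_map R M' N' f g (X \<oplus>\<^bsub>tensor R M N\<^esub> Y) =
      tensor_map R M' N' f g X \<oplus>\<^bsub>tensor R M' N'\<^esub> tensor_map R M' N' f g Y"
    unfolding a(2) b(2) source.coset_add[OF a(1) b(1)] tensor_map_coset[OF a(1)]
      tensor_map_coset[OF b(1)] tensor_map_coset[OF ab]
      target.coset_add[OF \<phi>_closed[OF a(1)] \<phi>_closed[OF b(1)]] frag_extend_add ..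
qed

lemmas tensor_map_closed = additive_map_closed[OF additive_map_tensor_map]
lemmas tensor_map_add = additive_map_add[OF additive_map_tensor_map]

lemma tensor_map_pure:
  assumes "x \<in> carrier M" "y \<in> carrier N"
  shows "tensor_map R M' N' f g (source.pure_tensor x y) = target.pure_tensor (f x) (g y)"
  unfolding source.pure_tensor_def target.pure_tensor_def
  using assms by (subst tensor_map_coset) auto

lemma tensor_map_unique:
  assumes "additive_map (tensor R M N) (tensor R M' N') h"
    "\<And>x y. x \<in> carrier M \<Longrightarrow> y \<in> carrier N \<Longrightarrow> h (source.pure_tensor x y) = target.pure_tensor (f x) (g y)"
    "X \<in> carrier (tensor R M N)"
  shows "tensor_map R M' N' f g X = h X"
  by (rule source.tensor_ext[OF target.abelian_group_tensor additive_map_tensor_map assms(1) _ assms(3)])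
    (simp add: assms(2) tensor_map_pure)

end

lemma tensor_map_compose:
  assumes fg: "tensor_factors_map R M N M' N' f g" and fg': "tensor_factors_map R M' N' M'' N'' f' g'"
    and X: "X \<in> carrier (tensor R M N)"
  shows "tensor_map R M'' N'' f' g' (tensor_map R M' N' f g X) =
    tensor_map R M'' N'' (\<lambda>x. f' (f x)) (\<lambda>y. g' (g y)) X"
proof -
  interpret A: tensor_factors_map R M N M' N' f g by fact
  interpret B: tensor_factors_map R M' N' M'' N'' f' g' by fact
  interpret C: tensor_factors_map R M N M'' N'' "\<lambda>x. f' (f x)" "\<lambda>y. g' (g y)"
    by unfold_locales (intro module_map_compose[OF A.f B.f] module_map_compose[OF A.g B.g])+
  show ?thesis
    by (rule C.tensor_map_unique[symmetric, OF additive_map_compose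
          [OF A.additive_map_tensor_map B.additive_map_tensor_map] _ X])
      (simp add: A.tensor_map_pure B.tensor_map_pure module_map_closed[OF A.f] module_map_closed[OF A.g])
qed

lemma (in tensor_factors) tensor_map_ident:
  assumes f: "\<And>x. x \<in> carrier M \<Longrightarrow> f x = x" and g: "\<And>y. y \<in> carrier N \<Longrightarrow> g y = y"
    and X: "X \<in> carrier (tensor R M N)"
  shows "tensor_map R M N f g X = X"
proof -
  interpret A: tensor_factors_map R M N M N f g
    using f g M_smult N_smult by unfold_locales (auto intro!: module_mapI)
  show ?thesis
    using X by (intro A.tensor_map_unique additive_mapI) (auto simp: f g)
qed

text \<open>Both sides of each module law are additive, so it is enough to check it on pure tensors.\<close>

lemma left_module_tensor_action:
  assumes TF: "tensor_factors R M N" and S: "ring S"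
    and p: "\<And>s. s \<in> carrier S \<Longrightarrow> module_map R M M (p s)"
    and q: "\<And>s. s \<in> carrier S \<Longrightarrow> module_map R N N (q s)"
    and distr: "\<And>s s' x y. \<lbrakk>s \<in> carrier S; s' \<in> carrier S; x \<in> carrier M; y \<in> carrier N\<rbrakk> \<Longrightarrow>
      tensor_factors.pure_tensor R M N (p (s \<oplus>\<^bsub>S\<^esub> s') x) (q (s \<oplus>\<^bsub>S\<^esub> s') y) =
      tensor_factors.pure_tensor R M N (p s x) (q s y) \<oplus>\<^bsub>tensor R M N\<^esub>
      tensor_factors.pure_tensor R M N (p s' x) (q s' y)"
    and assoc: "\<And>s s' x y. \<lbrakk>s \<in> carrier S; s' \<in> carrier S; x \<in> carrier M; y \<in> carrier N\<rbrakk> \<Longrightarrow>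
      p (s \<otimes>\<^bsub>S\<^esub> s') x = p s (p s' x) \<and> q (s \<otimes>\<^bsub>S\<^esub> s') y = q s (q s' y)"
    and one: "\<And>x y. \<lbrakk>x \<in> carrier M; y \<in> carrier N\<rbrakk> \<Longrightarrow> p \<one>\<^bsub>S\<^esub> x = x \<and> q \<one>\<^bsub>S\<^esub> y = y"
  shows "left_module S (with_smult (tensor R M N) (\<lambda>s. tensor_map R M N (p s) (q s)))"
proof -
  interpret tensor_factors R M N by fact
  interpret S: ring S by fact
  have TM: "tensor_factors_map R M N M N (p s) (q s)" if "s \<in> carrier S" for s
    using p[OF that] q[OF that] TF by (simp add: tensor_factors_map_def tensor_factors_map_axioms_def)
  note cl = tensor_factors_map.tensor_map_closed[OF TM]
  note ad = tensor_factors_map.tensor_map_add[OF TM]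
  note pu = tensor_factors_map.tensor_map_pure[OF TM]
  note pc = module_map_closed[OF p] and qc = module_map_closed[OF q]
  have "tensor_map R M N (p (s \<oplus>\<^bsub>S\<^esub> s')) (q (s \<oplus>\<^bsub>S\<^esub> s')) X =
      tensor_map R M N (p s) (q s) X \<oplus>\<^bsub>tensor R M N\<^esub> tensor_map R M N (p s') (q s') X"
    if s: "s \<in> carrier S" "s' \<in> carrier S" and X: "X \<in> carrier (tensor R M N)" for s s' X
    using s X by (intro tensor_factors_map.tensor_map_unique[OF TM] additive_mapI)
      (auto simp: cl ad pu distr T.a_ac)
  moreover have "tensor_map R M N (p (s \<otimes>\<^bsub>S\<^esub> s')) (q (s \<otimes>\<^bsub>S\<^esub> s')) X =
      tensor_map R M N (p s) (q s) (tensor_map R M N (p s') (q s') X)"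
    if s: "s \<in> carrier S" "s' \<in> carrier S" and X: "X \<in> carrier (tensor R M N)" for s s' X
  proof (rule tensor_factors_map.tensor_map_unique[OF TM])
    fix x y assume "x \<in> carrier M" "y \<in> carrier N"
    then show "tensor_map R M N (p s) (q s) (tensor_map R M N (p s') (q s') (pure_tensor x y)) =
        pure_tensor (p (s \<otimes>\<^bsub>S\<^esub> s') x) (q (s \<otimes>\<^bsub>S\<^esub> s') y)"
      using s assoc[of s s' x y] by (simp add: pu pc qc)
  qed (use s X in \<open>auto intro!: additive_mapI simp: cl ad\<close>)
  moreover have "tensor_map R M N (p \<one>\<^bsub>S\<^esub>) (q \<one>\<^bsub>S\<^esub>) X = X" if X: "X \<in> carrier (tensor R M N)" for X
  proof (rule tensor_factors_map.tensor_map_unique[OF TM])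
    fix x y assume "x \<in> carrier M" "y \<in> carrier N"
    then show "pure_tensor x y = pure_tensor (p \<one>\<^bsub>S\<^esub> x) (q \<one>\<^bsub>S\<^esub> y)"
      using one[of x y] by simp
  qed (use X in \<open>auto intro: additive_mapI\<close>)
  ultimately show ?thesis
    using S abelian_group_with_smult[OF abelian_group_tensor]
    by (simp add: left_module_def left_module_axioms_def cl ad)
qed

section \<open>The tensor-hom adjunction\<close>

text \<open>A left \<open>S\<close>-module on which \<open>Q\<close> acts from the right by \<open>S\<close>-linear maps.  The bimodules of both
  kinds are instances, one of them over the opposite rings.\<close>

locale bimodule_action =
  fixes S :: "'s ring" and Q :: "'r ring" and M :: "('s, 'm, 'y) module_scheme" and act :: "'r \<Rightarrow> 'm \<Rightarrow> 'm"
  assumes M: "left_module S M" and Q: "ring Q"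
    and act_map: "r \<in> carrier Q \<Longrightarrow> module_map S M M (act r)"
    and act_add: "\<lbrakk>r \<in> carrier Q; r' \<in> carrier Q; x \<in> carrier M\<rbrakk> \<Longrightarrow>
      act (r \<oplus>\<^bsub>Q\<^esub> r') x = act r x \<oplus>\<^bsub>M\<^esub> act r' x"
    and act_mult: "\<lbrakk>r \<in> carrier Q; r' \<in> carrier Q; x \<in> carrier M\<rbrakk> \<Longrightarrow>
      act (r \<otimes>\<^bsub>Q\<^esub> r') x = act r' (act r x)"
    and act_one: "x \<in> carrier M \<Longrightarrow> act \<one>\<^bsub>Q\<^esub> x = x"
begin

definition Hom_module :: "('s, 'n) module \<Rightarrow> ('r, 'm \<Rightarrow> 'n) module" where
  "Hom_module N = with_smult (hom_group S M N) (\<lambda>r f. \<lambda>x\<in>carrier M. f (act r x))"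

lemma left_module_Hom_module:
  assumes N: "left_module S N"
  shows "left_module Q (Hom_module N)"
proof -
  interpret M: left_module S M by (rule M)
  interpret N: left_module S N by fact
  interpret Q: ring Q by (rule Q)
  have "abelian_group (Hom_module N)"
    unfolding Hom_module_def by (intro abelian_group_with_smult abelian_group_hom_group' M N)
  moreover have "(\<lambda>x\<in>carrier M. f (act r x)) \<in> mod_hom S M N"
    if "r \<in> carrier Q" "f \<in> mod_hom S M N" for r f
    using that module_map_compose[OF act_map, of r N f]
    by (simp add: module_map_restrict[OF M] mod_hom_iff[of f])
  ultimately show ?thesis
    unfolding left_module_def left_module_axioms_def
    using Q
    by (auto simp: Hom_module_def act_add act_mult act_one module_map_closed[OF act_map]
        mod_hom_iff module_map_add module_map_closed intro!: restrict_ext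
        intro: extensionalityI[where A = "carrier M"])
qed

end

text \<open>\<open>T\<close> plays the role of the tensor product of \<open>W\<close> and \<open>M\<close>, and \<open>t\<close> that of the pure tensors.  Working with the universal
  property alone covers both orders of the tensor factors.\<close>

locale universal_balanced_map = bimodule_action S Q M act
  for S :: "'s ring" and Q :: "'r ring" and M :: "('s, 'm, 'y) module_scheme" and act :: "'r \<Rightarrow> 'm \<Rightarrow> 'm" +
  fixes W :: "('r, 'w) module" and T :: "('s, 't) module" and t :: "'w \<Rightarrow> 'm \<Rightarrow> 't" and N :: "('s, 'n) module"
  assumes W: "left_module Q W" and T: "left_module S T" and N: "left_module S N"
    and t: "balanced_map Q W M act T t"
    and t_smult: "\<lbrakk>s \<in> carrier S; w \<in> carrier W; m \<in> carrier M\<rbrakk> \<Longrightarrow> t w (s \<odot>\<^bsub>M\<^esub> m) = s \<odot>\<^bsub>T\<^esub> t w m"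
    and ext: "\<lbrakk>additive_map T N f; additive_map T N g;
      \<And>w m. w \<in> carrier W \<Longrightarrow> m \<in> carrier M \<Longrightarrow> f (t w m) = g (t w m); X \<in> carrier T\<rbrakk> \<Longrightarrow> f X = g X"
    and lift: "balanced_map Q W M act N b \<Longrightarrow>
      \<exists>h. additive_map T N h \<and> (\<forall>w\<in>carrier W. \<forall>m\<in>carrier M. h (t w m) = b w m)"
begin

definition curry_hom :: "('t \<Rightarrow> 'n) \<Rightarrow> 'w \<Rightarrow> 'm \<Rightarrow> 'n" where
  "curry_hom h = (\<lambda>w\<in>carrier W. \<lambda>m\<in>carrier M. h (t w m))"

lemma curry_hom_closed:
  assumes h: "h \<in> mod_hom S T N"
  shows "curry_hom h \<in> mod_hom Q W (Hom_module N)"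
proof -
  interpret M: left_module S M by (rule M)
  interpret W: left_module Q W by (rule W)
  have hm: "module_map S T N h"
    using h by (simp add: mod_hom_iff)
  have c: "(\<lambda>m\<in>carrier M. h (t w m)) \<in> mod_hom S M N" if "w \<in> carrier W" for w
    using that module_map_closed[OF hm] module_map_add[OF hm] module_map_smult[OF hm]
    unfolding module_map_restrict[OF M]
    by (intro module_mapI) (auto simp: balanced_mapD[OF t] t_smult)
  have "module_map Q W (Hom_module N) (\<lambda>w. \<lambda>m\<in>carrier M. h (t w m))"
    using c module_map_add[OF hm] module_map_closed[OF act_map]
    by (intro module_mapI)
      (auto simp: Hom_module_def balanced_mapD[OF t] intro!: restrict_ext)
  then show ?thesis
    unfolding curry_hom_def by (simp add: module_map_restrict[OF W])
qed

text \<open>Uniqueness of maps out of \<open>T\<close> makes currying injective and their existence makes it surjective;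
  the lift is \<open>S\<close>-linear because \<open>X \<mapsto> h (s X)\<close> and \<open>X \<mapsto> s h(X)\<close> agree on pure tensors.\<close>

theorem bij_betw_curry_hom:
  "bij_betw curry_hom (mod_hom S T N) (mod_hom Q W (Hom_module N))"
proof (rule bij_betwI')
  interpret M: left_module S M by (rule M)
  interpret W: left_module Q W by (rule W)
  interpret T: left_module S T by (rule T)
  interpret N: left_module S N by (rule N)
  fix h h' assume h: "h \<in> mod_hom S T N" and h': "h' \<in> mod_hom S T N"
  have hm: "module_map S T N h" "module_map S T N h'"
    using h h' by (simp_all add: mod_hom_iff)
  have "h = h'" if eq: "curry_hom h = curry_hom h'"
  proof (rule mod_hom_eqI[OF h h'])
    fix X assume "X \<in> carrier T"
    then show "h X = h' X"
    proof (rule ext[rotated -1])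
      fix w m assume wm: "w \<in> carrier W" "m \<in> carrier M"
      show "h (t w m) = h' (t w m)"
        using fun_cong[OF fun_cong[OF eq, of w], of m] wm by (simp add: curry_hom_def)
    qed (auto intro: hm[THEN module_map_additive_map])
  qed
  then show "curry_hom h = curry_hom h' \<longleftrightarrow> h = h'" by blast
next
  fix h assume "h \<in> mod_hom S T N"
  then show "curry_hom h \<in> mod_hom Q W (Hom_module N)" by (rule curry_hom_closed)
next
  interpret M: left_module S M by (rule M)
  interpret W: left_module Q W by (rule W)
  interpret T: left_module S T by (rule T)
  interpret N: left_module S N by (rule N)
  fix f assume f: "f \<in> mod_hom Q W (Hom_module N)"
  have fm: "module_map Q W (Hom_module N) f"
    using f by (simp add: mod_hom_iff)
  have fw: "module_map S M N (f w)" "f w \<in> extensional (carrier M)" if "w \<in> carrier W" for w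
    using module_map_closed[OF fm that] by (auto simp: Hom_module_def mod_hom_iff)
  have f_add: "f (w \<oplus>\<^bsub>W\<^esub> w') m = f w m \<oplus>\<^bsub>N\<^esub> f w' m"
    if "w \<in> carrier W" "w' \<in> carrier W" "m \<in> carrier M" for w w' m
    using module_map_add[OF fm that(1,2)] that by (simp add: Hom_module_def)
  have f_smult: "f (r \<odot>\<^bsub>W\<^esub> w) m = f w (act r m)"
    if "r \<in> carrier Q" "w \<in> carrier W" "m \<in> carrier M" for r w m
    using module_map_smult[OF fm that(1,2)] that by (simp add: Hom_module_def)
  have "balanced_map Q W M act N f"
    unfolding balanced_map_def
    using fw(1)[THEN module_map_additive_map] fw(1)[THEN module_map_closed] f_add f_smult
    by (auto intro: additive_mapI)
  then obtain h where h: "additive_map T N h"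
    "\<And>w m. w \<in> carrier W \<Longrightarrow> m \<in> carrier M \<Longrightarrow> h (t w m) = f w m"
    using lift by blast
  note hc = additive_map_closed[OF h(1)] and ha = additive_map_add[OF h(1)]
  have "h (s \<odot>\<^bsub>T\<^esub> X) = s \<odot>\<^bsub>N\<^esub> h X" if s: "s \<in> carrier S" and "X \<in> carrier T" for s X
    using \<open>X \<in> carrier T\<close>
  proof (rule ext[where f = "\<lambda>X. h (s \<odot>\<^bsub>T\<^esub> X)" and g = "\<lambda>X. s \<odot>\<^bsub>N\<^esub> h X", rotated -1])
    fix w m assume wm: "w \<in> carrier W" "m \<in> carrier M"
    show "h (s \<odot>\<^bsub>T\<^esub> t w m) = s \<odot>\<^bsub>N\<^esub> h (t w m)"
      using wm s module_map_smult[OF fw(1)[OF wm(1)] s wm(2)]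
      by (simp add: h(2) M.smult_closed flip: t_smult)
  qed (use s in \<open>auto intro!: additive_mapI simp: hc ha T.smult_closed N.smult_closed T.smult_r_distr N.smult_r_distr\<close>)
  then have "restrict h (carrier T) \<in> mod_hom S T N"
    using hc ha unfolding module_map_restrict[OF T] by (intro module_mapI) auto
  moreover have "f = curry_hom (restrict h (carrier T))"
  proof (rule extensionalityI[where A = "carrier W"])
    show "f \<in> extensional (carrier W)" using f by (simp add: mod_hom_iff)
    show "curry_hom (restrict h (carrier T)) \<in> extensional (carrier W)"
      by (simp add: curry_hom_def)
    fix w assume w: "w \<in> carrier W"
    show "f w = curry_hom (restrict h (carrier T)) w"
      using w fw(2)[OF w] h(2)[OF w]
      by (intro extensionalityI[where A = "carrier M"]) (auto simp: curry_hom_def balanced_mapD(1)[OF t])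
  qed
  ultimately show "\<exists>h\<in>mod_hom S T N. f = curry_hom h" by blast
qed

lemma curry_hom_add:
  "curry_hom (h \<oplus>\<^bsub>hom_group S T N\<^esub> h') =
    curry_hom h \<oplus>\<^bsub>hom_group Q W (Hom_module N)\<^esub> curry_hom h'"
  by (auto simp: curry_hom_def Hom_module_def balanced_mapD(1)[OF t] intro!: restrict_ext)

end

text \<open>Currying is natural in \<open>W\<close>, hence an isomorphism of complexes; by injectivity of \<open>N\<close> the
  complex \<open>Hom(T, N)\<close> computes the dual of the cohomology of \<open>T\<close>.\<close>

theorem rel_Ext_Hom_module:
  fixes W :: "nat \<Rightarrow> ('r, 'w) module" and T :: "nat \<Rightarrow> ('s, 't) module"
  assumes U: "\<And>n. universal_balanced_map S Q M act (W n) (T n) (t n) N"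
    and T: "cochain_complex S T dT" and inj: "injective_left S N"
    and dW: "\<And>n w. w \<in> carrier (W n) \<Longrightarrow> d n w \<in> carrier (W (Suc n))"
    and nat: "\<And>n w m. w \<in> carrier (W n) \<Longrightarrow> m \<in> carrier M \<Longrightarrow> dT n (t n w m) = t (Suc n) (d n w) m"
  shows "add_monoid (rel_Ext Q W d (bimodule_action.Hom_module S M act N) n) \<cong>
    add_monoid (hom_group S (cohomology_module T dT n) N)"
proof -
  let ?H = "homology (\<lambda>n. hom_group S (T n) N) (\<lambda>n. hom_precomp (T n) (dT n)) n"
  let ?curry = "\<lambda>k. universal_balanced_map.curry_hom M (W k) (t k)"
  interpret T: cochain_complex S T dT by fact
  interpret B: bimodule_action S Q M act
    using U by (rule universal_balanced_map.axioms(1))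
  have N: "left_module S N"
    using inj by (simp add: injective_left_def)
  have Wm: "left_module Q (W k)" for k
    using U by (rule universal_balanced_map.W)
  have "add_monoid ?H
      \<cong> add_monoid (homology (\<lambda>n. hom_group Q (W n) (B.Hom_module N)) (\<lambda>n. hom_precomp (W n) (d n)) n)"
  proof (rule homology_iso[where \<alpha> = ?curry])
    fix k
    show "abelian_group (hom_group S (T k) N)"
      by (rule abelian_group_hom_group'[OF T.module N])
    show "abelian_group (hom_group Q (W k) (B.Hom_module N))"
      by (rule abelian_group_hom_group'[OF Wm B.left_module_Hom_module[OF N]])
    show "bij_betw (?curry k)
        (carrier (hom_group S (T k) N)) (carrier (hom_group Q (W k) (B.Hom_module N)))"
      using universal_balanced_map.bij_betw_curry_hom[OF U] by simp
  next
    fix k h assume h: "h \<in> carrier (hom_group S (T (Suc k)) N)"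
    show "?curry k (hom_precomp (T k) (dT k) h) =
        hom_precomp (W k) (d k) (?curry (Suc k) h)"
      using dW nat balanced_mapD(1)[OF universal_balanced_map.t[OF U]]
      by (intro extensionalityI[where A = "carrier (W k)"])
        (auto simp: universal_balanced_map.curry_hom_def[OF U] hom_precomp_extensional intro!: restrict_ext)
  next
    fix k h assume h: "h \<in> carrier (hom_group S (T (Suc (Suc k))) N)"
    then have "h \<zero>\<^bsub>T (Suc (Suc k))\<^esub> = \<zero>\<^bsub>N\<^esub>"
      using module_map_zero[OF T.module N, of "Suc (Suc k)" h] by (simp add: mod_hom_iff)
    then show "hom_precomp (T k) (dT k) (hom_precomp (T (Suc k)) (dT (Suc k)) h) = \<zero>\<^bsub>hom_group S (T k) N\<^esub>"
      by (intro extensionalityI[where A = "carrier (T k)"])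
        (auto simp: hom_precomp_extensional T.closed T.square_zero)
  next
    show "additive_map (hom_group S (T (Suc k)) N) (hom_group S (T k) N) (hom_precomp (T k) (dT k))" for k
      by (rule additive_map_hom_precomp[OF T.module T.map])
    show "additive_map (hom_group S (T k) N) (hom_group Q (W k) (B.Hom_module N))
        (?curry k)" for k
      using universal_balanced_map.curry_hom_closed[OF U] universal_balanced_map.curry_hom_add[OF U]
      by (intro additive_mapI) auto
  qed
  note iso = this
  have grp: "group (add_monoid ?H)"
    unfolding T.homology_hom[OF N]
    by (intro abelian_group.a_group abelian_group_subquotient abelian_group_hom_group' T.module N
        T.additive_subgroup_hom_cycles T.additive_subgroup_hom_boundaries
        T.hom_boundaries_subset_hom_cycles)
  have "add_monoid (rel_Ext Q W d (B.Hom_module N) n) \<cong>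
      add_monoid ?H"
    unfolding rel_Ext_def by (rule group.iso_sym[OF grp iso])
  also have "\<dots> \<cong> add_monoid (hom_group S (cohomology_module T dT n) N)"
    by (rule T.homology_hom_iso_hom_cohomology[OF inj])
  finally show ?thesis .
qed

section \<open>Weak injective and weak flat modules under retracts\<close>

lemma subquotient_trivial_iff:
  assumes G: "abelian_group G" and B: "additive_subgroup B G" and Z: "Z \<subseteq> carrier G" "Z \<noteq> {}"
  shows "carrier (subquotient G Z B) = {\<zero>\<^bsub>subquotient G Z B\<^esub>} \<longleftrightarrow> Z \<subseteq> B"
proof -
  have "(\<lambda>z. B +>\<^bsub>G\<^esub> z) ` Z = {B} \<longleftrightarrow> (\<forall>z\<in>Z. B +>\<^bsub>G\<^esub> z = B)"
    using Z(2) by blast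
  also have "\<dots> \<longleftrightarrow> (\<forall>z\<in>Z. z \<in> B)"
    using coset_eq_self_iff[OF G B] Z(1) by blast
  finally show ?thesis
    unfolding subquotient_simps by blast
qed

lemma projective_resolutionD:
  assumes "projective_resolution R P d e F"
  shows "left_module R (P n)" "module_map R (P (Suc n)) (P n) (d n)"
  using assms by (auto simp: projective_resolution_def projective_def mod_hom_iff)

text \<open>Vanishing of a subquotient means that all cycles are boundaries; in this form it visibly passes
  to retracts.\<close>

lemma Ext_1_trivial_iff:
  assumes P: "projective_resolution R P d e F" and M: "left_module R M"
  shows "carrier (Ext R P d M 1) = {\<zero>\<^bsub>Ext R P d M 1\<^esub>} \<longleftrightarrow>
    (\<forall>f. module_map R (P 1) M f \<longrightarrow> (\<forall>x\<in>carrier (P 2). f (d 1 x) = \<zero>\<^bsub>M\<^esub>) \<longrightarrow>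
      (\<exists>k. module_map R (P 0) M k \<and> (\<forall>x\<in>carrier (P 1). f x = k (d 0 x))))"
    (is "?L \<longleftrightarrow> ?R")
proof -
  note Pm = projective_resolutionD(1)[OF P] and dm = projective_resolutionD(2)[OF P]
  define Z where "Z = {z \<in> mod_hom R (P 1) M. hom_precomp (P 2) (d 1) z = (\<lambda>x\<in>carrier (P 2). \<zero>\<^bsub>M\<^esub>)}"
  define B where "B = hom_precomp (P 1) (d 0) ` mod_hom R (P 0) M"
  have Z: "f \<in> Z \<longleftrightarrow> f \<in> mod_hom R (P 1) M \<and> (\<forall>x\<in>carrier (P 2). f (d 1 x) = \<zero>\<^bsub>M\<^esub>)" for f
    by (auto simp: Z_def hom_precomp_def compose_def restrict_def fun_eq_iff)
  have Ext: "Ext R P d M 1 = subquotient (hom_group R (P 1) M) Z B"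
    by (simp add: Ext_def cohomology_def coboundaries_def Z_def B_def numeral_2_eq_2)
  have G: "abelian_group (hom_group R (P n) M)" for n
    by (rule abelian_group_hom_group'[OF Pm M])
  have "additive_subgroup (hom_precomp (P 1) (d 0) ` carrier (hom_group R (P 0) M)) (hom_group R (P 1) M)"
    using additive_map_hom_precomp[OF Pm dm[of 0]] by (intro additive_subgroup_image G) simp
  then have B: "additive_subgroup B (hom_group R (P 1) M)"
    by (simp add: B_def)
  have "restrict (\<lambda>x. \<zero>\<^bsub>M\<^esub>) (carrier (P 1)) \<in> Z"
    using module_map_null[OF M, of "P 1"] module_map_closed[OF dm[of 1]]
    by (simp add: Z module_map_restrict[OF Pm] numeral_2_eq_2)
  then have "?L \<longleftrightarrow> Z \<subseteq> B"
    unfolding Ext by (intro subquotient_trivial_iff G B) (auto simp: Z_def)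
  also have "\<dots> \<longleftrightarrow> ?R"
  proof (intro iffI allI impI subsetI)
    fix f assume sub: "Z \<subseteq> B" and f: "module_map R (P 1) M f" "\<forall>x\<in>carrier (P 2). f (d 1 x) = \<zero>\<^bsub>M\<^esub>"
    have "restrict f (carrier (P 1)) \<in> Z"
      using f module_map_closed[OF dm[of 1]] by (simp add: Z module_map_restrict[OF Pm] numeral_2_eq_2)
    then obtain k where k: "k \<in> mod_hom R (P 0) M" "restrict f (carrier (P 1)) = hom_precomp (P 1) (d 0) k"
      using sub by (auto simp: B_def)
    have "f x = k (d 0 x)" if "x \<in> carrier (P 1)" for x
      using fun_cong[OF k(2), of x] that by simp
    then show "\<exists>k. module_map R (P 0) M k \<and> (\<forall>x\<in>carrier (P 1). f x = k (d 0 x))"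
      using k(1) by (auto simp: mod_hom_iff)
  next
    fix f assume R: ?R and "f \<in> Z"
    then have f: "module_map R (P 1) M f" "f \<in> extensional (carrier (P 1))"
      "\<forall>x\<in>carrier (P 2). f (d 1 x) = \<zero>\<^bsub>M\<^esub>"
      by (auto simp: Z mod_hom_iff)
    then obtain k where k: "module_map R (P 0) M k" "\<forall>x\<in>carrier (P 1). f x = k (d 0 x)"
      using R by blast
    have "f = hom_precomp (P 1) (d 0) (restrict k (carrier (P 0)))"
      using f(2) k(2) module_map_closed[OF dm[of 0]]
      by (intro extensionalityI[where A = "carrier (P 1)"]) (auto simp: hom_precomp_extensional)
    then show "f \<in> B"
      using k(1) by (auto simp: B_def module_map_restrict[OF Pm])
  qed
  finally show ?thesis .
qed

lemma weak_injective_retract: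
  assumes M: "weak_injective R M" and N: "left_module R N"
    and i: "module_map R N M i" and p: "module_map R M N p" and pi: "\<And>y. y \<in> carrier N \<Longrightarrow> p (i y) = y"
  shows "weak_injective R N"
  unfolding weak_injective_def
proof (intro conjI N allI impI)
  fix F :: "('a, (nat \<Rightarrow> 'a) set) module" and P :: "nat \<Rightarrow> ('a, nat \<Rightarrow> 'a) module" and d e
  assume F: "super_finitely_presented R F" and P: "projective_resolution R P d e F"
  have Mm: "left_module R M"
    using M by (simp add: weak_injective_def)
  have trivial: "carrier (Ext R P d M 1) = {\<zero>\<^bsub>Ext R P d M 1\<^esub>}"
    using M F P unfolding weak_injective_def by blast
  note factor = trivial[unfolded Ext_1_trivial_iff[OF P Mm], rule_format]
  show "carrier (Ext R P d N 1) = {\<zero>\<^bsub>Ext R P d N 1\<^esub>}"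
    unfolding Ext_1_trivial_iff[OF P N]
  proof (intro allI impI)
    fix f assume f: "module_map R (P 1) N f" and zero: "\<forall>x\<in>carrier (P 2). f (d 1 x) = \<zero>\<^bsub>N\<^esub>"
    obtain k where k: "module_map R (P 0) M k" "\<forall>x\<in>carrier (P 1). i (f x) = k (d 0 x)"
      using factor[OF module_map_compose[OF f i]] zero module_map_zero[OF N Mm i] by auto
    then show "\<exists>k. module_map R (P 0) N k \<and> (\<forall>x\<in>carrier (P 1). f x = k (d 0 x))"
      using module_map_compose[OF k(1) p] pi module_map_closed[OF f]
      by (intro exI[of _ "\<lambda>x. p (k x)"]) (metis (no_types, lifting))
  qed
qed

lemma tensor_factors_right_left:
  "right_module R M \<Longrightarrow> left_module R N \<Longrightarrow> tensor_factors R M N"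
  by (simp add: tensor_factors_def right_module_def left_module_def right_module_axioms_def
      left_module_axioms_def)

lemma tensor_factors_mapI:
  "\<lbrakk>right_module R M; left_module R N; right_module R M'; left_module R N';
    module_map R M M' f; module_map R N N' g\<rbrakk> \<Longrightarrow> tensor_factors_map R M N M' N' f g"
  by (simp add: tensor_factors_map_def tensor_factors_map_axioms_def tensor_factors_right_left)

lemma Tor_1_trivial_iff:
  assumes P: "projective_resolution R P d e F" and M: "right_module R M"
  shows "carrier (Tor R M P d 1) = {\<zero>\<^bsub>Tor R M P d 1\<^esub>} \<longleftrightarrow>
    (\<forall>X\<in>carrier (tensor R M (P 1)). tensor_map R M (P 0) (\<lambda>x. x) (d 0) X = \<zero>\<^bsub>tensor R M (P 0)\<^esub> \<longrightarrow>
      X \<in> tensor_map R M (P 1) (\<lambda>x. x) (d 1) ` carrier (tensor R M (P 2)))"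
    (is "?L \<longleftrightarrow> ?R")
proof -
  note Pm = projective_resolutionD(1)[OF P] and dm = projective_resolutionD(2)[OF P]
  have TM: "tensor_factors_map R M (P (Suc n)) M (P n) (\<lambda>x. x) (d n)" for n
    by (intro tensor_factors_mapI M Pm dm module_map_ident)
  note add = tensor_factors_map.additive_map_tensor_map[OF TM]
  have G: "abelian_group (tensor R M (P n))" for n
    by (rule tensor_factors.abelian_group_tensor[OF tensor_factors_right_left[OF M Pm]])
  define Z where "Z = {X \<in> carrier (tensor R M (P 1)).
    tensor_map R M (P 0) (\<lambda>x. x) (d 0) X = \<zero>\<^bsub>tensor R M (P 0)\<^esub>}"
  define B where "B = tensor_map R M (P 1) (\<lambda>x. x) (d 1) ` carrier (tensor R M (P 2))"
  have Tor: "Tor R M P d 1 = subquotient (tensor R M (P 1)) Z B"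
    by (simp add: Tor_def homology_def Z_def B_def numeral_2_eq_2)
  have B: "additive_subgroup B (tensor R M (P 1))"
    unfolding B_def
    using add[of 1] by (intro additive_subgroup_image G) (simp add: numeral_2_eq_2)
  have "additive_subgroup Z (tensor R M (P 1))"
    unfolding Z_def
    using add[of 0] by (intro additive_subgroup_kernel G) simp
  then have "Z \<noteq> {}"
    using additive_subgroup.zero_closed by blast
  then have "?L \<longleftrightarrow> Z \<subseteq> B"
    unfolding Tor by (intro subquotient_trivial_iff G B) (auto simp: Z_def)
  then show ?thesis
    unfolding Z_def B_def by blast
qed

text \<open>A cycle \<open>X\<close> with coefficients in \<open>N\<close> is included into \<open>M\<close>, where it is the
  boundary of some \<open>V\<close>; then \<open>X\<close> is the boundary of the projection of \<open>V\<close>.\<close>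

lemma weak_flat_retract:
  assumes M: "weak_flat R M" and N: "right_module R N"
    and i: "module_map R N M i" and p: "module_map R M N p" and pi: "\<And>y. y \<in> carrier N \<Longrightarrow> p (i y) = y"
  shows "weak_flat R N"
  unfolding weak_flat_def
proof (intro conjI N allI impI)
  fix F :: "('a, (nat \<Rightarrow> 'a) set) module" and P :: "nat \<Rightarrow> ('a, nat \<Rightarrow> 'a) module" and d e
  assume F: "super_finitely_presented R F" and P: "projective_resolution R P d e F"
  note Pm = projective_resolutionD(1)[OF P] and dm = projective_resolutionD(2)[OF P]
  have Mm: "right_module R M"
    using M by (simp add: weak_flat_def)
  have trivial: "carrier (Tor R M P d 1) = {\<zero>\<^bsub>Tor R M P d 1\<^esub>}"
    using M F P unfolding weak_flat_def by blast
  note exact = trivial[unfolded Tor_1_trivial_iff[OF P Mm], rule_format]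
  have iM: "tensor_factors_map R N (P n) M (P n) i (\<lambda>y. y)" for n
    by (intro tensor_factors_mapI N Mm Pm i module_map_ident)
  have pM: "tensor_factors_map R M (P n) N (P n) p (\<lambda>y. y)" for n
    by (intro tensor_factors_mapI N Mm Pm p module_map_ident)
  have dN: "tensor_factors_map R N (P (Suc n)) N (P n) (\<lambda>x. x) (d n)" for n
    by (intro tensor_factors_mapI N Pm dm module_map_ident)
  have dM: "tensor_factors_map R M (P (Suc n)) M (P n) (\<lambda>x. x) (d n)" for n
    by (intro tensor_factors_mapI Mm Pm dm module_map_ident)
  note TN = tensor_factors_right_left[OF N Pm] and TM = tensor_factors_right_left[OF Mm Pm]
  show "carrier (Tor R N P d 1) = {\<zero>\<^bsub>Tor R N P d 1\<^esub>}"
    unfolding Tor_1_trivial_iff[OF P N]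
  proof (intro ballI impI)
    fix X assume X: "X \<in> carrier (tensor R N (P 1))"
      and zero: "tensor_map R N (P 0) (\<lambda>x. x) (d 0) X = \<zero>\<^bsub>tensor R N (P 0)\<^esub>"
    define Y where "Y = tensor_map R M (P 1) i (\<lambda>y. y) X"
    have Y: "Y \<in> carrier (tensor R M (P 1))"
      unfolding Y_def by (rule tensor_factors_map.tensor_map_closed[OF iM X])
    have "tensor_map R M (P 0) (\<lambda>x. x) (d 0) Y = tensor_map R M (P 0) i (d 0) X"
      unfolding Y_def using X dM[of 0] by (subst tensor_map_compose[OF iM]) simp_all
    also have "\<dots> = tensor_map R M (P 0) i (\<lambda>y. y) (tensor_map R N (P 0) (\<lambda>x. x) (d 0) X)"
      using X dN[of 0] by (subst tensor_map_compose[OF _ iM]) simp_all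
    also have "\<dots> = \<zero>\<^bsub>tensor R M (P 0)\<^esub>"
      unfolding zero
      by (rule additive_zero[OF tensor_factors.abelian_group_tensor[OF TN]
          tensor_factors.abelian_group_tensor[OF TM] tensor_factors_map.additive_map_tensor_map[OF iM]])
    finally obtain V where V: "V \<in> carrier (tensor R M (P 2))" "Y = tensor_map R M (P 1) (\<lambda>x. x) (d 1) V"
      using exact[OF Y] by blast
    have "X = tensor_map R N (P 1) p (\<lambda>y. y) Y"
      unfolding Y_def using X
      by (subst tensor_map_compose[OF iM pM])
        (simp_all add: tensor_factors.tensor_map_ident[OF TN] pi)
    also have "\<dots> = tensor_map R N (P 1) p (d 1) V"
      unfolding V(2) using V(1) dM[of 1]
      by (subst tensor_map_compose[OF _ pM]) (simp_all add: numeral_2_eq_2)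
    also have "\<dots> = tensor_map R N (P 1) (\<lambda>x. x) (d 1) (tensor_map R N (P 2) p (\<lambda>y. y) V)"
      using V(1) dN[of 1] by (subst tensor_map_compose[OF pM]) (simp_all add: numeral_2_eq_2)
    finally show "X \<in> tensor_map R N (P 1) (\<lambda>x. x) (d 1) ` carrier (tensor R N (P 2))"
      using tensor_factors_map.tensor_map_closed[OF pM V(1)] by blast
  qed
qed

section \<open>Tensoring a complex with a bimodule\<close>

text \<open>The two factors may both vary, so that one statement serves complexes in the first and in the
  second factor; the other factor then carries the identity.\<close>

lemma cochain_complex_tensor:
  assumes fg: "\<And>n. tensor_factors_map R (A n) (B n) (A (Suc n)) (B (Suc n)) (f n) (g n)"
    and mod: "\<And>n. left_module S (with_smult (tensor R (A n) (B n)) (\<lambda>s. tensor_map R (A n) (B n) (p n s) (q n s)))"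
    and p: "\<And>n s. s \<in> carrier S \<Longrightarrow> module_map R (A n) (A n) (p n s)"
    and q: "\<And>n s. s \<in> carrier S \<Longrightarrow> module_map R (B n) (B n) (q n s)"
    and fp: "\<And>n s x. s \<in> carrier S \<Longrightarrow> x \<in> carrier (A n) \<Longrightarrow> f n (p n s x) = p (Suc n) s (f n x)"
    and gq: "\<And>n s y. s \<in> carrier S \<Longrightarrow> y \<in> carrier (B n) \<Longrightarrow> g n (q n s y) = q (Suc n) s (g n y)"
    and zero: "\<And>n x y. x \<in> carrier (A n) \<Longrightarrow> y \<in> carrier (B n) \<Longrightarrow>
      tensor_factors.pure_tensor R (A (Suc (Suc n))) (B (Suc (Suc n))) (f (Suc n) (f n x)) (g (Suc n) (g n y))
      = \<zero>\<^bsub>tensor R (A (Suc (Suc n))) (B (Suc (Suc n)))\<^esub>"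
  shows "cochain_complex S
    (\<lambda>n. with_smult (tensor R (A n) (B n)) (\<lambda>s. tensor_map R (A n) (B n) (p n s) (q n s)))
    (\<lambda>n. tensor_map R (A (Suc n)) (B (Suc n)) (f n) (g n))"
proof -
  let ?T = "\<lambda>n. tensor R (A n) (B n)" and ?d = "\<lambda>n. tensor_map R (A (Suc n)) (B (Suc n)) (f n) (g n)"
    and ?act = "\<lambda>n s. tensor_map R (A n) (B n) (p n s) (q n s)"
  note TF = tensor_factors_map.axioms(1)[OF fg]
  have pq: "tensor_factors_map R (A n) (B n) (A n) (B n) (p n s) (q n s)" if "s \<in> carrier S" for n s
    using p[OF that] q[OF that] TF by (simp add: tensor_factors_map_def tensor_factors_map_axioms_def)
  note am_fg = tensor_factors_map.additive_map_tensor_map[OF fg]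
    and am_pq = tensor_factors_map.additive_map_tensor_map[OF pq]
  note pu = tensor_factors_map.tensor_map_pure[OF fg] tensor_factors_map.tensor_map_pure[OF pq]
  have fc: "f n x \<in> carrier (A (Suc n))" if "x \<in> carrier (A n)" for n x
    by (rule module_map_closed[OF tensor_factors_map.f[OF fg] that])
  have gc: "g n x \<in> carrier (B (Suc n))" if "x \<in> carrier (B n)" for n x
    by (rule module_map_closed[OF tensor_factors_map.g[OF fg] that])
  have comm: "?d n (?act n s X)
    = ?act (Suc n) s
        (?d n X)"
    if s: "s \<in> carrier S" and X: "X \<in> carrier (?T n)" for n s X
    by (rule tensor_factors.tensor_ext[OF TF tensor_factors.abelian_group_tensor[OF TF]
          additive_map_compose[OF am_pq[OF s] am_fg] additive_map_compose[OF am_fg am_pq[OF s]] _ X])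
      (simp_all add: pu s fc gc fp gq module_map_closed[OF p] module_map_closed[OF q])
  have sq: "?d (Suc n)
      (?d n X) = \<zero>\<^bsub>?T (Suc (Suc n))\<^esub>"
    if X: "X \<in> carrier (?T n)" for n X
  proof -
    interpret G: abelian_group "?T (Suc (Suc n))"
      by (rule tensor_factors.abelian_group_tensor[OF TF])
    show ?thesis
      by (rule tensor_factors.tensor_ext[OF TF G.abelian_group_axioms
            additive_map_compose[OF am_fg am_fg] _ _ X,
            where g = "\<lambda>X. \<zero>\<^bsub>?T (Suc (Suc n))\<^esub>"])
        (simp_all add: additive_map_def pu fc gc zero)
  qed
  show ?thesis
    unfolding cochain_complex_def
    using mod comm sq
    by (auto intro!: module_mapI simp: additive_map_closed[OF am_fg] additive_map_add[OF am_fg])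
qed

lemma right_moduleD:
  assumes "right_module R M"
  shows "abelian_group M" "ring R"
    "\<And>a x. \<lbrakk>a \<in> carrier R; x \<in> carrier M\<rbrakk> \<Longrightarrow> a \<odot>\<^bsub>M\<^esub> x \<in> carrier M"
    "\<And>a b x. \<lbrakk>a \<in> carrier R; b \<in> carrier R; x \<in> carrier M\<rbrakk> \<Longrightarrow>
       (a \<oplus>\<^bsub>R\<^esub> b) \<odot>\<^bsub>M\<^esub> x = a \<odot>\<^bsub>M\<^esub> x \<oplus>\<^bsub>M\<^esub> b \<odot>\<^bsub>M\<^esub> x"
    "\<And>a x y. \<lbrakk>a \<in> carrier R; x \<in> carrier M; y \<in> carrier M\<rbrakk> \<Longrightarrow>
       a \<odot>\<^bsub>M\<^esub> (x \<oplus>\<^bsub>M\<^esub> y) = a \<odot>\<^bsub>M\<^esub> x \<oplus>\<^bsub>M\<^esub> a \<odot>\<^bsub>M\<^esub> y"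
    "\<And>a b x. \<lbrakk>a \<in> carrier R; b \<in> carrier R; x \<in> carrier M\<rbrakk> \<Longrightarrow>
       (a \<otimes>\<^bsub>R\<^esub> b) \<odot>\<^bsub>M\<^esub> x = b \<odot>\<^bsub>M\<^esub> (a \<odot>\<^bsub>M\<^esub> x)"
    "\<And>x. x \<in> carrier M \<Longrightarrow> \<one>\<^bsub>R\<^esub> \<odot>\<^bsub>M\<^esub> x = x"
  using assms by (simp_all add: right_module_def right_module_axioms_def)

lemmas left_moduleD = left_module.smult_closed left_module.smult_l_distr left_module.smult_r_distr
  left_module.smult_assoc left_module.smult_one

lemma right_part_simps [simp]:
  "carrier (right_part M) = carrier M" "\<zero>\<^bsub>right_part M\<^esub> = \<zero>\<^bsub>M\<^esub>"
  "x \<oplus>\<^bsub>right_part M\<^esub> y = x \<oplus>\<^bsub>M\<^esub> y" "b \<odot>\<^bsub>right_part M\<^esub> x = right_smult M x b"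
  by (simp_all add: right_part_def)

lemma bimoduleD:
  assumes "bimodule A B M"
  shows "left_module A M" "right_module B (right_part M)"
    "\<lbrakk>a \<in> carrier A; b \<in> carrier B; x \<in> carrier M\<rbrakk> \<Longrightarrow>
      right_smult M (a \<odot>\<^bsub>M\<^esub> x) b = a \<odot>\<^bsub>M\<^esub> right_smult M x b"
  using assms by (auto simp: bimodule_def)

lemma bimodule_action_right:
  assumes M: "bimodule R S M"
  shows "bimodule_action (opposite_ring S) (opposite_ring R) (right_part M) (\<lambda>r x. r \<odot>\<^bsub>M\<^esub> x)"
  unfolding bimodule_action_def
  using bimoduleD[OF M] left_moduleD[OF bimoduleD(1)[OF M]] left_module_ring[OF bimoduleD(1)[OF M]]
  by (auto simp: right_module_iff_left_module intro!: module_mapI)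

lemma bimodule_action_left:
  assumes L: "bimodule S R L"
  shows "bimodule_action S R L (\<lambda>r x. right_smult L x r)"
  unfolding bimodule_action_def
  using bimoduleD[OF L] right_moduleD[OF bimoduleD(2)[OF L], simplified]
  by (auto intro!: module_mapI)

lemma Hom_right_eq_Hom_module:
  assumes "bimodule R S M"
  shows "Hom_right S M N =
    bimodule_action.Hom_module (opposite_ring S) (right_part M) (\<lambda>r x. r \<odot>\<^bsub>M\<^esub> x) N"
  by (simp add: bimodule_action.Hom_module_def[OF bimodule_action_right[OF assms]] Hom_right_def)

lemma Hom_left_eq_Hom_module:
  assumes "bimodule S R L"
  shows "Hom_left S L N = bimodule_action.Hom_module S L (\<lambda>r x. right_smult L x r) N"
  by (simp add: bimodule_action.Hom_module_def[OF bimodule_action_left[OF assms]] Hom_left_def)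

text \<open>The adjunction over the opposite rings, the universal balanced map being that of the pure
  tensors in \<open>W k \<otimes> M\<close>.\<close>

theorem rel_Ext_Hom_right:
  fixes R :: "'r ring" and S :: "'s ring" and M :: "('r, 's, 'm) bimod"
    and W :: "nat \<Rightarrow> ('r, 'u) module" and N :: "('s, 'n) module"
  assumes M: "bimodule R S M" and inj: "injective_right S N"
    and W: "cochain_complex (opposite_ring R) W d"
  shows "add_monoid (rel_Ext R W d (Hom_right S M N) n) \<cong>
    add_monoid (hom_group S (rel_Tor_right R W d M n) N)"
proof -
  interpret W: cochain_complex "opposite_ring R" W d by fact
  note Ml = bimoduleD(1)[OF M] and Mr = bimoduleD(2)[OF M] and comm = bimoduleD(3)[OF M]
  note MrD = right_moduleD[OF Mr, simplified]
  have S: "ring S" and R: "ring R"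
    using Mr Ml by (simp_all add: right_module_def left_module_def)
  have Wr: "right_module R (W k)" for k
    using W.module[of k] by (simp add: right_module_iff_left_module)
  have TF: "tensor_factors R (W k) M" for k
    by (rule tensor_factors_right_left[OF Wr Ml])
  have q: "module_map R M M (\<lambda>y. right_smult M y s)" if "s \<in> carrier S" for s
    using that MrD comm by (intro module_mapI) auto
  have Tm: "left_module (opposite_ring S) (tensor_right R (W k) M)" for k
    unfolding tensor_right_def
    using S MrD
    by (intro left_module_tensor_action TF)
      (auto simp: q module_map_ident tensor_factors.pure_tensor_add_right[OF TF])
  have T: "cochain_complex (opposite_ring S) (\<lambda>k. tensor_right R (W k) M)
      (\<lambda>k. tensor_map R (W (Suc k)) M (d k) (\<lambda>y. y))"
    unfolding tensor_right_def
  proof (rule cochain_complex_tensor[where A = W and B = "\<lambda>_. M" and f = d and g = "\<lambda>_ y. y"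
        and p = "\<lambda>_ _ x. x" and q = "\<lambda>_ s y. right_smult M y s"])
    show "tensor_factors_map R (W k) M (W (Suc k)) M (d k) (\<lambda>y. y)" for k
      using W.map[of k] by (intro tensor_factors_mapI Wr Ml module_map_ident) simp
    show "left_module (opposite_ring S) (with_smult (tensor R (W k) M)
        (\<lambda>s. tensor_map R (W k) M (\<lambda>x. x) (\<lambda>y. right_smult M y s)))" for k
      using Tm[of k] by (simp add: tensor_right_def)
  qed (auto simp: q module_map_ident W.square_zero tensor_factors.pure_tensor_zero_left[OF TF])
  note BA = bimodule_action_right[OF M]
  have injl: "injective_left (opposite_ring S) N"
    using inj by (simp add: injective_right_iff_injective_left)
  then have N: "left_module (opposite_ring S) N"
    by (simp add: injective_left_def)
  have U: "universal_balanced_map (opposite_ring S) (opposite_ring R) (right_part M) (\<lambda>r x. r \<odot>\<^bsub>M\<^esub> x)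
      (W k) (tensor_right R (W k) M) (tensor_factors.pure_tensor R (W k) M) N" for k
  proof (rule universal_balanced_map.intro[OF BA universal_balanced_map_axioms.intro[OF W.module Tm N]])
    let ?t = "tensor_factors.pure_tensor R (W k) M" and ?T = "tensor_right R (W k) M"
    show "balanced_map (opposite_ring R) (W k) (right_part M) (\<lambda>r x. r \<odot>\<^bsub>M\<^esub> x)
        (?T) (?t)"
      using tensor_factors.balanced_map_pure_tensor[OF TF, of k]
      by (simp add: balanced_map_def additive_map_def tensor_right_def)
    show "?t w (s \<odot>\<^bsub>right_part M\<^esub> m) =
        s \<odot>\<^bsub>?T\<^esub> ?t w m"
      if "s \<in> carrier (opposite_ring S)" "w \<in> carrier (W k)" "m \<in> carrier (right_part M)" for s w m
      using that by (simp add: tensor_right_def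
          tensor_factors_map.tensor_map_pure[OF tensor_factors_mapI[OF Wr Ml Wr Ml module_map_ident q]])
    show "f X = g X"
      if "additive_map (?T) N f" "additive_map (?T) N g"
        "\<And>w m. w \<in> carrier (W k) \<Longrightarrow> m \<in> carrier (right_part M) \<Longrightarrow>
          f (?t w m) = g (?t w m)"
        "X \<in> carrier (?T)" for f g X
      by (rule tensor_factors.tensor_ext[OF TF left_module_abelian_group[OF N], of k f g X])
        (use that in \<open>simp_all add: tensor_right_def additive_map_def\<close>)
    show "\<exists>h. additive_map (?T) N h \<and>
        (\<forall>w\<in>carrier (W k). \<forall>m\<in>carrier (right_part M).
          h (?t w m) = b w m)"
      if "balanced_map (opposite_ring R) (W k) (right_part M) (\<lambda>r x. r \<odot>\<^bsub>M\<^esub> x) N b" for b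
    proof -
      have "balanced_map R (W k) M (\<lambda>r x. r \<odot>\<^bsub>M\<^esub> x) N b"
        using that by (simp add: balanced_map_def additive_map_def)
      from tensor_factors.tensor_lift[OF TF left_module_abelian_group[OF N] this]
      obtain h where "additive_map (tensor R (W k) M) N h"
        "\<And>w m. w \<in> carrier (W k) \<Longrightarrow> m \<in> carrier M \<Longrightarrow> h (?t w m) = b w m"
        by blast
      then show ?thesis
        by (intro exI[of _ h]) (simp add: tensor_right_def additive_map_def)
    qed
  qed
  have "tensor_map R (W (Suc k)) M (d k) (\<lambda>y. y) (tensor_factors.pure_tensor R (W k) M w m) =
      tensor_factors.pure_tensor R (W (Suc k)) M (d k w) m"
    if "w \<in> carrier (W k)" "m \<in> carrier (right_part M)" for k w m
    using that W.map[of k]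
    by (subst tensor_factors_map.tensor_map_pure[OF tensor_factors_mapI[OF Wr Ml Wr Ml _ module_map_ident]])
      simp_all
  then show ?thesis
    unfolding Hom_right_eq_Hom_module[OF M]
    using rel_Ext_Hom_module[OF U T injl W.closed, where n = n]
    by (simp add: rel_Ext_opposite_ring rel_Tor_right_def)
qed

text \<open>Here the universal balanced map is that of the pure tensors in \<open>L \<otimes> V k\<close> with exchanged
  arguments.\<close>

theorem rel_Ext_Hom_left:
  fixes R :: "'r ring" and S :: "'s ring" and L :: "('s, 'r, 'l) bimod"
    and V :: "nat \<Rightarrow> ('r, 'u) module" and N :: "('s, 'n) module"
  assumes L: "bimodule S R L" and inj: "injective_left S N" and V: "cochain_complex R V d"
  shows "add_monoid (rel_Ext R V d (Hom_left S L N) n) \<cong>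
    add_monoid (hom_group S (rel_Tor_left R L V d n) N)"
proof -
  interpret V: cochain_complex R V d by fact
  note Ll = bimoduleD(1)[OF L] and Lr = bimoduleD(2)[OF L] and comm = bimoduleD(3)[OF L]
  note LD = left_moduleD[OF Ll]
  have S: "ring S" and R: "ring R"
    using Lr Ll by (simp_all add: right_module_def left_module_def)
  have TF: "tensor_factors R (right_part L) (V k)" for k
    by (rule tensor_factors_right_left[OF Lr V.module])
  have p: "module_map R (right_part L) (right_part L) (\<lambda>x. s \<odot>\<^bsub>L\<^esub> x)" if "s \<in> carrier S" for s
    using that LD comm by (intro module_mapI) auto
  have Tm: "left_module S (tensor_left R L (V k))" for k
    unfolding tensor_left_def
    using S LD
    by (intro left_module_tensor_action TF)
      (auto simp: p module_map_ident tensor_factors.pure_tensor_add_left[OF TF, simplified])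
  have T: "cochain_complex S (\<lambda>k. tensor_left R L (V k))
      (\<lambda>k. tensor_map R (right_part L) (V (Suc k)) (\<lambda>x. x) (d k))"
    unfolding tensor_left_def
  proof (rule cochain_complex_tensor[where A = "\<lambda>_. right_part L" and B = V and f = "\<lambda>_ x. x" and g = d
        and p = "\<lambda>_ s x. s \<odot>\<^bsub>L\<^esub> x" and q = "\<lambda>_ _ y. y"])
    show "tensor_factors_map R (right_part L) (V k) (right_part L) (V (Suc k)) (\<lambda>x. x) (d k)" for k
      by (intro tensor_factors_mapI Lr V.module V.map module_map_ident)
    show "left_module S (with_smult (tensor R (right_part L) (V k))
        (\<lambda>s. tensor_map R (right_part L) (V k) (\<lambda>x. s \<odot>\<^bsub>L\<^esub> x) (\<lambda>y. y)))" for k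
      using Tm[of k] by (simp add: tensor_left_def)
  qed (auto simp: p module_map_ident V.square_zero tensor_factors.pure_tensor_zero_right[OF TF])
  note BA = bimodule_action_left[OF L]
  have N: "left_module S N"
    using inj by (simp add: injective_left_def)
  have U: "universal_balanced_map S R L (\<lambda>r x. right_smult L x r) (V k) (tensor_left R L (V k))
      (\<lambda>v l. tensor_factors.pure_tensor R (right_part L) (V k) l v) N" for k
  proof (rule universal_balanced_map.intro[OF BA universal_balanced_map_axioms.intro[OF V.module Tm N]])
    let ?t = "tensor_factors.pure_tensor R (right_part L) (V k)" and ?T = "tensor_left R L (V k)"
    show "balanced_map R (V k) L (\<lambda>r x. right_smult L x r) (?T)
        (\<lambda>v l. ?t l v)"
      using tensor_factors.balanced_map_pure_tensor[OF TF, of k]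
      by (simp add: balanced_map_def additive_map_def tensor_left_def)
    show "?t (s \<odot>\<^bsub>L\<^esub> l) v =
        s \<odot>\<^bsub>?T\<^esub> ?t l v"
      if "s \<in> carrier S" "v \<in> carrier (V k)" "l \<in> carrier L" for s v l
      using that by (simp add: tensor_left_def tensor_factors_map.tensor_map_pure
          [OF tensor_factors_mapI[OF Lr V.module Lr V.module p module_map_ident]])
    show "f X = g X"
      if "additive_map (?T) N f" "additive_map (?T) N g"
        "\<And>v l. v \<in> carrier (V k) \<Longrightarrow> l \<in> carrier L \<Longrightarrow>
          f (?t l v) =
          g (?t l v)"
        "X \<in> carrier (?T)" for f g X
      by (rule tensor_factors.tensor_ext[OF TF left_module_abelian_group[OF N], of k f g X])
        (use that in \<open>simp_all add: tensor_left_def additive_map_def\<close>)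
    show "\<exists>h. additive_map (?T) N h \<and> (\<forall>v\<in>carrier (V k). \<forall>l\<in>carrier L.
          h (?t l v) = b v l)"
      if "balanced_map R (V k) L (\<lambda>r x. right_smult L x r) N b" for b
    proof -
      have "balanced_map R (right_part L) (V k) (\<lambda>r y. r \<odot>\<^bsub>V k\<^esub> y) N (\<lambda>l v. b v l)"
        using that by (simp add: balanced_map_def additive_map_def)
      from tensor_factors.tensor_lift[OF TF left_module_abelian_group[OF N] this]
      obtain h where "additive_map (tensor R (right_part L) (V k)) N h"
        "\<And>l v. l \<in> carrier (right_part L) \<Longrightarrow> v \<in> carrier (V k) \<Longrightarrow>
          h (?t l v) = b v l"
        by blast
      then show ?thesis
        by (intro exI[of _ h]) (simp add: tensor_left_def additive_map_def)
    qed
  qed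
  have "tensor_map R (right_part L) (V (Suc k)) (\<lambda>x. x) (d k)
      (tensor_factors.pure_tensor R (right_part L) (V k) l v) =
      tensor_factors.pure_tensor R (right_part L) (V (Suc k)) l (d k v)"
    if "v \<in> carrier (V k)" "l \<in> carrier L" for k v l
    using that by (subst tensor_factors_map.tensor_map_pure
        [OF tensor_factors_mapI[OF Lr V.module Lr V.module module_map_ident V.map]]) simp_all
  then show ?thesis
    unfolding Hom_left_eq_Hom_module[OF L]
    using rel_Ext_Hom_module[OF U T inj V.closed, where n = n]
    by (simp add: rel_Tor_left_def)
qed

section \<open>The duality between relative Ext and relative Tor\<close>

lemma weak_injective_copy_module:
  assumes M: "weak_injective R M" and inv: "\<And>x. \<psi> (\<phi> x) = x"
  shows "weak_injective R (copy_module \<phi> \<psi> M)"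
proof -
  have "left_module R M"
    using M by (simp add: weak_injective_def)
  note copy = left_module_copy_module[of R M \<psi> \<phi>, OF this inv]
  show ?thesis
    by (rule weak_injective_retract[OF M copy(1,3,2)]) (auto simp: copy_module_def inv)
qed

lemma weak_flat_copy_module:
  assumes M: "weak_flat R M" and inv: "\<And>x. \<psi> (\<phi> x) = x"
  shows "weak_flat R (copy_module \<phi> \<psi> M)"
proof -
  have "left_module (opposite_ring R) M"
    using M by (simp add: weak_flat_def right_module_iff_left_module)
  note copy = left_module_copy_module[of "opposite_ring R" M \<psi> \<phi>, OF this inv,
      folded right_module_iff_left_module, unfolded module_map_opposite_ring]
  show ?thesis
    by (rule weak_flat_retract[OF M copy(1,3,2)]) (auto simp: copy_module_def inv)
qed

theorem proposition2p6:
  fixes R :: "'r ring" and S :: "'s ring"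
  assumes "ring R" and "ring S"
  shows
    "(\<forall>(L :: ('r, 'l) module) (M :: ('r, 's, 'm) bimod) (N :: ('s, 'n) module).
        right_module R L \<and> bimodule R S M \<and> injective_right S N \<longrightarrow>
        (\<forall>e (W :: nat \<Rightarrow> ('r, 'u) module) d e' (W' :: nat \<Rightarrow> ('r, 'u) module) d'.
           right_WF_resolution R L e W d \<and> right_WF_resolution R L e' W' d' \<longrightarrow>
           (\<forall>n. add_monoid (rel_Ext R W d (Hom_right S M N) n) \<cong>
                add_monoid (hom_group S (rel_Tor_right R W' d' M n) N))))
     \<and>
     (\<forall>(L :: ('s, 'r, 'k) bimod) (M :: ('r, 'p) module) (N :: ('s, 'q) module).
        bimodule S R L \<and> left_module R M \<and> injective_left S N \<longrightarrow>
        (\<forall>e (W :: nat \<Rightarrow> ('r, 'v) module) d e' (W' :: nat \<Rightarrow> ('r, 'v) module) d'.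
           right_WI_resolution R M e W d \<and> right_WI_resolution R M e' W' d' \<longrightarrow>
           (\<forall>n. add_monoid (rel_Ext R W d (Hom_left S L N) n) \<cong>
                add_monoid (hom_group S (rel_Tor_left R L W' d' n) N))))"
proof (intro conjI allI impI; elim conjE)
  fix L :: "('r, 'l) module" and M :: "('r, 's, 'm) bimod" and N :: "('s, 'n) module"
    and e e' and W W' :: "nat \<Rightarrow> ('r, 'u) module" and d d' n
  assume L: "right_module R L" and M: "bimodule R S M" and N: "injective_right S N"
    and W: "right_WF_resolution R L e W d" and W': "right_WF_resolution R L e' W' d'"
  \<comment> \<open>An embedding of the type of the resolutions into that of the test modules.\<close>
  define \<phi> :: "'u \<Rightarrow> ('r + 'l + 'u) list" where "\<phi> u = [Inr (Inr u)]" for u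
  define \<psi> :: "('r + 'l + 'u) list \<Rightarrow> 'u" where "\<psi> l = projr (projr (hd l))" for l
  have inv: "\<psi> (\<phi> u) = u" for u
    by (simp add: \<phi>_def \<psi>_def)
  have flat: "left_module (opposite_ring R) A" if "weak_flat R A" for A :: "('r, 'u) module"
    using that by (simp add: weak_flat_def right_module_iff_left_module)
  have copy: "weak_flat R (copy_module \<phi> \<psi> A)" if "weak_flat R A" for A :: "('r, 'u) module"
    using that inv by (rule weak_flat_copy_module)
  note res = W[unfolded right_WF_resolution_def, folded right_resolution_opposite_ring[of R]]
  note res' = W'[unfolded right_WF_resolution_def, folded right_resolution_opposite_ring[of R]]
  have X: "left_module (opposite_ring R) (Hom_right S M N)"
    unfolding Hom_right_eq_Hom_module[OF M]
    using N by (intro bimodule_action.left_module_Hom_module[OF bimodule_action_right[OF M]])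
      (simp add: injective_right_def right_module_iff_left_module)
  have "add_monoid (rel_Ext R W d (Hom_right S M N) n) \<cong>
      add_monoid (rel_Ext R W' d' (Hom_right S M N) n)"
    unfolding rel_Ext_opposite_ring[of R, symmetric]
    by (rule rel_Ext_independent_of_resolution[where \<phi> = \<phi> and \<psi> = \<psi>, OF _ _ _ _ X res res'])
      (use L flat copy inv in \<open>simp_all add: right_module_iff_left_module\<close>)
  also have "\<dots> \<cong> add_monoid (hom_group S (rel_Tor_right R W' d' M n) N)"
    by (rule rel_Ext_Hom_right[OF M N right_resolution_cochain_complex[OF res' flat]])
  finally show "add_monoid (rel_Ext R W d (Hom_right S M N) n) \<cong>
      add_monoid (hom_group S (rel_Tor_right R W' d' M n) N)" .
next
  fix L :: "('s, 'r, 'k) bimod" and M :: "('r, 'p) module" and N :: "('s, 'q) module"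
    and e e' and W W' :: "nat \<Rightarrow> ('r, 'v) module" and d d' n
  assume L: "bimodule S R L" and M: "left_module R M" and N: "injective_left S N"
    and W: "right_WI_resolution R M e W d" and W': "right_WI_resolution R M e' W' d'"
  define \<phi> :: "'v \<Rightarrow> ('r + 'p + 'v) list" where "\<phi> u = [Inr (Inr u)]" for u
  define \<psi> :: "('r + 'p + 'v) list \<Rightarrow> 'v" where "\<psi> l = projr (projr (hd l))" for l
  have inv: "\<psi> (\<phi> u) = u" for u
    by (simp add: \<phi>_def \<psi>_def)
  have inj: "left_module R A" if "weak_injective R A" for A :: "('r, 'v) module"
    using that by (simp add: weak_injective_def)
  have copy: "weak_injective R (copy_module \<phi> \<psi> A)" if "weak_injective R A" for A :: "('r, 'v) module"
    using that inv by (rule weak_injective_copy_module)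
  note res = W[unfolded right_WI_resolution_def]
  note res' = W'[unfolded right_WI_resolution_def]
  have X: "left_module R (Hom_left S L N)"
    unfolding Hom_left_eq_Hom_module[OF L]
    using N by (intro bimodule_action.left_module_Hom_module[OF bimodule_action_left[OF L]])
      (simp add: injective_left_def)
  have "add_monoid (rel_Ext R W d (Hom_left S L N) n) \<cong>
      add_monoid (rel_Ext R W' d' (Hom_left S L N) n)"
    by (rule rel_Ext_independent_of_resolution[where \<phi> = \<phi> and \<psi> = \<psi>, OF _ _ _ M X res res'])
      (use inj copy inv in simp_all)
  also have "\<dots> \<cong> add_monoid (hom_group S (rel_Tor_left R L W' d' n) N)"
    by (rule rel_Ext_Hom_left[OF L N right_resolution_cochain_complex[OF res' inj]])
  finally show "add_monoid (rel_Ext R W d (Hom_left S L N) n) \<cong>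
      add_monoid (hom_group S (rel_Tor_left R L W' d' n) N)" .
qed

end
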